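(* Let $G$ be a connected plane bipartite graph with a perfect matching. Suppose that for every nice cycle $C$ of $G$ and every maximum resonant set $K$ of $I[C]$, the graph $I[C]-K$ has a unique perfect matching. Then $Cl(G)=F(G)$.
   Context: For a perfect matching $M$ of a graph, a cycle is $M$-alternating if its edges alternate between edges in $M$ and not in $M$; a finite face is $M$-resonant if its boundary is $M$-alternating. A resonant set of a plane graph is a set of pairwise vertex-disjoint finite faces all $M$-resonant for a common perfect matching $M$; a maximum resonant set is one of largest size, and the Clar number $Cl(G)$ is the size of a maximum resonant set of $G$. A cycle $C$ of $G$ is nice if $G$ has a perfect matching $M$ for which $C$ is $M$-alternating. $I[C]$ is the subgraph of $G$ consisting of $C$ together with its interior (a plane graph whose finite faces are the faces of $G$ inside $C$). $I[C]-K$ is obtained by deleting all vertices on boundaries of faces in $K$ (the empty graph has exactly one perfect matching). A forcing set of a perfect matching $M$ is a subset $S\subseteq M$ contained in no other perfect matching; the forcing number $f(G,M)$ is the minimum size of a forcing set of $M$, and the maximum forcing number is $F(G)=\max_M f(G,M)$ over all perfect matchings $M$ of $G$. *)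

theory Defs
  imports "HOL-Analysis.Analysis"
begin

text \<open>
  A plane graph is a set of points of the plane together with a set of arcs joining them.
  An edge is the point set of its arc (end points included), so the ends of an edge are the
  vertices lying on it.
\<close>

record pgraph =
  verts :: "complex set"
  edges :: "complex set set"

definition ends :: "pgraph \<Rightarrow> complex set \<Rightarrow> complex set" where
  "ends G e = e \<inter> verts G"

text \<open>
  The arcs are arbitrary (not necessarily polygonal). The third conjunct excludes parallel edges;
  since the two end points of an arc are distinct, there are no loops. So the graph is finite
  and simple.
\<close>

definition plane_graph :: "pgraph \<Rightarrow> bool" where
  "plane_graph G \<longleftrightarrow>
     finite (verts G) \<and>
     (\<forall>e\<in>edges G. \<exists>g. arc g \<and> path_image g = e \<and> ends G e = {pathstart g, pathfinish g}) \<and>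
     (\<forall>e\<in>edges G. \<forall>e'\<in>edges G. e \<noteq> e' \<longrightarrow> ends G e \<noteq> ends G e') \<and>
     (\<forall>e\<in>edges G. \<forall>e'\<in>edges G. e \<noteq> e' \<longrightarrow> e \<inter> e' \<subseteq> verts G)"

definition connected_graph :: "pgraph \<Rightarrow> bool" where
  "connected_graph G \<longleftrightarrow>
     (\<forall>u\<in>verts G. \<forall>v\<in>verts G. (u, v) \<in> {(x, y). \<exists>e\<in>edges G. ends G e = {x, y}}\<^sup>*)"

definition bipartite :: "pgraph \<Rightarrow> bool" where
  "bipartite G \<longleftrightarrow>
     (\<exists>A B. A \<union> B = verts G \<and> A \<inter> B = {} \<and>
            (\<forall>e\<in>edges G. \<exists>a\<in>A. \<exists>b\<in>B. ends G e = {a, b}))"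

definition perfect_matching :: "pgraph \<Rightarrow> complex set set \<Rightarrow> bool" where
  "perfect_matching G M \<longleftrightarrow> M \<subseteq> edges G \<and> (\<forall>v\<in>verts G. \<exists>!e. e \<in> M \<and> v \<in> ends G e)"


text \<open>
  A cycle is represented by its edge set \<open>C\<close>; its point set is \<open>\<Union>C\<close>. The two lists enumerate
  its vertices and edges in cyclic order.
\<close>

definition cycle_seq :: "pgraph \<Rightarrow> complex list \<Rightarrow> complex set list \<Rightarrow> bool" where
  "cycle_seq G vs es \<longleftrightarrow>
     3 \<le> length vs \<and> length es = length vs \<and> distinct vs \<and>
     (\<forall>i<length vs. es ! i \<in> edges G \<and> ends G (es ! i) = {vs ! i, vs ! (Suc i mod length vs)})"

definition alternating_cycle :: "pgraph \<Rightarrow> complex set set \<Rightarrow> complex set set \<Rightarrow> bool" where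
  "alternating_cycle G M C \<longleftrightarrow>
     (\<exists>vs es. cycle_seq G vs es \<and> C = set es \<and>
        (\<forall>i<length es. es ! i \<in> M \<longleftrightarrow> es ! (Suc i mod length es) \<notin> M))"

definition nice_cycle :: "pgraph \<Rightarrow> complex set set \<Rightarrow> bool" where
  "nice_cycle G C \<longleftrightarrow> (\<exists>M. perfect_matching G M \<and> alternating_cycle G M C)"

text \<open>The plane graph \<open>I[C]\<close>: the cycle \<open>C\<close> together with its interior.\<close>

definition cycle_interior :: "pgraph \<Rightarrow> complex set set \<Rightarrow> pgraph" where
  "cycle_interior G C =
     \<lparr>verts = verts G \<inter> (\<Union>C \<union> inside (\<Union>C)),
      edges = {e \<in> edges G. e \<subseteq> \<Union>C \<union> inside (\<Union>C)}\<rparr>"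


definition finite_faces :: "pgraph \<Rightarrow> complex set set" where
  "finite_faces G = {f \<in> components (- (verts G \<union> \<Union>(edges G))). bounded f}"

text \<open>The boundary of a face is its topological frontier.\<close>

definition face_verts :: "pgraph \<Rightarrow> complex set \<Rightarrow> complex set" where
  "face_verts G f = verts G \<inter> frontier f"

definition resonant_face :: "pgraph \<Rightarrow> complex set set \<Rightarrow> complex set \<Rightarrow> bool" where
  "resonant_face G M f \<longleftrightarrow>
     f \<in> finite_faces G \<and> (\<exists>C. frontier f = \<Union>C \<and> alternating_cycle G M C)"

text \<open>
  Resonant sets of a plane graph are automatically finite, because the faces in them have
  pairwise disjoint non-empty vertex sets; so \<open>card\<close> below is the true size.
\<close>

definition resonant_set :: "pgraph \<Rightarrow> complex set set \<Rightarrow> bool" where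
  "resonant_set G K \<longleftrightarrow>
     (\<exists>M. perfect_matching G M \<and> (\<forall>f\<in>K. resonant_face G M f)) \<and>
     (\<forall>f\<in>K. \<forall>g\<in>K. f \<noteq> g \<longrightarrow> face_verts G f \<inter> face_verts G g = {})"

definition maximum_resonant_set :: "pgraph \<Rightarrow> complex set set \<Rightarrow> bool" where
  "maximum_resonant_set G K \<longleftrightarrow>
     resonant_set G K \<and> (\<forall>K'. resonant_set G K' \<longrightarrow> card K' \<le> card K)"

definition clar_number :: "pgraph \<Rightarrow> nat" where
  "clar_number G = Max {card K | K. resonant_set G K}"

definition delete_faces :: "pgraph \<Rightarrow> complex set set \<Rightarrow> pgraph" where
  "delete_faces G K =
     (let D = (\<Union>f\<in>K. face_verts G f)
      in \<lparr>verts = verts G - D, edges = {e \<in> edges G. ends G e \<inter> D = {}}\<rparr>)"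


definition forcing_set :: "pgraph \<Rightarrow> complex set set \<Rightarrow> complex set set \<Rightarrow> bool" where
  "forcing_set G M S \<longleftrightarrow> S \<subseteq> M \<and> (\<forall>M'. perfect_matching G M' \<and> S \<subseteq> M' \<longrightarrow> M' = M)"

definition forcing_number :: "pgraph \<Rightarrow> complex set set \<Rightarrow> nat" where
  "forcing_number G M = Min {card S | S. forcing_set G M S}"

definition max_forcing_number :: "pgraph \<Rightarrow> nat" where
  "max_forcing_number G = Max {forcing_number G M | M. perfect_matching G M}"

end

theory Submission
  imports Defs "HOL-Complex_Analysis.Winding_Numbers"
begin

text \<open>
  Forcing sets of a perfect matching \<open>M\<close> are the edge sets that meet every \<open>M\<close>-alternating cycle,
  so a resonant set for \<open>M\<close> bounds the forcing number of \<open>M\<close> from below. Conversely, by the planar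
  min-max theorem of Lucchesi and Younger the forcing number of \<open>M\<close> is the largest number of
  disjoint \<open>M\<close>-alternating cycles. Here the side of an alternating cycle is defined through
  winding numbers; two crossing cycles are replaced by cycles bounding the union and the
  intersection of their sides, and a noncrossing family is 2-coloured by depth.

  Disjoint alternating cycles are turned into faces one by one. Take a cycle \<open>C\<close> of the family
  that bounds no face and has minimal interior; all cycles inside it bound faces. If these faces
  were a maximum resonant set of \<open>I[C]\<close>, flipping \<open>C\<close> would contradict the uniqueness of the
  matching that is left. So \<open>I[C]\<close> has a larger resonant set, which can replace \<open>C\<close> and the
  cycles inside it.
\<close>

section \<open>Minimum covers and maximum packings in cross-free cut systems\<close>

text \<open>Orient the edges of a perfect matching \<open>M\<close> from one colour class to the
  other and all other edges backwards. The \<open>M\<close>-alternating cycles are then exactly the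
  directed cycles, that is, directed cuts of the dual; this is what bipartiteness is for. The
  min-max theorem is therefore stated for abstract arcs with a left and a right side. Its packings
  have capacities on \<open>M\<close> alone: cycles with a common vertex share the matching edge
  there, so disjointness on \<open>M\<close> makes alternating cycles disjoint as point sets. The
  obstacle is topological: edges are arbitrary arcs, and a dual graph would demand the whole face
  structure. What the argument really uses of it is a potential that jumps by one across the edges
  of a cycle and is constant elsewhere. Winding numbers of circulations supply it, and since they
  are additive, differences and pieces of alternating cycles can be handled even when they are not
  alternating cycles themselves.\<close>

locale cut_system =
  fixes Z :: "'e set set" and side :: "'e set \<Rightarrow> 'a set" and F :: "'a set"
    and ls rs :: "'e \<Rightarrow> 'a"
  assumes finF: "finite F"
    and finZ: "A \<in> Z \<Longrightarrow> finite A"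
    and neZ: "A \<in> Z \<Longrightarrow> A \<noteq> {}"
    and lsF: "e \<in> \<Union>Z \<Longrightarrow> ls e \<in> F"
    and rsF: "e \<in> \<Union>Z \<Longrightarrow> rs e \<in> F"
    and sideF: "A \<in> Z \<Longrightarrow> side A \<subseteq> F"
    and mem_cut: "\<lbrakk>A \<in> Z; e \<in> \<Union>Z\<rbrakk> \<Longrightarrow> e \<in> A \<longleftrightarrow> ls e \<in> side A \<and> rs e \<notin> side A"
    and no_reverse: "\<lbrakk>A \<in> Z; e \<in> \<Union>Z; rs e \<in> side A\<rbrakk> \<Longrightarrow> ls e \<in> side A"
    \<comment> \<open>The cut of \<open>T\<close> may split into several members of
      \<open>Z\<close>, so only some member inside it is promised; its side is known to be
      \<open>T\<close> when it exhausts the cut.\<close>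
    and uncross: "\<lbrakk>A \<in> Z; B \<in> Z; side A \<inter> side B \<noteq> {}; side A \<union> side B \<noteq> F;
          T = side A \<union> side B \<or> T = side A \<inter> side B\<rbrakk> \<Longrightarrow>
          \<exists>A'\<in>Z. A' \<subseteq> {e\<in>\<Union>Z. ls e \<in> T \<and> rs e \<notin> T} \<and>
             (A' = {e\<in>\<Union>Z. ls e \<in> T \<and> rs e \<notin> T} \<longrightarrow> side A' = T)"
begin

definition cut :: "'a set \<Rightarrow> 'e set" where
  "cut T = {e\<in>\<Union>Z. ls e \<in> T \<and> rs e \<notin> T}"

text \<open>Families are indexed, so repeated members count with multiplicity.\<close>

definition load :: "(nat \<Rightarrow> 'e set) \<Rightarrow> nat \<Rightarrow> 'e \<Rightarrow> nat" where
  "load A N e = card {i. i < N \<and> e \<in> A i}"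

text \<open>Sides that together cover \<open>F\<close> have disjoint complements and do not cross.
  This symmetric notion is needed because a side can be the exterior of a cycle.\<close>

definition crossing :: "'e set \<Rightarrow> 'e set \<Rightarrow> bool" where
  "crossing A B \<longleftrightarrow> side A \<inter> side B \<noteq> {} \<and> side A \<union> side B \<noteq> F \<and>
     \<not> side A \<subseteq> side B \<and> \<not> side B \<subseteq> side A"

lemma load_sum: "load A N e = (\<Sum>i<N. of_bool (e \<in> A i))"
proof -
  have "{..<N} \<inter> {i. e \<in> A i} = {i. i < N \<and> e \<in> A i}" by auto
  then show ?thesis by (simp add: load_def)
qed

lemma cut_subset: "A \<in> Z \<Longrightarrow> B \<in> Z \<Longrightarrow> T = side A \<union> side B \<or> T = side A \<inter> side B \<Longrightarrow> cut T \<subseteq> A \<union> B"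
  using mem_cut[of A] mem_cut[of B] no_reverse[of A] no_reverse[of B]
  unfolding cut_def by blast

text \<open>For arbitrary cuts this is only an inequality. The arcs that would be lost run between
  the two differences of the sides, and \<open>no_reverse\<close> excludes them.\<close>

lemma cut_count:
  assumes "A \<in> Z" "B \<in> Z"
  shows "of_bool (e \<in> cut (side A \<union> side B)) + of_bool (e \<in> cut (side A \<inter> side B))
       = of_bool (e \<in> A) + (of_bool (e \<in> B) :: nat)"
proof (cases "e \<in> \<Union>Z")
  case True
  then show ?thesis
    using mem_cut[OF assms(1) True] mem_cut[OF assms(2) True]
      no_reverse[OF assms(1) True] no_reverse[OF assms(2) True]
    by (auto simp: cut_def)
next
  case False
  then show ?thesis using assms by (auto simp: cut_def)
qed

lemma card_cut:
  assumes "A \<in> Z" "B \<in> Z"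
  shows "card (cut (side A \<union> side B)) + card (cut (side A \<inter> side B)) = card A + card B"
proof -
  have fin: "finite (A \<union> B)" using finZ[OF assms(1)] finZ[OF assms(2)] by simp
  have c: "card X = (\<Sum>e\<in>A \<union> B. of_bool (e \<in> X))" if "X \<subseteq> A \<union> B" for X
  proof -
    have "(A \<union> B) \<inter> {e. e \<in> X} = X" using that by auto
    then show ?thesis using fin by simp
  qed
  have "card (cut (side A \<union> side B)) + card (cut (side A \<inter> side B))
     = (\<Sum>e\<in>A \<union> B. of_bool (e \<in> cut (side A \<union> side B)) + of_bool (e \<in> cut (side A \<inter> side B)))"
    using c[OF cut_subset[OF assms disjI1[OF refl]]] c[OF cut_subset[OF assms disjI2[OF refl]]]
    by (simp only: sum.distrib)
  also have "\<dots> = (\<Sum>e\<in>A \<union> B. of_bool (e \<in> A) + of_bool (e \<in> B))"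
    by (simp only: cut_count[OF assms])
  also have "\<dots> = card A + card B"
    using c[of A] c[of B] by (simp only: sum.distrib) simp
  finally show ?thesis .
qed

text \<open>Bookkeeping for replacing two entries, used alike for loads, sizes and squares. The
  removed terms stand on the left to avoid subtraction of naturals.\<close>

lemma sum_update2:
  fixes g :: "'b \<Rightarrow> nat" and i j N :: nat
  assumes "i < N" "j < N" "i \<noteq> j"
  shows "(\<Sum>k<N. g ((f(i := a, j := b)) k)) + g (f i) + g (f j) = (\<Sum>k<N. g (f k)) + g a + g b"
proof -
  let ?R = "{..<N} - {i} - {j}"
  have split: "(\<Sum>k<N. h k) = h i + (h j + sum h ?R)" for h :: "nat \<Rightarrow> nat"
  proof -
    have "sum h {..<N} = h i + sum h ({..<N} - {i})" by (rule sum.remove) (use assms in auto)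
    also have "sum h ({..<N} - {i}) = h j + sum h ?R" by (rule sum.remove) (use assms in auto)
    finally show ?thesis .
  qed
  define f' where "f' = f(i := a, j := b)"
  have "(\<Sum>k\<in>?R. g (f' k)) = (\<Sum>k\<in>?R. g (f k))"
    unfolding f'_def by (rule sum.cong) auto
  moreover have "g (f' i) = g a" "g (f' j) = g b" using assms by (auto simp: f'_def)
  moreover note split[of "\<lambda>k. g (f' k)"] split[of "\<lambda>k. g (f k)"]
  ultimately show ?thesis unfolding f'_def[symmetric] by linarith
qed

text \<open>If the two differences have x and y elements, the right side exceeds the left by
  2xy.\<close>

lemma sum_squares_uncross:
  fixes S T :: "'a set"
  assumes "finite S" "finite T" "\<not> S \<subseteq> T" "\<not> T \<subseteq> S"
  shows "(card S)^2 + (card T)^2 < (card (S \<union> T))^2 + (card (S \<inter> T))^2"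
proof -
  have 1: "card S + card T = card (S \<union> T) + card (S \<inter> T)" using assms card_Un_Int by blast
  have 2: "card (S \<inter> T) < card S" "card (S \<inter> T) < card T"
    using assms by (auto intro!: psubset_card_mono)
  define n x y where "n = card (S \<inter> T)" and "x = card S - n" and "y = card T - n"
  have xy: "card S = n + x" "card T = n + y" "x > 0" "y > 0" "card (S \<union> T) = n + x + y"
    using 1 2 by (auto simp: n_def x_def y_def)
  have "0 < 2 * (x * y)" using xy by simp
  then show ?thesis
    unfolding xy(1,2,5) n_def[symmetric] by (simp add: power2_eq_square algebra_simps)
qed

text \<open>
  The total size is minimised first, so that the two cycles found in an uncrossed pair
  exhaust the two cuts; then the sum of the squares of the sides can only grow.
\<close>

lemma exists_noncrossing_family:
  assumes "\<And>i. i < N \<Longrightarrow> A i \<in> Z"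
  shows "\<exists>B. (\<forall>i<N. B i \<in> Z) \<and> (\<forall>e. load B N e \<le> load A N e) \<and>
             (\<forall>i<N. \<forall>j<N. \<not> crossing (B i) (B j))"
proof -
  define m1 where "m1 A = (\<Sum>i<N. card (A i))" for A :: "nat \<Rightarrow> 'e set"
  define sq where "sq A = (\<Sum>i<N. (card (side (A i)))^2)" for A
  \<comment> \<open>Subtracting from an upper bound turns growing squares into a decreasing natural
    measure.\<close>
  define m2 where "m2 A = N * (card F)^2 - sq A" for A
  have sq: "sq A \<le> N * (card F)^2" if "\<forall>i<N. A i \<in> Z" for A
  proof -
    have "sq A \<le> (\<Sum>i<N. (card F)^2)" unfolding sq_def
      using that sideF finF by (intro sum_mono power_mono card_mono) auto
    then show ?thesis by simp
  qed
  show ?thesis using assms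
  proof (induction A rule: wf_induct_rule[OF wf_measures[of "[m1, m2]"]])
    case (1 A)
    show ?case
    proof (cases "\<exists>i<N. \<exists>j<N. crossing (A i) (A j)")
      case False
      then show ?thesis using "1.prems" by blast
    next
      case True
      then obtain i j where ij: "i < N" "j < N" and cr: "crossing (A i) (A j)" by blast
      have ne: "i \<noteq> j" using cr by (auto simp: crossing_def)
      let ?U = "side (A i) \<union> side (A j)" and ?I = "side (A i) \<inter> side (A j)"
      have AZ: "A i \<in> Z" "A j \<in> Z" using ij "1.prems" by auto
      obtain U where U: "U \<in> Z" "U \<subseteq> cut ?U" "U = cut ?U \<longrightarrow> side U = ?U"
        using uncross[OF AZ, of ?U] cr unfolding crossing_def cut_def by blast
      obtain I where I: "I \<in> Z" "I \<subseteq> cut ?I" "I = cut ?I \<longrightarrow> side I = ?I"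
        using uncross[OF AZ, of ?I] cr unfolding crossing_def cut_def by blast
      define B where "B = A(i := U, j := I)"
      have BZ: "\<forall>i<N. B i \<in> Z" using "1.prems" U I by (auto simp: B_def)
      have fin: "finite (cut ?U)" "finite (cut ?I)"
        using cut_subset[OF AZ] finZ AZ by (metis finite_UnI finite_subset)+
      have load: "load B N e \<le> load A N e" for e
      proof -
        have "load B N e + of_bool (e \<in> A i) + of_bool (e \<in> A j)
            = load A N e + of_bool (e \<in> U) + of_bool (e \<in> I)"
          unfolding load_sum B_def
          using sum_update2[OF ij ne, of "\<lambda>X. of_bool (e \<in> X)" A U I] by simp
        moreover have "of_bool (e \<in> U) + of_bool (e \<in> I)
            \<le> (of_bool (e \<in> cut ?U) + of_bool (e \<in> cut ?I) :: nat)"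
          using U I by (intro add_mono) auto
        ultimately show ?thesis using cut_count[OF AZ, of e] by linarith
      qed
      have "card U \<le> card (cut ?U)" "card I \<le> card (cut ?I)"
        using U I fin by (auto intro: card_mono)
      moreover have "m1 B + card (A i) + card (A j) = m1 A + card U + card I"
        unfolding m1_def B_def using sum_update2[OF ij ne, of card A U I] by simp
      moreover note card_cut[OF AZ]
      ultimately have m1: "m1 B < m1 A \<or> m1 B = m1 A \<and> card U = card (cut ?U) \<and> card I = card (cut ?I)"
        by linarith
      have "m2 B < m2 A" if "card U = card (cut ?U)" "card I = card (cut ?I)"
      proof -
        have "side U = ?U" "side I = ?I"
          using U I that fin by (metis card_subset_eq)+
        then have "sq B + (card (side (A i)))^2 + (card (side (A j)))^2
            = sq A + (card ?U)^2 + (card ?I)^2"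
          unfolding sq_def B_def
          using sum_update2[OF ij ne, of "\<lambda>X. (card (side X))^2" A U I] by (simp only:)
        moreover have "(card (side (A i)))^2 + (card (side (A j)))^2 < (card ?U)^2 + (card ?I)^2"
          using cr finite_subset[OF sideF finF] AZ by (intro sum_squares_uncross) (auto simp: crossing_def)
        ultimately have "sq A < sq B" by linarith
        then show ?thesis using sq[OF BZ] unfolding m2_def by linarith
      qed
      then have "(B, A) \<in> measures [m1, m2]" using m1 by auto
      from "1.IH"[OF this] BZ obtain B' where
        "\<forall>i<N. B' i \<in> Z" "\<forall>e. load B' N e \<le> load B N e" "\<forall>i<N. \<forall>j<N. \<not> crossing (B' i) (B' j)"
        by blast
      moreover have "\<forall>e. load B' N e \<le> load A N e"
        using calculation(2) load order_trans by blast
      ultimately show ?thesis by blast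
    qed
  qed
qed

text \<open>\<open>t\<close> takes every value of an interval exactly once, and of n consecutive
  numbers at most (n + 1) div 2 have a given parity. The induction carries the exact count, which
  depends on the parity of the first number.\<close>

lemma card_parity_le:
  fixes t :: "'b \<Rightarrow> nat"
  assumes "finite X" "inj_on t X" "t ` X \<subseteq> {c..<c + card X}"
  shows "card {i\<in>X. even (t i) = b} \<le> (card X + 1) div 2"
proof -
  have eq: "t ` X = {c..<c + card X}"
    using assms by (intro card_subset_eq) (auto simp: card_image)
  have img: "t ` {i\<in>X. even (t i) = b} = {k\<in>t ` X. even k = b}" by auto
  have "card {i\<in>X. even (t i) = b} = card (t ` {i\<in>X. even (t i) = b})"
    using assms(2) by (intro card_image[symmetric]) (auto simp: inj_on_def)
  also have "t ` {i\<in>X. even (t i) = b} = {k\<in>{c..<c + card X}. even k = b}"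
    unfolding eq[symmetric] by (rule img)
  also have "card \<dots> \<le> (card X + 1) div 2"
  proof -
    have "card {k\<in>{c..<c + n}. even k = b} = (n + of_bool (even c = b)) div 2" for n
    proof (induction n)
      case (Suc n)
      have "{k\<in>{c..<c + Suc n}. even k = b} =
        (if even (c + n) = b then insert (c + n) else (\<lambda>x. x)) {k\<in>{c..<c + n}. even k = b}"
        by (auto simp: less_Suc_eq)
      then have "card {k\<in>{c..<c + Suc n}. even k = b} =
        of_bool (even (c + n) = b) + card {k\<in>{c..<c + n}. even k = b}" by simp
      also have "\<dots> = (Suc n + of_bool (even c = b)) div 2"
        unfolding Suc by (cases "even n"; cases "even c"; cases b; simp)
      finally show ?case .
    qed (cases "even c = b"; simp)
    then show ?thesis by (simp add: div_le_mono)
  qed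
  finally show ?thesis .
qed

text \<open>
  The members of a noncrossing family are coloured by the parity of their depth. The sides
  entered by a fixed arc form a chain on which the depth takes consecutive values.
\<close>

lemma balanced_colouring:
  assumes AZ: "\<And>i. i < N \<Longrightarrow> A i \<in> Z"
    and nc: "\<And>i j. i < N \<Longrightarrow> j < N \<Longrightarrow> \<not> crossing (A i) (A j)"
  shows "\<exists>col :: nat \<Rightarrow> bool. \<forall>e b. card {i. i < N \<and> e \<in> A i \<and> col i = b} \<le> (load A N e + 1) div 2"
proof -
  define S where "S i = side (A i)" for i
  \<comment> \<open>Equal sides are ordered by index, so that \<open>lt\<close> is total on every
    chain of sides.\<close>
  define lt where "lt i j \<longleftrightarrow> S i \<subset> S j \<or> S i = S j \<and> i < j" for i j :: nat
  \<comment> \<open>Sides that cover \<open>F\<close> together with \<open>S i\<close> also count as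
    above, which makes the depths fit together at every arc.\<close>
  define above where "above i = {j. j < N \<and> j \<noteq> i \<and> (S i \<union> S j = F \<or> lt i j)}" for i
  define t where "t i = card (above i)" for i
  have "card {i. i < N \<and> e \<in> A i \<and> even (t i) = b} \<le> (load A N e + 1) div 2" for e b
  proof (cases "e \<in> \<Union>Z")
    case False
    then have "{i. i < N \<and> e \<in> A i \<and> even (t i) = b} = {}" using AZ by blast
    then show ?thesis by (metis card.empty zero_le)
  next
    case True
    define X where "X = {i. i < N \<and> e \<in> A i}"
    define Y where "Y = {j. j < N \<and> e \<notin> A j \<and> ls e \<in> S j}"
    have X: "i \<in> X \<longleftrightarrow> i < N \<and> ls e \<in> S i \<and> rs e \<notin> S i" for i
      using mem_cut[OF AZ True] by (auto simp: X_def S_def)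
    have Y: "j \<in> Y \<longleftrightarrow> j < N \<and> ls e \<in> S j \<and> rs e \<in> S j" for j
      using mem_cut[OF AZ True] by (auto simp: Y_def S_def)
    have Y': "j < N \<Longrightarrow> rs e \<in> S j \<Longrightarrow> j \<in> Y" for j
      using no_reverse[OF AZ True] Y by (auto simp: S_def)
    have cmp: "S i \<subseteq> S j \<or> S j \<subseteq> S i \<or> S i \<inter> S j = {} \<or> S i \<union> S j = F" if "i < N" "j < N" for i j
      using nc[OF that] by (auto simp: crossing_def S_def)
    have fin: "finite X" "finite Y" by (auto simp: X_def Y_def)
    \<comment> \<open>A member of \<open>Y\<close> contains both ends of \<open>e\<close>, so it is
      neither disjoint from nor contained in \<open>S i\<close>; being noncrossing, it contains
      \<open>S i\<close> or covers \<open>F\<close> with it. The depth on \<open>X\<close> is thus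
      the constant \<open>card Y\<close> plus the rank in a chain.\<close>
    have ab: "above i = Y \<union> {j\<in>X. lt i j}" if i: "i \<in> X" for i
    proof (intro set_eqI iffI)
      fix j assume j: "j \<in> above i"
      then have "j < N" by (auto simp: above_def)
      show "j \<in> Y \<union> {j\<in>X. lt i j}"
      proof (cases "rs e \<in> S j")
        case True
        then show ?thesis using Y' \<open>j < N\<close> by auto
      next
        case False
        then have "S i \<union> S j \<noteq> F" using i X rsF[OF \<open>e \<in> \<Union>Z\<close>] by blast
        then have "lt i j" using j by (auto simp: above_def)
        then have "ls e \<in> S j" using i X by (auto simp: lt_def)
        then show ?thesis using False \<open>lt i j\<close> X \<open>j < N\<close> by auto
      qed
    next
      fix j assume "j \<in> Y \<union> {j\<in>X. lt i j}"
      then show "j \<in> above i"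
      proof
        assume j: "j \<in> Y"
        then have "S i \<subset> S j \<or> S i \<union> S j = F" using i X Y cmp by blast
        moreover have "i \<noteq> j" using i j X Y by auto
        ultimately show ?thesis using j Y by (auto simp: above_def lt_def)
      next
        assume j: "j \<in> {j\<in>X. lt i j}"
        then show ?thesis using X by (auto simp: above_def lt_def)
      qed
    qed
    have t: "t i = card Y + card {j\<in>X. lt i j}" if "i \<in> X" for i
      unfolding t_def ab[OF that] using fin X Y by (intro card_Un_disjoint) auto
    have total: "lt i j \<or> lt j i \<or> i = j" if "i \<in> X" "j \<in> X" for i j
    proof -
      have "S i \<inter> S j \<noteq> {}" "S i \<union> S j \<noteq> F" using that X rsF[OF True] by auto
      then have "S i \<subseteq> S j \<or> S j \<subseteq> S i" using cmp[of i j] that X by blast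
      then show ?thesis unfolding lt_def by (metis linorder_neqE_nat psubsetI)
    qed
    have strict: "t j < t i" if "i \<in> X" "j \<in> X" "lt i j" for i j
    proof -
      have "{k\<in>X. lt j k} \<subset> {k\<in>X. lt i k}"
        using that by (auto simp: lt_def)
      then show ?thesis using t that fin by (simp add: psubset_card_mono)
    qed
    have "inj_on t X" by (rule inj_onI) (metis strict total less_irrefl)
    moreover have "t ` X \<subseteq> {card Y..<card Y + card X}"
    proof
      fix k assume "k \<in> t ` X"
      then obtain i where i: "i \<in> X" "k = t i" by blast
      have "{j\<in>X. lt i j} \<subset> X" using i by (auto simp: lt_def)
      then have "card {j\<in>X. lt i j} < card X" using fin by (simp add: psubset_card_mono)
      then show "k \<in> {card Y..<card Y + card X}" using i t by auto
    qed
    ultimately have "card {i\<in>X. even (t i) = b} \<le> (card X + 1) div 2"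
      using fin by (intro card_parity_le) auto
    then show ?thesis by (simp add: X_def load_def conj_assoc)
  qed
  then show ?thesis by (intro exI[of _ "\<lambda>i. even (t i)"]) blast
qed

text \<open>Packings are capacitated only on a set \<open>M\<close> of arcs meeting every member of \<open>Z\<close>.\<close>

definition pack :: "'e set \<Rightarrow> ('e \<Rightarrow> nat) \<Rightarrow> nat \<Rightarrow> bool" where
  "pack M c N \<longleftrightarrow> (\<exists>A. (\<forall>i<N. A i \<in> Z) \<and> (\<forall>e\<in>M. load A N e \<le> c e))"

text \<open>Surplus members are dropped and the rest is reindexed by an initial segment.\<close>

lemma pack_subfamily:
  assumes "\<And>i. i \<in> X \<Longrightarrow> A i \<in> Z" "finite X" "n \<le> card X"
    "\<And>e. e \<in> M \<Longrightarrow> card {i\<in>X. e \<in> A i} \<le> c e"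
  shows "pack M c n"
proof -
  obtain X' where X': "X' \<subseteq> X" "card X' = n" using assms(3) by (metis obtain_subset_with_card_n)
  have "finite X'" using X' assms finite_subset by blast
  then obtain h where h: "bij_betw h {..<n} X'"
    using X' by (metis ex_bij_betw_nat_finite atLeast0LessThan)
  have "load (A \<circ> h) n e \<le> c e" if "e \<in> M" for e
  proof -
    have "bij_betw h {i. i < n \<and> e \<in> A (h i)} {i\<in>X'. e \<in> A i}"
      using h by (auto simp: bij_betw_def inj_on_def image_iff)
    then have "load (A \<circ> h) n e = card {i\<in>X'. e \<in> A i}"
      unfolding load_def by (simp add: bij_betw_same_card)
    also have "\<dots> \<le> card {i\<in>X. e \<in> A i}" using X' assms(2) by (intro card_mono) auto
    finally show ?thesis using assms(4)[OF that] by simp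
  qed
  moreover have "(A \<circ> h) i \<in> Z" if "i < n" for i
    using h X' assms(1) that by (auto simp: bij_betw_def)
  ultimately show ?thesis unfolding pack_def by blast
qed

text \<open>Uncross, colour and keep the larger colour class, which has at least (N + 1) div 2
  members. The rounding in the balanced load is harmless because the capacity is even: (2c + 1) div
  2 = c.\<close>

lemma pack_halve:
  assumes "pack M (\<lambda>e. 2 * c e) N"
  shows "pack M c ((N + 1) div 2)"
proof -
  obtain A where A: "\<forall>i<N. A i \<in> Z" "\<forall>e\<in>M. load A N e \<le> 2 * c e"
    using assms unfolding pack_def by blast
  obtain B where B: "\<forall>i<N. B i \<in> Z" "\<forall>e. load B N e \<le> load A N e"
    "\<forall>i<N. \<forall>j<N. \<not> crossing (B i) (B j)"
    using exists_noncrossing_family[of N A] A by blast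
  obtain col :: "nat \<Rightarrow> bool" where col: "\<forall>e b. card {i. i < N \<and> e \<in> B i \<and> col i = b} \<le> (load B N e + 1) div 2"
    using balanced_colouring[of N B] B by blast
  define X where "X b = {i. i < N \<and> col i = b}" for b
  have "card (X True) + card (X False) = card (X True \<union> X False)"
    by (intro card_Un_disjoint[symmetric]) (auto simp: X_def)
  also have "X True \<union> X False = {..<N}" by (auto simp: X_def)
  finally have "card (X True) + card (X False) = N" by simp
  then have "(N + 1) div 2 \<le> card (X True) \<or> (N + 1) div 2 \<le> card (X False)" by presburger
  then obtain b where b: "(N + 1) div 2 \<le> card (X b)" by blast
  show ?thesis
  proof (rule pack_subfamily[OF _ _ b])
    show "B i \<in> Z" if "i \<in> X b" for i using that B by (auto simp: X_def)
    show "finite (X b)" by (auto simp: X_def)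
    show "card {i\<in>X b. e \<in> B i} \<le> c e" if "e \<in> M" for e
    proof -
      have eq: "{i\<in>X b. e \<in> B i} = {i. i < N \<and> e \<in> B i \<and> col i = b}" by (auto simp: X_def)
      have "card {i\<in>X b. e \<in> B i} \<le> (load B N e + 1) div 2" unfolding eq using col by blast
      moreover have "load B N e \<le> 2 * c e" using A B that by (meson le_trans)
      ultimately show ?thesis by linarith
    qed
  qed
qed

lemma pack_add:
  assumes "pack M c N" "pack M d K"
  shows "pack M (\<lambda>e. c e + d e) (N + K)"
proof -
  obtain A B where A: "\<forall>i<N. A i \<in> Z" "\<forall>e\<in>M. load A N e \<le> c e"
    and B: "\<forall>i<K. B i \<in> Z" "\<forall>e\<in>M. load B K e \<le> d e"
    using assms unfolding pack_def by blast
  define C where "C i = (if i < N then A i else B (i - N))" for i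
  have "load C (N + K) e = load A N e + load B K e" for e
  proof -
    have "load C (N + K) e = (\<Sum>i<N. of_bool (e \<in> C i)) + (\<Sum>i<K. of_bool (e \<in> C (N + i)))"
      unfolding load_sum by (induction K) auto
    then show ?thesis unfolding load_sum by (simp add: C_def)
  qed
  then show ?thesis unfolding pack_def using A B
    by (intro exI[of _ C]) (auto simp: C_def intro!: add_mono)
qed

lemma pack_mono: "pack M c N \<Longrightarrow> (\<And>e. e \<in> M \<Longrightarrow> c e \<le> d e) \<Longrightarrow> pack M d N"
  unfolding pack_def by (meson le_trans)

text \<open>
  Lovasz's argument: if deleting any arc of \<open>R\<close> leaves \<open>k + 1\<close> disjoint members, raise
  capacities one unit at a time until \<open>k + 2\<close> members fit; together with \<open>k + 1\<close> disjoint
  members avoiding the arc raised last, they form a half-integral packing that is too large.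
\<close>

theorem min_max:
  assumes M: "\<And>A. A \<in> Z \<Longrightarrow> A \<inter> M \<noteq> {}" and finM: "finite M" and R: "R \<subseteq> M"
    and np: "\<not> pack M (\<lambda>e. of_bool (e \<in> R)) (Suc k)"
  shows "\<exists>T\<subseteq>R. card T \<le> k \<and> (\<forall>A\<in>Z. A \<inter> M \<subseteq> R \<longrightarrow> A \<inter> T \<noteq> {})"
  using R np
proof (induction k arbitrary: R)
  case 0
  have "\<not> (A \<in> Z \<and> A \<inter> M \<subseteq> R)" for A
  proof
    assume A: "A \<in> Z \<and> A \<inter> M \<subseteq> R"
    have "pack M (\<lambda>e. of_bool (e \<in> R)) (Suc 0)"
      unfolding pack_def load_sum using A by (intro exI[of _ "\<lambda>_. A"]) auto
    then show False using 0 by simp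
  qed
  then show ?case by (intro exI[of _ "{}"]) auto
next
  case (Suc k)
  show ?case
  proof (cases "\<exists>e\<in>R. \<not> pack M (\<lambda>f. of_bool (f \<in> R - {e})) (Suc k)")
    case True
    then obtain e where e: "e \<in> R" "\<not> pack M (\<lambda>f. of_bool (f \<in> R - {e})) (Suc k)" by blast
    obtain T where T: "T \<subseteq> R - {e}" "card T \<le> k"
      "\<forall>A\<in>Z. A \<inter> M \<subseteq> R - {e} \<longrightarrow> A \<inter> T \<noteq> {}"
      using Suc.IH[OF _ e(2)] Suc.prems by blast
    have "finite T" using T(1) Suc.prems(1) finM by (meson finite_Diff finite_subset)
    then have "card (insert e T) \<le> Suc k" using T(2) by (simp add: card_insert_if)
    moreover have "insert e T \<subseteq> R" using T(1) e(1) by blast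
    moreover have "\<forall>A\<in>Z. A \<inter> M \<subseteq> R \<longrightarrow> A \<inter> insert e T \<noteq> {}" using T(3) by blast
    ultimately show ?thesis by blast
  next
    case False
    show ?thesis
    proof (cases "\<exists>A\<in>Z. A \<inter> M \<subseteq> R")
      case False
      then show ?thesis by (intro exI[of _ "{}"]) auto
    next
      case True
      then obtain A where A: "A \<in> Z" "A \<inter> M \<subseteq> R" by blast
      \<comment> \<open>Capacity at least 1 on \<open>R\<close> is what later lets doubling absorb
        one extra unit; capacity 0 on the rest of \<open>M\<close> confines members to those whose
        matching edges lie in \<open>R\<close>.\<close>
      define good where "good c \<longleftrightarrow> (\<forall>e\<in>R. 1 \<le> c e) \<and> (\<forall>e\<in>M - R. c e = 0) \<and> pack M c (Suc (Suc k))"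
        for c :: "'e \<Rightarrow> nat"
      have ld: "load (\<lambda>_. A) N e \<le> of_bool (e \<in> R) * N" if "e \<in> M" for e N
      proof -
        have "load (\<lambda>_. A) N e \<le> card {..<N}" unfolding load_def by (intro card_mono) auto
        moreover have "load (\<lambda>_. A) N e = 0" if "e \<notin> A" using that by (simp add: load_def)
        ultimately show ?thesis using A that by auto
      qed
      have "pack M (\<lambda>e. of_bool (e \<in> R) * Suc (Suc k)) (Suc (Suc k))"
        unfolding pack_def using A(1) ld by (intro exI[of _ "\<lambda>_. A"] conjI ballI allI impI)
      then have g0: "good (\<lambda>e. of_bool (e \<in> R) * Suc (Suc k))"
        unfolding good_def by simp
      \<comment> \<open>A good capacity of least total plays the role of the moment at which
        \<open>k + 2\<close> members first fit. Some good capacity exists, since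
        \<open>k + 2\<close> copies of \<open>A\<close> can be taken.\<close>
      have "\<exists>c. good c \<and> (\<forall>d. good d \<longrightarrow> sum c M \<le> sum d M)"
        by (rule ex_has_least_nat[of good, OF g0])
      then obtain c where c: "good c" and cmin: "\<forall>d. good d \<longrightarrow> sum c M \<le> sum d M" by (elim exE conjE)
      have "\<exists>e\<in>R. 2 \<le> c e"
      proof (rule ccontr)
        assume *: "\<not> ?thesis"
        have le: "c f \<le> of_bool (f \<in> R)" if "f \<in> M" for f
        proof (cases "f \<in> R")
          case True
          then have "\<not> 2 \<le> c f" using * by blast
          then show ?thesis using True by simp
        next
          case False
          then show ?thesis using c that by (simp add: good_def)
        qed
        have "pack M c (Suc (Suc k))" using c by (simp add: good_def)
        then have "pack M (\<lambda>f. of_bool (f \<in> R)) (Suc (Suc k))" using le by (rule pack_mono)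
        with Suc.prems(2) show False by contradiction
      qed
      then obtain e where e: "e \<in> R" "2 \<le> c e" by blast
      define d where "d = c(e := c e - 1)"
      have "sum d M < sum c M"
        using finM
      proof (rule sum_strict_mono_ex1)
        show "\<forall>x\<in>M. d x \<le> c x" by (simp add: d_def)
        show "\<exists>x\<in>M. d x < c x" using e Suc.prems(1) by (intro bexI[of _ e]) (auto simp: d_def)
      qed
      then have "\<not> good d" using cmin linorder_not_le by blast
      moreover have "(\<forall>e\<in>R. 1 \<le> d e) \<and> (\<forall>e\<in>M - R. d e = 0)" using c e by (auto simp: good_def d_def)
      ultimately have nd: "\<not> pack M d (Suc (Suc k))" by (auto simp: good_def)
      have "pack M (\<lambda>f. c f + of_bool (f \<in> R - {e})) (Suc (Suc k) + Suc k)"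
        using c False e by (intro pack_add) (auto simp: good_def)
      \<comment> \<open>At \<open>e\<close> this reads c <= 2(c - 1), true since c >= 2; elsewhere
        in \<open>R\<close> it reads c + 1 <= 2c, true since c >= 1. Halving 2k + 3 members, rounded
        up, gives k + 2 of them within \<open>d\<close>.\<close>
      moreover have "c f + of_bool (f \<in> R - {e}) \<le> 2 * d f" if "f \<in> M" for f
      proof (cases "f = e")
        case True
        then show ?thesis using e by (simp add: d_def)
      next
        case False
        then show ?thesis using c that by (cases "f \<in> R") (auto simp: good_def d_def)
      qed
      ultimately have "pack M (\<lambda>f. 2 * d f) (Suc (Suc k) + Suc k)" by (rule pack_mono)
      moreover have "(Suc (Suc k) + Suc k + 1) div 2 = Suc (Suc k)" by simp
      ultimately have "pack M d (Suc (Suc k))" by (metis pack_halve)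
      then show ?thesis using nd by simp
    qed
  qed
qed

end

section \<open>Alternating cycles and perfect matchings\<close>

text \<open>Vertex-disjoint unions of alternating cycles, described locally at each vertex. The
  local form is easy to check for symmetric differences of matchings and for cuts.\<close>

definition altset :: "pgraph \<Rightarrow> complex set set \<Rightarrow> complex set set \<Rightarrow> bool" where
  "altset G M E \<longleftrightarrow> E \<subseteq> edges G \<and>
     (\<forall>e\<in>E. \<forall>v\<in>ends G e. \<exists>m\<in>E \<inter> M. \<exists>p\<in>E - M. v \<in> ends G m \<and> v \<in> ends G p \<and>
        (\<forall>f\<in>E. v \<in> ends G f \<longrightarrow> f = m \<or> f = p))"

text \<open>Degree two at every covered vertex. This weaker notion is needed since the symmetric
  difference of two alternating cycles need not alternate.\<close>

definition two_regular :: "pgraph \<Rightarrow> complex set set \<Rightarrow> bool" where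
  "two_regular G E \<longleftrightarrow> E \<subseteq> edges G \<and>
     (\<forall>e\<in>E. \<forall>v\<in>ends G e. \<exists>f\<in>E. f \<noteq> e \<and> v \<in> ends G f \<and>
        (\<forall>g\<in>E. v \<in> ends G g \<longrightarrow> g = e \<or> g = f))"

lemma altsetE:
  assumes "altset G M E" "e \<in> E" "v \<in> ends G e"
  obtains m p where "m \<in> E" "m \<in> M" "p \<in> E" "p \<notin> M" "v \<in> ends G m" "v \<in> ends G p"
    "\<forall>f\<in>E. v \<in> ends G f \<longrightarrow> f = m \<or> f = p"
proof -
  have "\<exists>m\<in>E \<inter> M. \<exists>p\<in>E - M. v \<in> ends G m \<and> v \<in> ends G p \<and> (\<forall>f\<in>E. v \<in> ends G f \<longrightarrow> f = m \<or> f = p)"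
    using assms by (simp add: altset_def)
  then show ?thesis using that by auto
qed

lemma two_regularE:
  assumes "two_regular G E" "e \<in> E" "v \<in> ends G e"
  obtains f where "f \<in> E" "f \<noteq> e" "v \<in> ends G f"
    "\<forall>g\<in>E. v \<in> ends G g \<longrightarrow> g = e \<or> g = f"
proof -
  have "\<exists>f\<in>E. f \<noteq> e \<and> v \<in> ends G f \<and> (\<forall>g\<in>E. v \<in> ends G g \<longrightarrow> g = e \<or> g = f)"
    using assms by (simp add: two_regular_def)
  then show ?thesis using that by auto
qed

lemma perfect_matchingE:
  assumes "perfect_matching G M" "v \<in> verts G"
  obtains m where "m \<in> M" "v \<in> ends G m" "\<forall>f\<in>M. v \<in> ends G f \<longrightarrow> f = m"
proof -
  have "\<exists>!e. e \<in> M \<and> v \<in> ends G e" using assms by (simp add: perfect_matching_def)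
  then show ?thesis using that by (elim ex1E) auto
qed

lemma altset_imp_two_regular:
  assumes "altset G M E"
  shows "two_regular G E"
  unfolding two_regular_def
proof (intro conjI ballI)
  show "E \<subseteq> edges G" using assms by (simp add: altset_def)
  fix e v assume e: "e \<in> E" "v \<in> ends G e"
  obtain m p where mp: "m \<in> E" "m \<in> M" "p \<in> E" "p \<notin> M" "v \<in> ends G m" "v \<in> ends G p"
    "\<forall>f\<in>E. v \<in> ends G f \<longrightarrow> f = m \<or> f = p"
    using altsetE[OF assms e] .
  have "m \<noteq> p" using mp(2,4) by auto
  show "\<exists>f\<in>E. f \<noteq> e \<and> v \<in> ends G f \<and> (\<forall>g\<in>E. v \<in> ends G g \<longrightarrow> g = e \<or> g = f)"
  proof (cases "e = m")
    case True
    show ?thesis by (rule bexI[of _ p]) (use mp True \<open>m \<noteq> p\<close> in auto)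
  next
    case False
    then have "e = p" using mp(7) e by auto
    show ?thesis by (rule bexI[of _ m]) (use mp \<open>e = p\<close> \<open>m \<noteq> p\<close> in auto)
  qed
qed

text \<open>At \<open>v\<close> both sets have exactly two edges, so these coincide:
  \<open>C\<close> is a union of components of \<open>E\<close>.\<close>

lemma two_regular_closed:
  assumes "two_regular G E" "two_regular G C" "C \<subseteq> E" "e \<in> C" "v \<in> ends G e" "f \<in> E" "v \<in> ends G f"
  shows "f \<in> C"
proof -
  obtain g where g: "g \<in> C" "g \<noteq> e" "v \<in> ends G g" using two_regularE[OF assms(2,4,5)] by metis
  have eE: "e \<in> E" "g \<in> E" using assms g by auto
  obtain h where "\<forall>g\<in>E. v \<in> ends G g \<longrightarrow> g = e \<or> g = h"
    using two_regularE[OF assms(1) eE(1) assms(5)] by metis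
  then have "g = h" "f = e \<or> f = h" using g eE assms by metis+
  then show ?thesis using g assms by auto
qed

lemma altset_other:
  assumes "altset G M E" "e \<in> E" "f \<in> E" "e \<noteq> f" "v \<in> ends G e" "v \<in> ends G f"
  shows "e \<in> M \<longleftrightarrow> f \<notin> M"
proof -
  obtain m p where mp: "m \<in> M" "p \<notin> M" "\<forall>f\<in>E. v \<in> ends G f \<longrightarrow> f = m \<or> f = p"
    by (rule altsetE[OF assms(1,2,5)]) (rule that)
  then have "e = m \<or> e = p" "f = m \<or> f = p" using assms by auto
  then show ?thesis using mp(1,2) assms(4) by auto
qed

section \<open>Cycles as cyclic lists\<close>

lemma Suc_mod_eq: "k < n \<Longrightarrow> Suc k mod n = (if Suc k = n then 0 else Suc k)"
  by auto

lemma cycle_pred: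
  assumes "j < n" obtains i where "i < n" "Suc i mod n = j" "\<And>k. k < n \<Longrightarrow> Suc k mod n = j \<longleftrightarrow> k = i"
  by (rule that[of "if j = 0 then n - 1 else j - 1"]) (use assms in \<open>auto simp: Suc_mod_eq\<close>)

lemma cycle_seq_lengths:
  assumes "cycle_seq G vs es"
  shows "3 \<le> length vs" "length es = length vs" "distinct vs"
    "i < length vs \<Longrightarrow> es ! i \<in> edges G" "i < length vs \<Longrightarrow> ends G (es ! i) = {vs ! i, vs ! (Suc i mod length vs)}"
  using assms by (auto simp: cycle_seq_def)

text \<open>Equal edges have equal ends, and from length 3 on distinct indices give distinct pairs
  of cyclic neighbours.\<close>

lemma cycle_seq_edge_inj:
  assumes c: "cycle_seq G vs es" and ij: "i < length vs" "j < length vs" and eq: "es ! i = es ! j"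
  shows "i = j"
proof (rule ccontr)
  note l = cycle_seq_lengths[OF c]
  let ?n = "length vs"
  assume ne: "i \<noteq> j"
  have lt: "Suc i mod ?n < ?n" "Suc j mod ?n < ?n" using l(1) by (auto intro!: mod_less_divisor)
  have "{vs ! i, vs ! (Suc i mod ?n)} = {vs ! j, vs ! (Suc j mod ?n)}" using l(5) ij eq by metis
  then have "{i, Suc i mod ?n} = {j, Suc j mod ?n}"
    using lt ij l(3) by (auto simp: doubleton_eq_iff nth_eq_iff_index_eq)
  then show False using ne ij l(1) by (auto simp: doubleton_eq_iff Suc_mod_eq split: if_splits)
qed

lemma cycle_seq_at_vertex:
  assumes c: "cycle_seq G vs es" and ij: "i < length vs" "Suc i mod length vs = j" and f: "f \<in> set es"
  shows "vs ! j \<in> ends G f \<longleftrightarrow> f = es ! i \<or> f = es ! j"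
proof -
  note l = cycle_seq_lengths[OF c]
  have n0: "0 < length vs" using l(1) by linarith
  have j: "j < length vs" unfolding ij(2)[symmetric] using n0 by (rule mod_less_divisor)
  obtain k where k: "k < length vs" "f = es ! k" using f l(2) by (auto simp: in_set_conv_nth)
  have "vs ! j \<in> ends G f \<longleftrightarrow> j = k \<or> j = Suc k mod length vs"
    using l(3) k j mod_less_divisor[OF n0, of "Suc k"]
    by (simp add: l(5) nth_eq_iff_index_eq)
  also have "\<dots> \<longleftrightarrow> k = i \<or> k = j"
    using cycle_pred[OF j] ij k(1) by metis
  also have "\<dots> \<longleftrightarrow> f = es ! i \<or> f = es ! j"
    using cycle_seq_edge_inj[OF c] k ij(1) j by blast
  finally show ?thesis .
qed

lemma cycle_seq_vertex_index:
  assumes c: "cycle_seq G vs es" and "e \<in> set es" "v \<in> ends G e"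
  obtains i j where "i < length vs" "j < length vs" "Suc i mod length vs = j" "v = vs ! j" "es ! i \<noteq> es ! j"
proof -
  note l = cycle_seq_lengths[OF c]
  obtain k where k: "k < length vs" "e = es ! k" using assms(2) l(2) by (auto simp: in_set_conv_nth)
  have n0: "0 < length vs" using l(1) by linarith
  have "\<exists>j<length vs. v = vs ! j"
    using l(5)[OF k(1)] assms(3) k n0 by (metis insertE mod_less_divisor singletonD)
  then obtain j where j: "j < length vs" "v = vs ! j" by blast
  obtain i where i: "i < length vs" "Suc i mod length vs = j" using cycle_pred[OF j(1)] by metis
  have "i \<noteq> j" using i l(1) by (auto simp: Suc_mod_eq split: if_splits)
  then show ?thesis using that i j cycle_seq_edge_inj[OF c] by blast
qed

lemma cycle_seq_two_regular:
  assumes c: "cycle_seq G vs es"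
  shows "two_regular G (set es)"
  unfolding two_regular_def
proof (intro conjI ballI)
  note l = cycle_seq_lengths[OF c]
  show "set es \<subseteq> edges G" using l by (auto simp: in_set_conv_nth)
  fix e v assume e: "e \<in> set es" "v \<in> ends G e"
  obtain i j where ij: "i < length vs" "j < length vs" "Suc i mod length vs = j" "v = vs ! j" "es ! i \<noteq> es ! j"
    using cycle_seq_vertex_index[OF c e] .
  have in_es: "es ! i \<in> set es" "es ! j \<in> set es" using ij l(2) by auto
  have iff: "v \<in> ends G f \<longleftrightarrow> f = es ! i \<or> f = es ! j" if "f \<in> set es" for f
    using cycle_seq_at_vertex[OF c ij(1,3) that] ij(4) by simp
  show "\<exists>f\<in>set es. f \<noteq> e \<and> v \<in> ends G f \<and> (\<forall>g\<in>set es. v \<in> ends G g \<longrightarrow> g = e \<or> g = f)"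
  proof (cases "e = es ! i")
    case True
    show ?thesis by (rule bexI[of _ "es ! j"]) (use True ij(5) iff in_es in auto)
  next
    case False
    then have "e = es ! j" using iff e by blast
    then show ?thesis by (intro bexI[of _ "es ! i"]) (use ij(5) iff in_es in auto)
  qed
qed

lemma alternating_cycle_altset:
  assumes "alternating_cycle G M C"
  shows "altset G M C"
proof -
  obtain vs es where c: "cycle_seq G vs es" and C: "C = set es"
    and alt: "\<forall>i<length es. es ! i \<in> M \<longleftrightarrow> es ! (Suc i mod length es) \<notin> M"
    using assms unfolding alternating_cycle_def by blast
  note l = cycle_seq_lengths[OF c]
  show ?thesis unfolding altset_def
  proof (intro conjI ballI)
    show "C \<subseteq> edges G" using l C by (auto simp: in_set_conv_nth)
    fix e v assume e: "e \<in> C" "v \<in> ends G e"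
    obtain i j where ij: "i < length vs" "j < length vs" "Suc i mod length vs = j" "v = vs ! j" "es ! i \<noteq> es ! j"
      using cycle_seq_vertex_index[OF c] e C by metis
    have in_es: "es ! i \<in> C" "es ! j \<in> C" using ij l(2) C by auto
    have iff: "v \<in> ends G f \<longleftrightarrow> f = es ! i \<or> f = es ! j" if "f \<in> C" for f
      using cycle_seq_at_vertex[OF c ij(1,3)] that ij(4) C by simp
    have a: "es ! i \<in> M \<longleftrightarrow> es ! j \<notin> M" using alt ij l(2) by auto
    show "\<exists>m\<in>C \<inter> M. \<exists>p\<in>C - M. v \<in> ends G m \<and> v \<in> ends G p \<and> (\<forall>f\<in>C. v \<in> ends G f \<longrightarrow> f = m \<or> f = p)"
    proof (cases "es ! i \<in> M")
      case True
      show ?thesis by (rule bexI[of _ "es ! i"], rule bexI[of _ "es ! j"]) (use iff in_es a True in auto)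
    next
      case False
      show ?thesis by (rule bexI[of _ "es ! j"], rule bexI[of _ "es ! i"]) (use iff in_es a False in auto)
    qed
  qed
qed

lemma alternating_cycle_edges: "alternating_cycle G M C \<Longrightarrow> C \<subseteq> edges G"
  using alternating_cycle_altset by (auto simp: altset_def)

lemma altset_cycle_seq_alternating:
  assumes "altset G M E" and c: "cycle_seq G vs es" and "set es \<subseteq> E"
  shows "alternating_cycle G M (set es)"
  unfolding alternating_cycle_def
proof (intro exI conjI allI impI)
  note l = cycle_seq_lengths[OF c]
  show "cycle_seq G vs es" by (rule c)
  show "set es = set es" by simp
  fix i assume "i < length es"
  then have i: "i < length vs" using l(2) by simp
  let ?j = "Suc i mod length vs"
  have n0: "0 < length vs" using l(1) by linarith
  have j: "?j < length vs" using n0 by (rule mod_less_divisor)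
  have "i \<noteq> ?j" using i l(1) by (auto simp: Suc_mod_eq split: if_splits)
  then have "es ! i \<noteq> es ! ?j" using cycle_seq_edge_inj[OF c i j] by blast
  moreover have "vs ! ?j \<in> ends G (es ! i)" "vs ! ?j \<in> ends G (es ! ?j)" using l(5) i j by auto
  moreover have "es ! i \<in> E" "es ! ?j \<in> E" using assms(3) i j l(2) by auto
  ultimately show "es ! i \<in> M \<longleftrightarrow> es ! (Suc i mod length es) \<notin> M"
    using altset_other[OF assms(1)] l(2) by metis
qed

lemma perfect_matching_unique:
  assumes "perfect_matching G M" "v \<in> verts G" "e \<in> M" "v \<in> ends G e" "f \<in> M" "v \<in> ends G f"
  shows "e = f"
  using assms unfolding perfect_matching_def by blast

lemma ends_subset_verts: "ends G e \<subseteq> verts G"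
  by (simp add: ends_def)

lemma perfect_matching_flip:
  assumes pm: "perfect_matching G M" and alt: "altset G M E"
  shows "perfect_matching G ((M - E) \<union> (E - M))"
  unfolding perfect_matching_def
proof (intro conjI ballI)
  show "M - E \<union> (E - M) \<subseteq> edges G" using assms by (auto simp: perfect_matching_def altset_def)
  fix v assume v: "v \<in> verts G"
  obtain m where m: "m \<in> M" "v \<in> ends G m" "\<forall>f\<in>M. v \<in> ends G f \<longrightarrow> f = m"
    using perfect_matchingE[OF pm v] .
  show "\<exists>!e. e \<in> M - E \<union> (E - M) \<and> v \<in> ends G e"
  proof (cases "\<exists>e\<in>E. v \<in> ends G e")
    case True
    then obtain e where e: "e \<in> E" "v \<in> ends G e" by blast
    obtain m' p where mp: "m' \<in> E" "m' \<in> M" "p \<in> E" "p \<notin> M" "v \<in> ends G m'" "v \<in> ends G p"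
      "\<forall>f\<in>E. v \<in> ends G f \<longrightarrow> f = m' \<or> f = p"
      using altsetE[OF alt e] .
    have "m' = m" using m(3) mp by blast
    show ?thesis
    proof (rule ex1I[of _ p])
      fix f assume f: "f \<in> M - E \<union> (E - M) \<and> v \<in> ends G f"
      show "f = p"
      proof (cases "f \<in> M")
        case True
        then have "f = m" using m(3) f by blast
        then show ?thesis using f mp(1,2) \<open>m' = m\<close> True by blast
      next
        case False
        then show ?thesis using f mp(2,7) by blast
      qed
    qed (use mp in auto)
  next
    case False
    show ?thesis by (rule ex1I[of _ m]) (use False m in blast)+
  qed
qed

lemma perfect_matching_diff_altset:
  assumes "perfect_matching G M" "perfect_matching G N"
  shows "altset G M ((M - N) \<union> (N - M))"
  unfolding altset_def
proof (intro conjI ballI)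
  show "M - N \<union> (N - M) \<subseteq> edges G" using assms by (auto simp: perfect_matching_def)
  fix e v assume e: "e \<in> M - N \<union> (N - M)" "v \<in> ends G e"
  have v: "v \<in> verts G" using e ends_subset_verts by blast
  obtain m where m: "m \<in> M" "v \<in> ends G m" "\<forall>f\<in>M. v \<in> ends G f \<longrightarrow> f = m"
    using perfect_matchingE[OF assms(1) v] .
  obtain n where n: "n \<in> N" "v \<in> ends G n" "\<forall>f\<in>N. v \<in> ends G f \<longrightarrow> f = n"
    using perfect_matchingE[OF assms(2) v] .
  have "m \<noteq> n" using m(3) n(3) m(1) n(1) e by blast
  then have mn: "m \<notin> N" "n \<notin> M" using m n by blast+
  show "\<exists>m\<in>(M - N \<union> (N - M)) \<inter> M. \<exists>p\<in>(M - N \<union> (N - M)) - M. v \<in> ends G m \<and> v \<in> ends G p \<and>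
      (\<forall>f\<in>M - N \<union> (N - M). v \<in> ends G f \<longrightarrow> f = m \<or> f = p)"
    by (rule bexI[of _ m], rule bexI[of _ n]) (use m n mn in blast)+
qed

section \<open>Cycles in plane graphs and forcing sets\<close>

locale plane =
  fixes G :: pgraph
  assumes plane: "plane_graph G"
begin

lemma finite_verts: "finite (verts G)"
  using plane by (simp add: plane_graph_def)

lemma edge_arc:
  assumes "e \<in> edges G"
  obtains g where "arc g" "path_image g = e" "ends G e = {pathstart g, pathfinish g}"
proof -
  have "\<exists>g. arc g \<and> path_image g = e \<and> ends G e = {pathstart g, pathfinish g}"
    using plane assms by (simp add: plane_graph_def)
  then show ?thesis using that by blast
qed

lemma ends_inj: "e \<in> edges G \<Longrightarrow> f \<in> edges G \<Longrightarrow> ends G e = ends G f \<Longrightarrow> e = f"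
  using plane by (auto simp only: plane_graph_def)

lemma edges_meet: "e \<in> edges G \<Longrightarrow> f \<in> edges G \<Longrightarrow> e \<noteq> f \<Longrightarrow> e \<inter> f \<subseteq> verts G"
  using plane by (simp add: plane_graph_def)

lemma finite_edges: "finite (edges G)"
proof (rule finite_imageD)
  show "finite (ends G ` edges G)"
    by (rule finite_subset[of _ "Pow (verts G)"]) (auto simp: ends_def finite_verts)
  show "inj_on (ends G) (edges G)" using ends_inj by (auto simp: inj_on_def)
qed

lemma edge_ends:
  assumes "e \<in> edges G" "v \<in> ends G e"
  obtains w where "w \<noteq> v" "ends G e = {v, w}"
proof -
  obtain g where g: "arc g" "ends G e = {pathstart g, pathfinish g}" using assms edge_arc by blast
  then have "pathstart g \<noteq> pathfinish g" using arc_distinct_ends by metis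
  then show ?thesis using that g assms by (metis insertE insert_commute singletonD)
qed

lemma ends_nonempty: "e \<in> edges G \<Longrightarrow> \<exists>v. v \<in> ends G e"
  using edge_arc by (metis insertI1)

text \<open>Take a longest path in \<open>E\<close> that starts along \<open>e\<close>. The second
  edge at its last vertex leads back to the path by maximality. It cannot end at the predecessor,
  since there are no parallel edges, nor at another inner vertex, which would have degree three; so
  it closes the path at its start.\<close>

lemma two_regular_cycle:
  assumes reg: "two_regular G E" and e: "e \<in> E"
  obtains vs es where "cycle_seq G vs es" "e \<in> set es" "set es \<subseteq> E"
proof -
  have EG: "E \<subseteq> edges G" using reg by (simp add: two_regular_def)
  obtain a where "a \<in> ends G e" using ends_nonempty e EG by blast
  then obtain b where ab: "b \<noteq> a" "ends G e = {a, b}" using edge_ends e EG by blast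
  define walk where "walk ws \<longleftrightarrow> distinct ws \<and> 2 \<le> length ws \<and> ws ! 0 = a \<and> ws ! 1 = b \<and>
     (\<forall>i. Suc i < length ws \<longrightarrow> (\<exists>f\<in>E. ends G f = {ws ! i, ws ! Suc i}))" for ws
  have w0: "walk [a, b]" using ab e by (auto simp: walk_def)
  have bound: "length ws \<le> card (verts G)" if w: "walk ws" for ws
  proof -
    have "ws ! i \<in> verts G" if i: "i < length ws" for i
    proof (cases "Suc i < length ws")
      case True
      then show ?thesis using w ends_subset_verts unfolding walk_def by (metis insert_subset)
    next
      case False
      have "2 \<le> length ws" using w by (simp add: walk_def)
      then obtain k where "i = Suc k" "Suc k < length ws"
        using i False by (intro that[of "length ws - 2"]) auto
      then show ?thesis using w ends_subset_verts unfolding walk_def by (metis insert_subset)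
    qed
    then have "set ws \<subseteq> verts G" by (auto simp: in_set_conv_nth)
    then show ?thesis using w finite_verts by (metis card_mono distinct_card walk_def)
  qed
  obtain ws where ws: "walk ws" and max: "\<And>us. walk us \<Longrightarrow> length us \<le> length ws"
    using ex_has_greatest_nat[of walk, OF w0, of length] bound by (metis le_imp_less_Suc)
  define n where "n = length ws"
  have dist: "distinct ws" and n2: "2 \<le> n" and ws0: "ws ! 0 = a" "ws ! 1 = b"
    using ws by (auto simp: walk_def n_def)
  have nth_eq: "ws ! i = ws ! j \<longleftrightarrow> i = j" if "i < n" "j < n" for i j
    using that dist by (simp add: n_def nth_eq_iff_index_eq)
  obtain fe where fe: "fe i \<in> E" "ends G (fe i) = {ws ! i, ws ! Suc i}" if "Suc i < n" for i
    using ws unfolding walk_def n_def by metis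
  have third: "False" if "Suc i < n" "g \<in> E" "h \<in> E" "ws ! i \<in> ends G g" "ws ! i \<in> ends G h"
    "g \<noteq> h" "g \<noteq> fe i" "h \<noteq> fe i" for i g h
  proof -
    note ex = two_regularE[OF reg fe(1)[OF that(1)]]
    have "ws ! i \<in> ends G (fe i)" using fe(2)[OF that(1)] by simp
    from ex[OF this] obtain f where "\<forall>g\<in>E. ws ! i \<in> ends G g \<longrightarrow> g = fe i \<or> g = f"
      by metis
    then have "g = f" "h = f" using that by metis+
    then show False using that by simp
  qed
  define p where "p = n - 2"
  have np: "n = Suc (Suc p)" using n2 by (simp add: p_def)
  have last_in: "ws ! Suc p \<in> ends G (fe p)" using fe np by auto
  have "fe p \<in> E" using fe(1)[of p] np by simp
  then obtain f where f: "f \<in> E" "f \<noteq> fe p" "ws ! Suc p \<in> ends G f"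
    using two_regularE[OF reg _ last_in] by metis
  obtain w where w: "w \<noteq> ws ! Suc p" "ends G f = {ws ! Suc p, w}" using edge_ends f EG by blast
  have "w \<in> set ws"
  proof (rule ccontr)
    assume nw: "w \<notin> set ws"
    have "walk (ws @ [w])" unfolding walk_def
    proof (intro conjI allI impI)
      show "distinct (ws @ [w])" using dist nw by simp
      fix i assume "Suc i < length (ws @ [w])"
      then have "Suc i < n \<or> i = Suc p" using np by (auto simp: n_def)
      then show "\<exists>f\<in>E. ends G f = {(ws @ [w]) ! i, (ws @ [w]) ! Suc i}"
      proof
        assume "Suc i < n"
        then show ?thesis using fe[of i] by (intro bexI[of _ "fe i"]) (auto simp: nth_append n_def)
      next
        assume "i = Suc p"
        then show ?thesis using f w np n_def by (intro bexI[of _ f]) (auto simp: nth_append)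
      qed
    qed (use n2 ws0 in \<open>auto simp: n_def nth_append\<close>)
    then show False using max by fastforce
  qed
  then obtain j where j: "j < n" "w = ws ! j" by (auto simp: in_set_conv_nth n_def)
  have jn: "j \<noteq> Suc p" using w j by auto
  have jp: "j \<noteq> p"
  proof
    assume "j = p"
    then have "ends G f = ends G (fe p)" using w fe np j by auto
    then show False using ends_inj f fe np EG by (metis lessI subsetD)
  qed
  have "j = 0"
  proof (rule ccontr)
    assume "j \<noteq> 0"
    then obtain k where k: "j = Suc k" using not0_implies_Suc by blast
    have lt: "Suc j < n" "Suc p < n" "k < n" "p < n" using j jn np k by auto
    have e1: "ends G (fe k) = {ws ! k, ws ! j}" "ends G (fe j) = {ws ! j, ws ! Suc j}" "ends G f = {ws ! Suc p, ws ! j}"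
      using fe lt k w j by auto
    have "ends G (fe k) \<noteq> ends G f" "ends G (fe k) \<noteq> ends G (fe j)" "ends G f \<noteq> ends G (fe j)"
      unfolding e1 using lt jp jn k np by (auto simp: doubleton_eq_iff nth_eq)
    moreover have "fe k \<in> E" using fe(1)[of k] lt k by simp
    moreover have "ws ! j \<in> ends G (fe k)" "ws ! j \<in> ends G f" by (simp_all add: e1)
    ultimately show False using third[OF lt(1) _ f(1), of "fe k"] by metis
  qed
  then have fends: "ends G f = {ws ! Suc p, ws ! 0}" and p0: "p \<noteq> 0" using w j jp by auto
  define es where "es = map fe [0..<Suc p] @ [f]"
  have len: "length es = n" by (simp add: es_def np)
  have es_nth: "es ! i = (if i = Suc p then f else fe i)" if "i < n" for i
    using that np by (auto simp: es_def nth_append simp del: upt_Suc)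
  have cyc: "cycle_seq G ws es"
    unfolding cycle_seq_def n_def[symmetric]
  proof (intro conjI allI impI)
    fix i assume i: "i < n"
    show "es ! i \<in> edges G" using i es_nth f fe EG np by auto
    show "ends G (es ! i) = {ws ! i, ws ! (Suc i mod n)}"
      using i es_nth fends fe np by (auto simp: Suc_mod_eq)
  qed (use np p0 len dist in auto)
  have "ends G (fe 0) = ends G e" using fe[of 0] np ws0 ab by simp
  moreover have "fe 0 \<in> edges G" "e \<in> edges G" using fe(1)[of 0] np e EG by auto
  ultimately have "fe 0 = e" using ends_inj by blast
  then have "e \<in> set es" by (auto simp: es_def simp del: upt_Suc)
  moreover have "set es \<subseteq> E" using fe f np by (auto simp: es_def)
  ultimately show ?thesis using that cyc by blast
qed

lemma altset_cycle:
  assumes "altset G M E" "e \<in> E"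
  obtains C where "alternating_cycle G M C" "C \<subseteq> E" "e \<in> C"
  by (metis altset_cycle_seq_alternating altset_imp_two_regular assms two_regular_cycle)

text \<open>Flipping \<open>M\<close> along an alternating cycle gives another perfect matching, and
  any other perfect matching differs from \<open>M\<close> by a union of such cycles.\<close>

lemma forcing_set_iff:
  assumes pm: "perfect_matching G M"
  shows "forcing_set G M S \<longleftrightarrow> S \<subseteq> M \<and> (\<forall>C. alternating_cycle G M C \<longrightarrow> S \<inter> C \<noteq> {})"
proof (intro iffI conjI allI impI)
  fix C assume S: "forcing_set G M S" and C: "alternating_cycle G M C"
  show "S \<inter> C \<noteq> {}"
  proof
    assume d: "S \<inter> C = {}"
    have alt: "altset G M C" using C by (rule alternating_cycle_altset)
    have "S \<subseteq> (M - C) \<union> (C - M)" using S d by (auto simp: forcing_set_def)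
    moreover have "N = M" if "perfect_matching G N" "S \<subseteq> N" for N
      using S that by (simp add: forcing_set_def)
    ultimately have eq: "(M - C) \<union> (C - M) = M"
      using perfect_matching_flip[OF pm alt] by blast
    obtain vs es where "cycle_seq G vs es" "C = set es" using C unfolding alternating_cycle_def by blast
    then have "C \<noteq> {}" by (auto simp: cycle_seq_def)
    moreover have "C \<subseteq> edges G" using C by (rule alternating_cycle_edges)
    ultimately obtain e v where "e \<in> C" "v \<in> ends G e" using ends_nonempty by blast
    then have "\<exists>f. f \<in> C - M" using altsetE[OF alt] by (metis DiffI)
    then show False using eq by blast
  qed
next
  assume S: "S \<subseteq> M \<and> (\<forall>C. alternating_cycle G M C \<longrightarrow> S \<inter> C \<noteq> {})"
  have "N = M" if N: "perfect_matching G N" "S \<subseteq> N" for N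
  proof (rule ccontr)
    assume "N \<noteq> M"
    then obtain e where "e \<in> (M - N) \<union> (N - M)" by blast
    then obtain C where "alternating_cycle G M C" "C \<subseteq> (M - N) \<union> (N - M)"
      using altset_cycle[OF perfect_matching_diff_altset[OF pm N(1)]] by blast
    then show False using S N by blast
  qed
  then show "forcing_set G M S" using S by (simp add: forcing_set_def)
qed (simp add: forcing_set_def)

end

section \<open>Winding numbers of circulations\<close>

context plane
begin

lemma compact_edge: "e \<in> edges G \<Longrightarrow> compact e"
  by (metis arc_imp_path compact_path_image edge_arc)

lemma closed_edge: "e \<in> edges G \<Longrightarrow> closed e"
  using compact_edge compact_imp_closed by blast

lemma edge_interior:
  assumes "e \<in> edges G"
  shows "e - verts G \<noteq> {}" "connected (e - verts G)" "e \<subseteq> closure (e - verts G)"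
proof -
  obtain g where g: "arc g" "path_image g = e" "ends G e = {pathstart g, pathfinish g}"
    using edge_arc[OF assms] .
  have inj: "inj_on g {0..1}" and cont: "continuous_on {0..1} g"
    using g(1) by (auto simp: arc_def path_def)
  have eq: "e - verts G = g ` {0<..<1}"
  proof -
    have "e - verts G = e - ends G e" by (auto simp: ends_def)
    also have "\<dots> = g ` {0..1} - g ` {0, 1}"
      using g by (auto simp: path_image_def pathstart_def pathfinish_def)
    also have "\<dots> = g ` ({0..1} - {0, 1})"
      using inj by (intro inj_on_image_set_diff[symmetric]) auto
    also have "{0..1} - {0, 1} = {0<..<1::real}" by auto
    finally show ?thesis .
  qed
  show "e - verts G \<noteq> {}" unfolding eq by auto
  show "connected (e - verts G)" unfolding eq
    by (intro connected_continuous_image continuous_on_subset[OF cont]) auto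
  have "g ` closure {0<..<1} \<subseteq> closure (g ` {0<..<1})"
    using cont by (intro image_closure_subset closure_subset) auto
  then show "e \<subseteq> closure (e - verts G)" unfolding eq using g(2) by (simp add: path_image_def)
qed

text \<open>Used to join one end of an edge to its inner points without touching the other
  end.\<close>

lemma connected_edge_part:
  assumes "e \<in> edges G" "e - verts G \<subseteq> T" "T \<subseteq> e"
  shows "connected T"
  using edge_interior(2)[OF assms(1)] assms(2) order_trans[OF assms(3) edge_interior(3)[OF assms(1)]]
  by (rule connected_intermediate_closure)

end

section \<open>Circulations and their potentials\<close>

locale plane_bip = plane +
  fixes P :: "complex set"
  assumes P_verts: "P \<subseteq> verts G"
    and P_ends: "e \<in> edges G \<Longrightarrow> \<exists>a\<in>P. \<exists>b\<in>verts G - P. ends G e = {a, b}"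
begin

lemma oriented_arc:
  assumes "e \<in> edges G"
  shows "\<exists>g. arc g \<and> path_image g = e \<and> pathstart g \<in> P \<and> pathfinish g \<notin> P \<and>
             ends G e = {pathstart g, pathfinish g}"
proof -
  obtain g where g: "arc g" "path_image g = e" "ends G e = {pathstart g, pathfinish g}"
    using edge_arc[OF assms] .
  obtain a b where ab: "a \<in> P" "b \<notin> P" "ends G e = {a, b}" using P_ends[OF assms] by blast
  then consider "pathstart g = a" "pathfinish g = b" | "pathstart g = b" "pathfinish g = a"
    using g by (metis doubleton_eq_iff)
  then show ?thesis
  proof cases
    case 1
    then show ?thesis using g ab by (intro exI[of _ g]) auto
  next
    case 2
    then show ?thesis using g ab by (intro exI[of _ "reversepath g"]) (auto simp: arc_reversepath)
  qed
qed

definition garc :: "complex set \<Rightarrow> real \<Rightarrow> complex" where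
  "garc e = (SOME g. arc g \<and> path_image g = e \<and> pathstart g \<in> P \<and> pathfinish g \<notin> P \<and>
             ends G e = {pathstart g, pathfinish g})"

lemma garc:
  assumes "e \<in> edges G"
  shows "arc (garc e)" "path_image (garc e) = e" "pathstart (garc e) \<in> P" "pathfinish (garc e) \<notin> P"
    "ends G e = {pathstart (garc e), pathfinish (garc e)}"
  using someI_ex[OF oriented_arc[OF assms]] unfolding garc_def by blast+

text \<open>The winding number of an open arc is complex. Its real part is the swept angle in full
  turns; its imaginary part only records the ratio of the distances of the ends from
  \<open>z\<close>.\<close>

definition wn :: "complex set \<Rightarrow> complex \<Rightarrow> real" where
  "wn e z = Re (winding_number (garc e) z)"

text \<open>The potential of a flow. For a circulation it is integral and locally constant off the
  support.\<close>

definition W :: "(complex set \<Rightarrow> int) \<Rightarrow> complex \<Rightarrow> real" where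
  "W x z = (\<Sum>e\<in>edges G. of_int (x e) * wn e z)"

text \<open>
  Edges are oriented from \<open>P\<close> to its complement, so conservation at a vertex is the vanishing
  of the plain sum over the incident edges.
\<close>

definition circ :: "(complex set \<Rightarrow> int) \<Rightarrow> bool" where
  "circ x \<longleftrightarrow> (\<forall>v\<in>verts G. (\<Sum>e | e \<in> edges G \<and> v \<in> ends G e. x e) = 0)"

definition supp :: "(complex set \<Rightarrow> int) \<Rightarrow> complex set" where
  "supp x = \<Union>{e \<in> edges G. x e \<noteq> 0}"

lemma W_diff: "W (\<lambda>e. x e - y e) z = W x z - W y z"
  by (simp add: W_def sum_subtractf algebra_simps)

lemma W_scale: "W (\<lambda>e. k * x e) z = of_int k * W x z"
  by (simp add: W_def sum_distrib_left algebra_simps)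

lemma circ_diff: "circ x \<Longrightarrow> circ y \<Longrightarrow> circ (\<lambda>e. x e - y e)"
  by (simp add: circ_def sum_subtractf)

lemma circ_scale: "circ x \<Longrightarrow> circ (\<lambda>e. k * x e)"
  by (simp add: circ_def flip: sum_distrib_left)

text \<open>The exponential of 2 pi i times the winding number is the quotient (b - z)/(a - z), so
  the winding number is a difference of principal logarithms up to an integer.\<close>

lemma wn_logs:
  assumes e: "e \<in> edges G" and z: "z \<notin> e"
  defines "l v \<equiv> Re (Ln (v - z) / (2 * of_real pi * \<i>))"
  shows "\<exists>n::int. wn e z = l (pathfinish (garc e)) - l (pathstart (garc e)) + of_int n"
proof -
  let ?a = "pathstart (garc e)" and ?b = "pathfinish (garc e)"
  let ?w = "winding_number (garc e) z"
  have ends: "?a \<in> e" "?b \<in> e" using garc(2)[OF e] by auto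
  then have ne: "?a - z \<noteq> 0" "?b - z \<noteq> 0" using z by auto
  have "exp (Ln (?b - z)) = exp (2 * of_real pi * \<i> * ?w) * exp (Ln (?a - z))"
    using winding_number_exp_2pi[of "garc e" z] garc(1,2)[OF e] z ne
    by (simp add: arc_imp_path)
  then have "exp (2 * of_real pi * \<i> * ?w + Ln (?a - z)) = exp (Ln (?b - z))"
    by (simp add: exp_add)
  then obtain n :: int where
    n: "2 * of_real pi * \<i> * ?w + Ln (?a - z) = Ln (?b - z) + of_int (2 * n) * of_real pi * \<i>"
    by (auto simp: exp_eq)
  have "2 * of_real pi * \<i> * ?w = Ln (?b - z) - Ln (?a - z) + of_int n * (2 * of_real pi * \<i>)"
    using n by (simp add: algebra_simps)
  then have "?w = (Ln (?b - z) - Ln (?a - z) + of_int n * (2 * of_real pi * \<i>)) / (2 * of_real pi * \<i>)"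
    by (simp add: nonzero_eq_divide_eq mult.commute)
  also have "\<dots> = Ln (?b - z) / (2 * of_real pi * \<i>) - Ln (?a - z) / (2 * of_real pi * \<i>) + of_int n"
    by (simp add: diff_divide_distrib add_divide_distrib)
  finally have "wn e z = l ?b - l ?a + of_int n" by (simp add: wn_def l_def)
  then show ?thesis by blast
qed

text \<open>Collected by vertices, the logarithm at \<open>v\<close> is multiplied by the sum of
  \<open>x\<close> over the edges at \<open>v\<close>, which is 0; only integers remain.\<close>

lemma W_int:
  assumes c: "circ x" and z: "z \<notin> supp x"
  shows "W x z \<in> \<int>"
proof -
  define l where "l v = Re (Ln (v - z) / (2 * of_real pi * \<i>))" for v
  \<comment> \<open>Every edge starts in \<open>P\<close>, so a vertex of \<open>P\<close> always
    contributes as a start, with a minus sign.\<close>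
  define s where "s v = (if v \<in> P then - l v else l v)" for v
  have "\<exists>n::int. x e \<noteq> 0 \<longrightarrow> wn e z = l (pathfinish (garc e)) - l (pathstart (garc e)) + of_int n"
    if "e \<in> edges G" for e
  proof (cases "x e = 0")
    case False
    then have "z \<notin> e" using z that by (auto simp: supp_def)
    then show ?thesis using wn_logs[OF that, of z] by (auto simp: l_def)
  qed simp
  then obtain n :: "complex set \<Rightarrow> int" where n: "x e \<noteq> 0 \<Longrightarrow>
    wn e z = l (pathfinish (garc e)) - l (pathstart (garc e)) + of_int (n e)" if "e \<in> edges G" for e
    by metis
  have s: "l (pathfinish (garc e)) - l (pathstart (garc e)) = (\<Sum>v\<in>verts G. if v \<in> ends G e then s v else 0)"
    if e: "e \<in> edges G" for e
  proof -
    have "(\<Sum>v\<in>verts G. if v \<in> ends G e then s v else 0) = (\<Sum>v\<in>verts G \<inter> ends G e. s v)"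
      using finite_verts by (simp add: sum.inter_restrict)
    also have "verts G \<inter> ends G e = {pathstart (garc e), pathfinish (garc e)}"
      using garc(5)[OF e] ends_subset_verts by blast
    also have "(\<Sum>v\<in>{pathstart (garc e), pathfinish (garc e)}. s v) = l (pathfinish (garc e)) - l (pathstart (garc e))"
      using garc(3,4)[OF e] by (subst sum.insert) (auto simp: s_def)
    finally show ?thesis by simp
  qed
  have "W x z = (\<Sum>e\<in>edges G. of_int (x e) * (\<Sum>v\<in>verts G. if v \<in> ends G e then s v else 0) + of_int (x e * n e))"
    unfolding W_def
  proof (rule sum.cong)
    fix e assume e: "e \<in> edges G"
    show "of_int (x e) * wn e z =
      of_int (x e) * (\<Sum>v\<in>verts G. if v \<in> ends G e then s v else 0) + of_int (x e * n e)"
      using n[OF e] s[OF e] by (cases "x e = 0") (auto simp: algebra_simps)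
  qed simp
  also have "\<dots> = (\<Sum>e\<in>edges G. \<Sum>v\<in>verts G. if v \<in> ends G e then of_int (x e) * s v else 0)
      + of_int (\<Sum>e\<in>edges G. x e * n e)"
    by (simp add: sum.distrib sum_distrib_left if_distrib cong: if_cong)
  also have "(\<Sum>e\<in>edges G. \<Sum>v\<in>verts G. if v \<in> ends G e then of_int (x e) * s v else 0)
      = (\<Sum>v\<in>verts G. \<Sum>e\<in>edges G. if v \<in> ends G e then of_int (x e) * s v else 0)"
    by (rule sum.swap)
  also have "\<dots> = (\<Sum>v\<in>verts G. 0)"
  proof (rule sum.cong)
    fix v assume v: "v \<in> verts G"
    have "(\<Sum>e\<in>edges G. if v \<in> ends G e then of_int (x e) * s v else 0)
        = (\<Sum>e | e \<in> edges G \<and> v \<in> ends G e. of_int (x e) * s v)"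
      using finite_edges by (simp add: sum.inter_filter)
    also have "\<dots> = of_int (\<Sum>e | e \<in> edges G \<and> v \<in> ends G e. x e) * s v"
      by (simp add: sum_distrib_right)
    also have "\<dots> = 0" using c v by (simp add: circ_def)
    finally show "(\<Sum>e\<in>edges G. if v \<in> ends G e then of_int (x e) * s v else 0) = 0" .
  qed simp
  finally have "W x z = of_int (\<Sum>e\<in>edges G. x e * n e)" by (simp only: sum.neutral_const add_0_left)
  then show ?thesis by (metis Ints_of_int)
qed

text \<open>An edge with \<open>x e = 0\<close> contributes nothing even at its own points, so the
  potential passes continuously through it and through vertices off the support. Evaluating
  potentials on the graph itself rests on this.\<close>

lemma W_cont: "continuous_on (- supp x) (W x)"
  unfolding W_def[abs_def]
proof (intro continuous_on_sum)
  fix e assume e: "e \<in> edges G"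
  show "continuous_on (- supp x) (\<lambda>z. of_int (x e) * wn e z)"
  proof (cases "x e = 0")
    case False
    then have "- supp x \<subseteq> - e" using e by (auto simp: supp_def)
    moreover have "continuous_on (- e) (winding_number (garc e))"
      using continuous_on_winding_number[of "garc e"] garc(1,2)[OF e] by (simp add: arc_imp_path)
    ultimately have "continuous_on (- supp x) (winding_number (garc e))"
      using continuous_on_subset by blast
    then show ?thesis unfolding wn_def by (intro continuous_intros)
  qed simp
qed

lemma W_const:
  assumes "circ x" "connected T" "T \<inter> supp x = {}" "z \<in> T" "w \<in> T"
  shows "W x z = W x w"
proof -
  have "W x constant_on T"
  proof (rule continuous_discrete_range_constant)
    show "continuous_on T (W x)" using W_cont by (rule continuous_on_subset) (use assms in auto)
    fix p assume p: "p \<in> T"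
    show "\<exists>e>0. \<forall>q. q \<in> T \<and> W x q \<noteq> W x p \<longrightarrow> e \<le> norm (W x q - W x p)"
    proof (intro exI[of _ 1] conjI allI impI)
      fix q assume q: "q \<in> T \<and> W x q \<noteq> W x p"
      then have "W x q \<in> \<int>" "W x p \<in> \<int>" using W_int assms p by blast+
      then obtain a b where "W x q = of_int a" "W x p = of_int b" by (auto elim!: Ints_cases)
      then show "1 \<le> norm (W x q - W x p)" using q by auto
    qed simp
  qed (rule assms)
  then show ?thesis using assms by (metis constant_on_def)
qed

end

section \<open>Cycles as Jordan curves\<close>

context plane_bip
begin

text \<open>An edge traversed from \<open>v\<close> runs with the orientation of \<open>garc\<close>
  if \<open>v\<close> is in \<open>P\<close> and against it otherwise.\<close>

definition edge_sign :: "complex \<Rightarrow> real" where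
  "edge_sign v = (if v \<in> P then 1 else - 1)"

lemma oriented_edge:
  assumes "e \<in> edges G" "ends G e = {u, v}" "u \<noteq> v"
  obtains h where "arc h" "path_image h = e" "pathstart h = u" "pathfinish h = v"
    "\<And>z. z \<notin> e \<Longrightarrow> Re (winding_number h z) = edge_sign u * wn e z"
proof (cases "u \<in> P")
  case True
  then have "pathstart (garc e) = u" "pathfinish (garc e) = v"
    using garc(3-5)[OF assms(1)] assms(2,3) by (metis doubleton_eq_iff)+
  then show ?thesis using that[of "garc e"] garc(1,2)[OF assms(1)] True
    by (simp add: wn_def edge_sign_def)
next
  case False
  then have "pathstart (garc e) = v" "pathfinish (garc e) = u"
    using garc(3-5)[OF assms(1)] assms(2,3) by (metis doubleton_eq_iff)+
  then show ?thesis using that[of "reversepath (garc e)"] garc(1,2)[OF assms(1)] False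
    by (simp add: wn_def edge_sign_def arc_reversepath winding_number_reversepath arc_imp_path)
qed

text \<open>The closing edge is left to \<open>cycle_curve\<close>: up to there the joined path is
  still an arc.\<close>

lemma cycle_walk:
  assumes c: "cycle_seq G vs es" and k: "0 < k" "k < length vs"
  shows "\<exists>\<gamma>. arc \<gamma> \<and> pathstart \<gamma> = vs ! 0 \<and> pathfinish \<gamma> = vs ! k \<and> path_image \<gamma> = (\<Union>i<k. es ! i) \<and>
    (\<forall>z. z \<notin> path_image \<gamma> \<longrightarrow> Re (winding_number \<gamma> z) = (\<Sum>i<k. edge_sign (vs ! i) * wn (es ! i) z))"
  using k
proof (induction k)
  case (Suc k)
  note l = cycle_seq_lengths[OF c]
  have kn: "k < length vs" "Suc k mod length vs = Suc k" using Suc.prems by auto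
  have ends: "ends G (es ! k) = {vs ! k, vs ! Suc k}" using l(5)[OF kn(1)] kn(2) by simp
  have "vs ! k \<noteq> vs ! Suc k" using l(3) Suc.prems by (simp add: nth_eq_iff_index_eq)
  then obtain h where h: "arc h" "path_image h = es ! k" "pathstart h = vs ! k" "pathfinish h = vs ! Suc k"
    "\<And>z. z \<notin> es ! k \<Longrightarrow> Re (winding_number h z) = edge_sign (vs ! k) * wn (es ! k) z"
    using oriented_edge[OF l(4)[OF kn(1)] ends] by metis
  show ?case
  proof (cases "k = 0")
    case True
    then show ?thesis using h by (intro exI[of _ h]) auto
  next
    case False
    then obtain \<gamma> where g: "arc \<gamma>" "pathstart \<gamma> = vs ! 0" "pathfinish \<gamma> = vs ! k" "path_image \<gamma> = (\<Union>i<k. es ! i)"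
      "\<And>z. z \<notin> path_image \<gamma> \<Longrightarrow> Re (winding_number \<gamma> z) = (\<Sum>i<k. edge_sign (vs ! i) * wn (es ! i) z)"
      using Suc.IH kn by auto
    have int: "path_image \<gamma> \<inter> path_image h \<subseteq> {pathstart h}"
    proof
      fix p assume p: "p \<in> path_image \<gamma> \<inter> path_image h"
      then obtain i where i: "i < k" "p \<in> es ! i" "p \<in> es ! k" using g(4) h(2) by auto
      have ik: "i < length vs" "Suc i mod length vs = Suc i" using i kn by auto
      have "es ! i \<noteq> es ! k" using cycle_seq_edge_inj[OF c ik(1) kn(1)] i by auto
      then have "p \<in> verts G" using edges_meet l(4) ik(1) kn(1) i by blast
      then have "p \<in> ends G (es ! i)" "p \<in> ends G (es ! k)" using i by (auto simp: ends_def)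
      then have "p \<in> {vs ! i, vs ! Suc i}" "p \<in> {vs ! k, vs ! Suc k}"
        using l(5)[OF ik(1)] ik(2) ends by auto
      moreover have "vs ! Suc k \<noteq> vs ! i" "vs ! Suc k \<noteq> vs ! Suc i"
        using l(3) Suc.prems i by (simp_all add: nth_eq_iff_index_eq)
      ultimately show "p \<in> {pathstart h}" using h(3) by auto
    qed
    have "path_image (\<gamma> +++ h) = (\<Union>i<Suc k. es ! i)"
      using g h by (subst path_image_join) (auto simp: lessThan_Suc)
    moreover have "Re (winding_number (\<gamma> +++ h) z) = (\<Sum>i<Suc k. edge_sign (vs ! i) * wn (es ! i) z)"
      if "z \<notin> path_image (\<gamma> +++ h)" for z
    proof -
      have z: "z \<notin> path_image \<gamma>" "z \<notin> path_image h"
        using that g(3) h(3) by (auto simp: path_image_join)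
      then have "winding_number (\<gamma> +++ h) z = winding_number \<gamma> z + winding_number h z"
        using g h by (intro winding_number_join) (auto simp: arc_imp_path)
      then show ?thesis using g(5)[OF z(1)] h(5) z(2) h(2) by simp
    qed
    ultimately show ?thesis using g h arc_join[OF g(1) h(1) _ int]
      by (intro exI[of _ "\<gamma> +++ h"]) auto
  qed
qed simp

lemma cycle_curve:
  assumes c: "cycle_seq G vs es"
  shows "\<exists>\<gamma>. simple_path \<gamma> \<and> pathfinish \<gamma> = pathstart \<gamma> \<and> path_image \<gamma> = \<Union>(set es) \<and>
    (\<forall>z. z \<notin> path_image \<gamma> \<longrightarrow>
       Re (winding_number \<gamma> z) = (\<Sum>i<length vs. edge_sign (vs ! i) * wn (es ! i) z))"
proof -
  note l = cycle_seq_lengths[OF c]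
  define m where "m = length vs - 1"
  have m: "length vs = Suc m" "0 < m" "m < length vs" using l(1) by (auto simp: m_def)
  obtain \<gamma> where g: "arc \<gamma>" "pathstart \<gamma> = vs ! 0" "pathfinish \<gamma> = vs ! m" "path_image \<gamma> = (\<Union>i<m. es ! i)"
      "\<And>z. z \<notin> path_image \<gamma> \<Longrightarrow> Re (winding_number \<gamma> z) = (\<Sum>i<m. edge_sign (vs ! i) * wn (es ! i) z)"
    using cycle_walk[OF c m(2,3)] by blast
  have ends: "ends G (es ! m) = {vs ! m, vs ! 0}" using l(5)[OF m(3)] m(1) by simp
  have "vs ! m \<noteq> vs ! 0" using l(3) m by (simp add: nth_eq_iff_index_eq)
  then obtain h where h: "arc h" "path_image h = es ! m" "pathstart h = vs ! m" "pathfinish h = vs ! 0"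
    "\<And>z. z \<notin> es ! m \<Longrightarrow> Re (winding_number h z) = edge_sign (vs ! m) * wn (es ! m) z"
    using oriented_edge[OF l(4)[OF m(3)] ends] by metis
  have int: "path_image \<gamma> \<inter> path_image h \<subseteq> {pathstart \<gamma>, pathstart h}"
  proof
    fix p assume p: "p \<in> path_image \<gamma> \<inter> path_image h"
    then obtain i where i: "i < m" "p \<in> es ! i" "p \<in> es ! m" using g(4) h(2) by auto
    have ik: "i < length vs" using i m by auto
    have "es ! i \<noteq> es ! m" using cycle_seq_edge_inj[OF c ik m(3)] i by auto
    then have "p \<in> verts G" using edges_meet l(4) ik m(3) i by blast
    then have "p \<in> ends G (es ! m)" using i by (auto simp: ends_def)
    then show "p \<in> {pathstart \<gamma>, pathstart h}" using ends g(2) h(3) by auto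
  qed
  have "set es = (\<lambda>i. es ! i) ` {..<Suc m}"
    using l(2) m(1) by (auto simp: set_conv_nth)
  then have "\<Union>(set es) = (\<Union>i<m. es ! i) \<union> es ! m" by (auto simp: lessThan_Suc)
  then have im: "path_image (\<gamma> +++ h) = \<Union>(set es)"
    using g h by (subst path_image_join) auto
  have "Re (winding_number (\<gamma> +++ h) z) = (\<Sum>i<length vs. edge_sign (vs ! i) * wn (es ! i) z)"
    if "z \<notin> path_image (\<gamma> +++ h)" for z
  proof -
    have z: "z \<notin> path_image \<gamma>" "z \<notin> path_image h"
      using that g(3) h(3) by (auto simp: path_image_join)
    then have "winding_number (\<gamma> +++ h) z = winding_number \<gamma> z + winding_number h z"
      using g h by (intro winding_number_join) (auto simp: arc_imp_path)
    then show ?thesis using g(5)[OF z(1)] h(5) z(2) h(2) m(1) by simp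
  qed
  moreover have "simple_path (\<gamma> +++ h)"
    using g h int by (intro simple_path_join_loop) auto
  ultimately show ?thesis using g h im by (intro exI[of _ "\<gamma> +++ h"]) auto
qed

lemma cycle_jordan:
  assumes "cycle_seq G vs es"
  defines "S \<equiv> \<Union>(set es)"
  shows "inside S \<noteq> {}" "outside S \<noteq> {}" "open (inside S)" "connected (inside S)" "open (outside S)" "connected (outside S)"
    "bounded (inside S)" "\<not> bounded (outside S)" "inside S \<inter> outside S = {}" "inside S \<union> outside S = - S"
    "frontier (inside S) = S" "frontier (outside S) = S" "compact S" "connected S"
proof -
  obtain \<gamma> where g: "simple_path \<gamma>" "pathfinish \<gamma> = pathstart \<gamma>" "path_image \<gamma> = S"
    using cycle_curve[OF assms(1)] unfolding S_def by blast
  show "inside S \<noteq> {}" "outside S \<noteq> {}" "open (inside S)" "connected (inside S)" "open (outside S)" "connected (outside S)"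
    "bounded (inside S)" "\<not> bounded (outside S)" "inside S \<inter> outside S = {}" "inside S \<union> outside S = - S"
    "frontier (inside S) = S" "frontier (outside S) = S"
    using Jordan_inside_outside[OF g(1,2)] unfolding g(3) by blast+
  show "compact S" "connected S"
    using g by (auto simp: compact_simple_path_image connected_simple_path_image)
qed

lemma edge_sign_step:
  assumes "e \<in> edges G" "ends G e = {u, v}"
  shows "edge_sign v = - edge_sign u"
  using P_ends[OF assms(1)] assms(2) by (auto simp: edge_sign_def doubleton_eq_iff)

text \<open>Conservation makes \<open>x\<close> change sign from edge to edge, and so does
  \<open>edge_sign\<close>. Their product is a constant, which makes \<open>W x\<close> that
  constant times the winding number of the Jordan curve.\<close>

lemma cycle_W:
  assumes c: "cycle_seq G vs es" and x: "circ x"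
    and x0: "\<And>e. e \<notin> set es \<Longrightarrow> x e = 0" and x1: "\<And>e. e \<in> set es \<Longrightarrow> \<bar>x e\<bar> = 1"
  shows "\<exists>\<sigma>\<in>{1, -1}. (\<forall>z\<in>inside (\<Union>(set es)). W x z = \<sigma>) \<and> (\<forall>z\<in>outside (\<Union>(set es)). W x z = 0)"
proof -
  note l = cycle_seq_lengths[OF c]
  let ?n = "length vs"
  obtain \<gamma> where g: "simple_path \<gamma>" "pathfinish \<gamma> = pathstart \<gamma>" "path_image \<gamma> = \<Union>(set es)"
    "\<And>z. z \<notin> path_image \<gamma> \<Longrightarrow> Re (winding_number \<gamma> z) = (\<Sum>i<?n. edge_sign (vs ! i) * wn (es ! i) z)"
    using cycle_curve[OF c] by blast
  have esE: "set es \<subseteq> edges G" using cycle_seq_two_regular[OF c] by (simp add: two_regular_def)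
  have "distinct es" using cycle_seq_edge_inj[OF c] l(2) by (auto simp: distinct_conv_nth)
  then have bij: "bij_betw ((!) es) {..<?n} (set es)"
    using l(2) bij_betw_nth[of es "{..<?n}" "set es"] by simp
  have step: "x (es ! Suc i) = - x (es ! i)" if i: "Suc i < ?n" for i
  proof -
    let ?v = "vs ! Suc i"
    have v: "?v \<in> verts G" using l(5)[of "Suc i"] i ends_subset_verts by blast
    have "es ! i \<in> set es" "es ! Suc i \<in> set es" using i l(2) by auto
    then have *: "{e\<in>set es. ?v \<in> ends G e} = {es ! i, es ! Suc i}"
      using cycle_seq_at_vertex[OF c _ _ , of i "Suc i"] i by auto
    have "0 = (\<Sum>e | e \<in> edges G \<and> ?v \<in> ends G e. x e)" using x v by (simp add: circ_def)
    also have "\<dots> = (\<Sum>e\<in>{e\<in>set es. ?v \<in> ends G e}. x e)"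
      using esE finite_edges x0 by (intro sum.mono_neutral_right) auto
    also have "\<dots> = x (es ! i) + x (es ! Suc i)"
      unfolding * using cycle_seq_edge_inj[OF c, of i "Suc i"] i by (subst sum.insert) auto
    finally show ?thesis by simp
  qed
  define \<kappa> where "\<kappa> = of_int (x (es ! 0)) * edge_sign (vs ! 0)"
  have \<kappa>: "of_int (x (es ! i)) * edge_sign (vs ! i) = \<kappa>" if "i < ?n" for i
    using that
  proof (induction i)
    case (Suc i)
    have "edge_sign (vs ! Suc i) = - edge_sign (vs ! i)"
      using edge_sign_step[OF l(4)[of i] l(5)[of i]] Suc.prems by simp
    then show ?case using Suc step by simp
  qed (simp add: \<kappa>_def)
  have "0 < length es" using l(1,2) by linarith
  then have "\<bar>x (es ! 0)\<bar> = 1" by (intro x1 nth_mem)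
  then have \<kappa>1: "\<kappa> \<in> {1, -1}" by (auto simp: \<kappa>_def edge_sign_def abs_if split: if_splits)
  have W: "W x z = \<kappa> * Re (winding_number \<gamma> z)" if z: "z \<notin> path_image \<gamma>" for z
  proof -
    have "W x z = (\<Sum>e\<in>set es. of_int (x e) * wn e z)"
      unfolding W_def using esE finite_edges x0 by (intro sum.mono_neutral_right) auto
    also have "\<dots> = (\<Sum>i<?n. of_int (x (es ! i)) * wn (es ! i) z)"
      by (rule sum.reindex_bij_betw[OF bij, symmetric])
    also have "\<dots> = (\<Sum>i<?n. \<kappa> * (edge_sign (vs ! i) * wn (es ! i) z))"
    proof (rule sum.cong)
      fix i assume "i \<in> {..<?n}"
      moreover have "edge_sign (vs ! i) * edge_sign (vs ! i) = 1" by (simp add: edge_sign_def)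
      ultimately show "of_int (x (es ! i)) * wn (es ! i) z = \<kappa> * (edge_sign (vs ! i) * wn (es ! i) z)"
        using \<kappa>[of i] by (metis lessThan_iff mult.assoc mult.commute mult.right_neutral)
    qed simp
    also have "\<dots> = \<kappa> * Re (winding_number \<gamma> z)" using g(4)[OF z] by (simp add: sum_distrib_left)
    finally show ?thesis .
  qed
  have out: "W x z = 0" if "z \<in> outside (path_image \<gamma>)" for z
    using W[of z] winding_number_zero_in_outside[OF simple_path_imp_path[OF g(1)] g(2) that] that
    by (simp add: outside_def)
  consider "\<And>z. z \<in> inside (path_image \<gamma>) \<Longrightarrow> winding_number \<gamma> z = 1"
    | "\<And>z. z \<in> inside (path_image \<gamma>) \<Longrightarrow> winding_number \<gamma> z = -1"
    using simple_closed_path_winding_number_inside[OF g(1)] by metis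
  then show ?thesis
  proof cases
    case 1
    have "W x z = \<kappa>" if "z \<in> inside (path_image \<gamma>)" for z
      using W[of z] 1[OF that] that by (simp add: inside_def)
    then show ?thesis using \<kappa>1 out unfolding g(3) by blast
  next
    case 2
    have "W x z = - \<kappa>" if "z \<in> inside (path_image \<gamma>)" for z
      using W[of z] 2[OF that] that by (simp add: inside_def)
    moreover have "- \<kappa> \<in> {1, -1}" using \<kappa>1 by auto
    ultimately show ?thesis using out unfolding g(3) by blast
  qed
qed

end

section \<open>The two sides of an edge\<close>

locale matched = plane_bip +
  fixes M :: "complex set set"
  assumes pm: "perfect_matching G M"
begin

definition Z :: "complex set set set" where
  "Z = {C. alternating_cycle G M C}"

definition E0 :: "complex set set" where
  "E0 = \<Union>Z"

definition X0 :: "complex set" where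
  "X0 = \<Union>E0"

text \<open>Corrects the orientation from \<open>P\<close> to the one in which alternating cycles
  are directed; \<open>xi A\<close> is then the unit flow around \<open>A\<close>.\<close>

definition sgn_edge :: "complex set \<Rightarrow> int" where
  "sgn_edge e = (if e \<in> M then 1 else - 1)"

definition xi :: "complex set set \<Rightarrow> complex set \<Rightarrow> int" where
  "xi A e = (if e \<in> A then sgn_edge e else 0)"

definition circ0 :: "(complex set \<Rightarrow> int) \<Rightarrow> bool" where
  "circ0 x \<longleftrightarrow> circ x \<and> (\<forall>e. e \<notin> E0 \<longrightarrow> x e = 0)"

text \<open>
  Points with the same winding numbers take the place of points of the same face, so that no
  face structure of the graph is needed.
\<close>

definition same_side :: "complex \<Rightarrow> complex \<Rightarrow> bool" where
  "same_side z w \<longleftrightarrow> (\<forall>x. circ0 x \<longrightarrow> W x z = W x w)"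

lemma Z_altset: "A \<in> Z \<Longrightarrow> altset G M A"
  by (simp add: Z_def alternating_cycle_altset)

lemma Z_edges: "A \<in> Z \<Longrightarrow> A \<subseteq> edges G"
  using Z_altset by (simp add: altset_def)

lemma Z_nonempty: "A \<in> Z \<Longrightarrow> A \<noteq> {}"
  by (auto simp: Z_def alternating_cycle_def cycle_seq_def)

lemma E0_edges: "E0 \<subseteq> edges G"
  using Z_edges by (auto simp: E0_def)

lemma Z_E0: "A \<in> Z \<Longrightarrow> A \<subseteq> E0"
  by (auto simp: E0_def)

lemma closed_X0: "closed X0"
  unfolding X0_def using E0_edges finite_edges closed_edge
  by (intro closed_Union) (auto intro: finite_subset)

lemma sgn_sq: "sgn_edge e * sgn_edge e = 1"
  by (simp add: sgn_edge_def)

lemma circ_xi: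
  assumes "altset G M A"
  shows "circ (xi A)"
  unfolding circ_def
proof
  fix v assume v: "v \<in> verts G"
  let ?I = "{e. e \<in> edges G \<and> v \<in> ends G e}"
  have fin: "finite ?I" using finite_edges by simp
  show "(\<Sum>e\<in>?I. xi A e) = 0"
  proof (cases "\<exists>e\<in>A. v \<in> ends G e")
    case False
    then show ?thesis by (intro sum.neutral) (auto simp: xi_def)
  next
    case True
    then obtain e where e: "e \<in> A" "v \<in> ends G e" by blast
    obtain m p where mp: "m \<in> A" "m \<in> M" "p \<in> A" "p \<notin> M" "v \<in> ends G m" "v \<in> ends G p"
      "\<forall>f\<in>A. v \<in> ends G f \<longrightarrow> f = m \<or> f = p"
      using altsetE[OF assms e] .
    have "A \<subseteq> edges G" using assms by (simp add: altset_def)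
    then have "{m, p} \<subseteq> ?I" using mp by blast
    then have "(\<Sum>e\<in>?I. xi A e) = (\<Sum>e\<in>{m, p}. xi A e)"
      using fin mp(7) by (intro sum.mono_neutral_right) (auto simp: xi_def)
    also have "\<dots> = 0" using mp(1-4) by (subst sum.insert) (auto simp: xi_def sgn_edge_def)
    finally show ?thesis .
  qed
qed

lemma circ0_xi: "A \<in> Z \<Longrightarrow> circ0 (xi A)"
  using circ_xi[OF Z_altset] Z_E0 by (auto simp: circ0_def xi_def)

lemma circ0_supp: "circ0 x \<Longrightarrow> supp x \<subseteq> X0"
  by (auto simp: circ0_def supp_def X0_def)

lemma Z_jordan:
  assumes "A \<in> Z"
  shows "open (inside (\<Union>A))" "open (outside (\<Union>A))" "inside (\<Union>A) \<union> outside (\<Union>A) = - \<Union>A"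
    "frontier (inside (\<Union>A)) = \<Union>A" "frontier (outside (\<Union>A)) = \<Union>A"
proof -
  obtain vs es where c: "cycle_seq G vs es" "A = set es"
    using assms unfolding Z_def alternating_cycle_def by blast
  show "open (inside (\<Union>A))" "open (outside (\<Union>A))" "inside (\<Union>A) \<union> outside (\<Union>A) = - \<Union>A"
    "frontier (inside (\<Union>A)) = \<Union>A" "frontier (outside (\<Union>A)) = \<Union>A"
    unfolding c(2) by (rule cycle_jordan[OF c(1)])+
qed

lemma Z_W:
  assumes "A \<in> Z"
  obtains \<sigma> :: real where "\<sigma> = 1 \<or> \<sigma> = -1" "\<And>z. z \<in> inside (\<Union>A) \<Longrightarrow> W (xi A) z = \<sigma>"
    "\<And>z. z \<in> outside (\<Union>A) \<Longrightarrow> W (xi A) z = 0"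
proof -
  obtain vs es where c: "cycle_seq G vs es" "A = set es"
    using assms unfolding Z_def alternating_cycle_def by blast
  have "circ (xi A)" using circ_xi Z_altset assms by blast
  moreover have "xi A e = 0" if "e \<notin> set es" for e using that c(2) by (simp add: xi_def)
  moreover have "\<bar>xi A e\<bar> = 1" if "e \<in> set es" for e using that c(2) by (simp add: xi_def sgn_edge_def)
  ultimately obtain \<sigma> :: real where "\<sigma> \<in> {1, -1}" "\<forall>z\<in>inside (\<Union>A). W (xi A) z = \<sigma>"
    "\<forall>z\<in>outside (\<Union>A). W (xi A) z = 0"
    using cycle_W[OF c(1), of "xi A"] c(2) by blast
  then show ?thesis using that[of \<sigma>] by blast
qed

text \<open>\<open>l\<close> and \<open>r\<close> represent the left and the right of
  \<open>e\<close>. Potentials drop from \<open>l\<close> to \<open>r\<close> by the signed flow on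
  \<open>e\<close>; near inner points of \<open>e\<close> nothing but these two classes occurs, and
  points off \<open>X0\<close> do occur; and if the support of a circulation misses a point of
  \<open>e\<close>, possibly an end, its potential there is the one at \<open>l\<close>.\<close>

definition sides :: "complex set \<Rightarrow> complex \<Rightarrow> complex \<Rightarrow> bool" where
  "sides e l r \<longleftrightarrow> l \<notin> X0 \<and> r \<notin> X0 \<and>
     (\<forall>x. circ0 x \<longrightarrow> W x l - W x r = of_int (sgn_edge e * x e)) \<and>
     (\<forall>p\<in>e - verts G. (\<exists>d>0. \<forall>z\<in>ball p d - X0. same_side z l \<or> same_side z r) \<and>
                      (\<forall>d>0. ball p d - X0 \<noteq> {})) \<and>
     (\<forall>x. \<forall>p\<in>e. circ0 x \<longrightarrow> p \<notin> supp x \<longrightarrow> W x l = W x p)"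

lemma edge_neighbourhood:
  assumes e: "e \<in> edges G" and p: "p \<in> e - verts G"
  obtains d where "0 < d" "\<And>f. f \<in> edges G \<Longrightarrow> f \<noteq> e \<Longrightarrow> ball p d \<inter> f = {}"
proof -
  let ?K = "\<Union>(edges G - {e})"
  have "closed ?K" using finite_edges closed_edge by (intro closed_Union) auto
  moreover have "p \<notin> ?K" using edges_meet e p by blast
  ultimately obtain d where "d > 0" "ball p d \<subseteq> - ?K"
    by (metis ComplI open_Compl open_contains_ball)
  then show ?thesis using that by blast
qed

text \<open>Subtracting a multiple of the unit flow of a cycle \<open>A\<close> through
  \<open>e\<close> makes any circulation vanish on \<open>e\<close>, and its potential is then
  constant along \<open>e\<close>. So near \<open>e\<close> every potential varies only with that of
  \<open>A\<close>, which merely distinguishes the inside from the outside of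
  \<open>A\<close>.\<close>

lemma sides_exist:
  assumes "e \<in> E0"
  shows "\<exists>l r. sides e l r"
proof -
  obtain A where A: "A \<in> Z" "e \<in> A" using assms by (auto simp: E0_def)
  have e: "e \<in> edges G" using A Z_edges by blast
  have eA: "e \<subseteq> \<Union>A" using A by blast
  obtain \<sigma> where \<sigma>: "\<sigma> = 1 \<or> \<sigma> = -1" "\<And>z. z \<in> inside (\<Union>A) \<Longrightarrow> W (xi A) z = \<sigma>"
    "\<And>z. z \<in> outside (\<Union>A) \<Longrightarrow> W (xi A) z = 0" using Z_W[OF A(1)] by metis
  have "\<forall>p\<in>e - verts G. \<exists>d>0. \<forall>f\<in>edges G. f \<noteq> e \<longrightarrow> ball p d \<inter> f = {}"
    using edge_neighbourhood[OF e] by metis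
  then obtain D where D: "\<And>p. p \<in> e - verts G \<Longrightarrow> 0 < D p"
    "\<And>p f. p \<in> e - verts G \<Longrightarrow> f \<in> edges G \<Longrightarrow> f \<noteq> e \<Longrightarrow> ball p (D p) \<inter> f = {}" by metis
  have ballX: "ball p (D p) \<inter> X0 \<subseteq> e" if "p \<in> e - verts G" for p
    using D(2)[OF that] E0_edges unfolding X0_def by blast
  obtain p0 where p0: "p0 \<in> e - verts G" using edge_interior(1)[OF e] by blast
  define y where "y x f = x f - (x e * sgn_edge e) * xi A f" for x f
  have y: "circ0 (y x)" "y x e = 0" if "circ0 x" for x
  proof -
    show "y x e = 0" using A sgn_sq[of e] by (simp add: y_def xi_def mult.assoc)
    have "circ (y x)" unfolding y_def
      using that circ0_xi[OF A(1)] by (intro circ_diff circ_scale) (auto simp: circ0_def)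
    then show "circ0 (y x)" using that circ0_xi[OF A(1)] by (auto simp: circ0_def y_def)
  qed
  have const: "W x z = W x p0"
    if x: "circ0 x" "x e = 0" and p: "p \<in> e - verts G" and z: "z \<in> ball p (D p)" for x p z
  proof -
    have off: "f \<in> edges G \<Longrightarrow> x f \<noteq> 0 \<Longrightarrow> f \<noteq> e" for f using x by auto
    have "W x z = W x p"
    proof (rule W_const[of x "ball p (D p)"])
      show "ball p (D p) \<inter> supp x = {}" using D(2)[OF p] off unfolding supp_def by blast
      show "p \<in> ball p (D p)" using D(1)[OF p] by simp
    qed (use x z in \<open>auto simp: circ0_def\<close>)
    also have "\<dots> = W x p0"
    proof (rule W_const[of x "e - verts G"])
      show "(e - verts G) \<inter> supp x = {}" using edges_meet[OF e] off unfolding supp_def by blast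
    qed (use x p p0 edge_interior(2)[OF e] in \<open>auto simp: circ0_def\<close>)
    finally show ?thesis .
  qed
  have Wx: "W x z = of_int (x e * sgn_edge e) * W (xi A) z + W (y x) p0"
    if "circ0 x" "p \<in> e - verts G" "z \<in> ball p (D p)" for x p z
  proof -
    have "W (y x) z = W x z - of_int (x e * sgn_edge e) * W (xi A) z"
      unfolding y_def by (simp only: W_diff W_scale)
    then show ?thesis using const[OF y[OF that(1)] that(2,3)] by simp
  qed
  have near: "\<exists>zi zo. zi \<in> ball p d \<inter> inside (\<Union>A) \<and> zo \<in> ball p d \<inter> outside (\<Union>A)"
    if pe: "p \<in> e" and d: "0 < d" for p d
  proof -
    have "p \<in> frontier (inside (\<Union>A))" "p \<in> frontier (outside (\<Union>A))"
      using pe eA Z_jordan(4,5)[OF A(1)] by auto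
    then have "p \<in> closure (inside (\<Union>A))" "p \<in> closure (outside (\<Union>A))"
      by (auto simp: frontier_def)
    then obtain zi zo where "zi \<in> inside (\<Union>A)" "dist zi p < d" "zo \<in> outside (\<Union>A)" "dist zo p < d"
      using d unfolding closure_approachable by blast
    then show ?thesis by (intro exI[of _ zi] exI[of _ zo]) (simp add: dist_commute)
  qed
  obtain zi zo where z: "zi \<in> ball p0 (D p0)" "zi \<in> inside (\<Union>A)" "zo \<in> ball p0 (D p0)" "zo \<in> outside (\<Union>A)"
    using near[of p0 "D p0"] p0 D(1) by blast
  have notA: "w \<notin> X0" if "p \<in> e - verts G" "w \<in> ball p (D p)" "w \<in> inside (\<Union>A) \<or> w \<in> outside (\<Union>A)" for p w
  proof
    assume "w \<in> X0"
    then have "w \<in> \<Union>A" using ballX[OF that(1)] that(2) eA by blast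
    then show False using that(3) Z_jordan(3)[OF A(1)] by blast
  qed
  have main: "sides e l r"
    if lr: "l \<in> ball p0 (D p0)" "r \<in> ball p0 (D p0)" "l \<notin> X0" "r \<notin> X0" "W (xi A) l - W (xi A) r = 1"
      "\<And>w. w \<in> inside (\<Union>A) \<union> outside (\<Union>A) \<Longrightarrow> W (xi A) w = W (xi A) l \<or> W (xi A) w = W (xi A) r" for l r
    unfolding sides_def
  proof (intro conjI allI impI ballI)
    fix x assume x: "circ0 x"
    have "W x l - W x r = of_int (x e * sgn_edge e) * (W (xi A) l - W (xi A) r)"
      using Wx[OF x p0 lr(1)] Wx[OF x p0 lr(2)] by (simp add: algebra_simps)
    then show "W x l - W x r = of_int (sgn_edge e * x e)" using lr(5) by (simp add: mult.commute)
  next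
    fix p assume p: "p \<in> e - verts G"
    have "same_side z l \<or> same_side z r" if z: "z \<in> ball p (D p) - X0" for z
    proof -
      have "z \<notin> \<Union>A" using z Z_E0[OF A(1)] by (auto simp: X0_def)
      then have "z \<in> inside (\<Union>A) \<union> outside (\<Union>A)" using Z_jordan(3)[OF A(1)] by simp
      then consider "W (xi A) z = W (xi A) l" | "W (xi A) z = W (xi A) r" using lr(6) by blast
      then show ?thesis
      proof cases
        case 1
        then have "same_side z l" unfolding same_side_def
          using Wx[OF _ p] Wx[OF _ p0 lr(1)] z by auto
        then show ?thesis ..
      next
        case 2
        then have "same_side z r" unfolding same_side_def
          using Wx[OF _ p] Wx[OF _ p0 lr(2)] z by auto
        then show ?thesis ..
      qed
    qed
    then show "\<exists>d>0. \<forall>z\<in>ball p d - X0. same_side z l \<or> same_side z r" using D(1)[OF p] by blast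
    fix d :: real assume d: "0 < d"
    then have "0 < min d (D p)" using D(1)[OF p] by simp
    then obtain w where "w \<in> ball p (min d (D p))" "w \<in> inside (\<Union>A)" using near[of p] p by blast
    then have "w \<in> ball p d - X0" using notA[OF p, of w] by auto
    then show "ball p d - X0 \<noteq> {}" by blast
  next
    fix x p assume p: "p \<in> e" and x: "circ0 x" "p \<notin> supp x"
    have xe: "x e = 0" using p x e by (auto simp: supp_def)
    have off: "f \<in> edges G \<Longrightarrow> x f \<noteq> 0 \<Longrightarrow> f \<noteq> e" for f using xe by auto
    have "W x l = W x p0" using const[OF x(1) xe p0 lr(1)] .
    also have "\<dots> = W x p"
    proof (rule W_const[of x "insert p (e - verts G)"])
      show "connected (insert p (e - verts G))" using p by (intro connected_edge_part[OF e]) auto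
      show "insert p (e - verts G) \<inter> supp x = {}"
        using edges_meet[OF e] off x(2) unfolding supp_def by blast
    qed (use x p0 in \<open>auto simp: circ0_def\<close>)
    finally show "W x l = W x p" .
  qed (use lr in auto)
  have zz: "zi \<notin> X0" "zo \<notin> X0" using notA[OF p0] z by auto
  \<comment> \<open>The left point is the one with the larger potential of \<open>A\<close>; whether
    it is the inner or the outer one depends on the direction of \<open>A\<close>.\<close>
  from \<sigma>(1) show ?thesis
  proof
    assume s1: "\<sigma> = 1"
    have "sides e zi zo"
    proof (rule main[OF z(1,3) zz])
      show "W (xi A) zi - W (xi A) zo = 1" using \<sigma>(2)[OF z(2)] \<sigma>(3)[OF z(4)] s1 by simp
      show "W (xi A) w = W (xi A) zi \<or> W (xi A) w = W (xi A) zo" if "w \<in> inside (\<Union>A) \<union> outside (\<Union>A)" for w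
        using \<sigma>(2,3)[of w] \<sigma>(2)[OF z(2)] \<sigma>(3)[OF z(4)] that by (elim UnE) simp_all
    qed
    then show ?thesis by blast
  next
    assume s1: "\<sigma> = -1"
    have "sides e zo zi"
    proof (rule main[OF z(3,1) zz(2,1)])
      show "W (xi A) zo - W (xi A) zi = 1" using \<sigma>(2)[OF z(2)] \<sigma>(3)[OF z(4)] s1 by simp
      show "W (xi A) w = W (xi A) zo \<or> W (xi A) w = W (xi A) zi" if "w \<in> inside (\<Union>A) \<union> outside (\<Union>A)" for w
        using \<sigma>(2,3)[of w] \<sigma>(2)[OF z(2)] \<sigma>(3)[OF z(4)] that by (elim UnE) simp_all
    qed
    then show ?thesis by blast
  qed
qed

definition ls :: "complex set \<Rightarrow> complex" where
  "ls e = fst (SOME lr. sides e (fst lr) (snd lr))"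

definition rs :: "complex set \<Rightarrow> complex" where
  "rs e = snd (SOME lr. sides e (fst lr) (snd lr))"

lemma sides_ls_rs: "e \<in> E0 \<Longrightarrow> sides e (ls e) (rs e)"
  unfolding ls_def rs_def by (rule someI_ex[of "\<lambda>lr. sides e (fst lr) (snd lr)"]) (use sides_exist in auto)

lemma ls_rs_notin: "e \<in> E0 \<Longrightarrow> ls e \<notin> X0" "e \<in> E0 \<Longrightarrow> rs e \<notin> X0"
  using sides_ls_rs by (auto simp: sides_def)

lemma jump: "e \<in> E0 \<Longrightarrow> circ0 x \<Longrightarrow> W x (ls e) - W x (rs e) = of_int (sgn_edge e * x e)"
  using sides_ls_rs by (auto simp: sides_def)

lemma W_ls: "e \<in> E0 \<Longrightarrow> circ0 x \<Longrightarrow> p \<in> e \<Longrightarrow> p \<notin> supp x \<Longrightarrow> W x (ls e) = W x p"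
  using sides_ls_rs by (auto simp: sides_def)

lemma W_rs:
  assumes "e \<in> E0" "circ0 x" "p \<in> e" "p \<notin> supp x"
  shows "W x (rs e) = W x p"
proof -
  have "e \<in> edges G" using assms(1) E0_edges by blast
  then have "x e = 0" using assms by (auto simp: supp_def)
  then show ?thesis using jump[OF assms(1,2)] W_ls[OF assms] by simp
qed

text \<open>Takes the place of connectedness of the dual graph. Without jumps, \<open>f\<close> is
  locally constant around every point that is not a vertex on \<open>X0\<close>, and the plane stays
  connected when finitely many points are removed.\<close>

lemma no_jump_constant:
  assumes resp: "\<And>z w. z \<notin> X0 \<Longrightarrow> w \<notin> X0 \<Longrightarrow> same_side z w \<Longrightarrow> f z = f w"
    and nj: "\<And>e. e \<in> E0 \<Longrightarrow> f (ls e) = f (rs e)"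
    and z: "z \<notin> X0" and w: "w \<notin> X0"
  shows "f z = f w"
proof (rule ccontr)
  assume neq: "f z \<noteq> f w"
  define V where "V = verts G \<inter> X0"
  \<comment> \<open>Only nearby points off \<open>X0\<close> are tested, so inner points of edges
    can belong to \<open>U Q\<close> although \<open>f\<close> carries no information there.\<close>
  define U where "U Q = {p. p \<notin> V \<and> (\<exists>d>0. \<forall>q\<in>ball p d - X0. Q (f q))}" for Q
  have finV: "finite V" using finite_verts by (simp add: V_def)
  have opV: "open (- V)" using finV by (simp add: finite_imp_closed open_Compl)
  have opU: "open (U Q)" for Q
    unfolding open_contains_ball
  proof
    fix p assume "p \<in> U Q"
    then obtain d where d: "p \<notin> V" "d > 0" "\<forall>q\<in>ball p d - X0. Q (f q)" by (auto simp: U_def)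
    obtain d' where d': "d' > 0" "ball p d' \<subseteq> - V" using opV d(1) by (meson ComplI open_contains_ball)
    have "ball p (min (d/2) d') \<subseteq> U Q"
    proof
      fix q assume q: "q \<in> ball p (min (d/2) d')"
      have "ball q (d/2) \<subseteq> ball p d"
      proof
        fix t assume "t \<in> ball q (d/2)"
        then show "t \<in> ball p d" using q dist_triangle[of p t q] by (auto simp: dist_commute)
      qed
      moreover have "q \<notin> V" using q d' by auto
      ultimately show "q \<in> U Q" using d unfolding U_def by (intro CollectI conjI exI[of _ "d/2"]) auto
    qed
    then show "\<exists>e>0. ball p e \<subseteq> U Q" using d d' by (intro exI[of _ "min (d/2) d'"]) auto
  qed
  have nonempty: "ball p d - X0 \<noteq> {}" if p: "p \<notin> V" and d: "d > 0" for p d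
  proof (cases "p \<in> X0")
    case True
    then obtain e where e: "e \<in> E0" "p \<in> e - verts G" using p by (auto simp: X0_def V_def)
    then show ?thesis using sides_ls_rs[OF e(1)] d by (simp add: sides_def)
  next
    case False
    then show ?thesis using d by (intro ex_in_conv[THEN iffD1] exI[of _ p]) simp
  qed
  have loc: "\<exists>d>0. \<exists>c. \<forall>q\<in>ball p d - X0. f q = c" if p: "p \<notin> V" for p
  proof (cases "p \<in> X0")
    case True
    then obtain e where e: "e \<in> E0" "p \<in> e - verts G" using p by (auto simp: X0_def V_def)
    then obtain d where d: "d > 0" "\<forall>q\<in>ball p d - X0. same_side q (ls e) \<or> same_side q (rs e)"
      using sides_ls_rs[OF e(1)] unfolding sides_def by blast
    have "f q = f (ls e)" if q: "q \<in> ball p d - X0" for q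
    proof -
      have qX: "q \<notin> X0" using q by simp
      have "same_side q (ls e) \<or> same_side q (rs e)" using d(2) q by blast
      then show ?thesis
        using resp[OF qX ls_rs_notin(1)[OF e(1)]] resp[OF qX ls_rs_notin(2)[OF e(1)]] nj[OF e(1)] by auto
    qed
    then show ?thesis using d(1) by blast
  next
    case False
    then obtain d where d: "d > 0" "ball p d \<subseteq> - X0"
      using closed_X0 by (meson ComplI open_Compl open_contains_ball)
    have "f q = f p" if q: "q \<in> ball p d - X0" for q
    proof (rule resp)
      show "same_side q p" unfolding same_side_def
      proof (intro allI impI)
        fix x assume x: "circ0 x"
        show "W x q = W x p"
        proof (rule W_const[of x "ball p d"])
          show "ball p d \<inter> supp x = {}" using circ0_supp[OF x] d by blast
        qed (use x d q in \<open>auto simp: circ0_def\<close>)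
      qed
    qed (use q False in auto)
    then show ?thesis using d(1) by blast
  qed
  have "connected (UNIV - V)"
    using finV by (intro connected_open_delete_finite) auto
  then have conn: "connected (- V)" by (simp add: Compl_eq_Diff_UNIV)
  have cover: "- V \<subseteq> U (\<lambda>c. c = f z) \<union> U (\<lambda>c. c \<noteq> f z)"
  proof
    fix p assume "p \<in> - V"
    then have p: "p \<notin> V" by simp
    obtain d c where "d > 0" "\<forall>q\<in>ball p d - X0. f q = c" using loc[OF p] by blast
    then show "p \<in> U (\<lambda>c. c = f z) \<union> U (\<lambda>c. c \<noteq> f z)"
      using p unfolding U_def by (cases "c = f z") auto
  qed
  have disj: "U (\<lambda>c. c = f z) \<inter> U (\<lambda>c. c \<noteq> f z) \<inter> - V = {}"
  proof -
    have False if p: "p \<in> U (\<lambda>c. c = f z)" "p \<in> U (\<lambda>c. c \<noteq> f z)" for p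
    proof -
      obtain d where d: "d > 0" "\<forall>q\<in>ball p d - X0. f q = f z" "p \<notin> V" using p(1) unfolding U_def by blast
      obtain d' where d': "d' > 0" "\<forall>q\<in>ball p d' - X0. f q \<noteq> f z" using p(2) unfolding U_def by blast
      have "0 < min d d'" using d(1) d'(1) by simp
      then obtain q where "q \<in> ball p (min d d') - X0" using nonempty[OF d(3)] by blast
      then have "q \<in> ball p d - X0" "q \<in> ball p d' - X0" by auto
      then have "f q = f z" "f q \<noteq> f z" using d(2) d'(2) by blast+
      then show False by contradiction
    qed
    then show ?thesis by blast
  qed
  have inU: "p \<in> U (\<lambda>c. c = f p)" if p: "p \<notin> X0" for p
  proof -
    have pV: "p \<notin> V" using p by (simp add: V_def)
    obtain d c where d: "d > 0" "\<forall>q\<in>ball p d - X0. f q = c" using loc[OF pV] by blast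
    moreover have "p \<in> ball p d - X0" using p d(1) by simp
    ultimately have "f p = c" by blast
    then show ?thesis using d pV unfolding U_def by blast
  qed
  have zin: "z \<in> U (\<lambda>c. c = f z) \<inter> - V" using inU[OF z] z by (simp add: V_def)
  have "w \<in> U (\<lambda>c. c \<noteq> f z)"
  proof -
    obtain d where d: "w \<notin> V" "d > 0" "\<forall>q\<in>ball w d - X0. f q = f w" using inU[OF w] unfolding U_def by blast
    have "f q \<noteq> f z" if "q \<in> ball w d - X0" for q using d(3) that neq by metis
    then show ?thesis using d(1,2) unfolding U_def by blast
  qed
  then have win: "w \<in> U (\<lambda>c. c \<noteq> f z) \<inter> - V" using w by (simp add: V_def)
  have "U (\<lambda>c. c = f z) \<inter> - V = {} \<or> U (\<lambda>c. c \<noteq> f z) \<inter> - V = {}"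
    using conn opU opU disj cover by (rule connectedD)
  then show False
  proof
    assume "U (\<lambda>c. c = f z) \<inter> - V = {}"
    with zin show False by simp
  next
    assume "U (\<lambda>c. c \<noteq> f z) \<inter> - V = {}"
    with win show False by simp
  qed
qed

end

section \<open>Sides of alternating cycles\<close>

context matched
begin

text \<open>The left of the directed cycle \<open>A\<close>: its inside if it runs counterclockwise,
  otherwise its outside. Asking for a smaller potential elsewhere avoids this case
  distinction.\<close>

definition side :: "complex set set \<Rightarrow> complex set" where
  "side A = {z. z \<notin> X0 \<and> (\<exists>w. w \<notin> X0 \<and> W (xi A) w < W (xi A) z)}"

definition cutset :: "complex set \<Rightarrow> complex set set" where
  "cutset T = {e\<in>E0. ls e \<in> T \<and> rs e \<notin> T}"

lemma W_two_values:
  assumes c: "cycle_seq G vs es" and x: "circ0 x" and esE: "set es \<subseteq> E0"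
    and x0: "\<And>e. e \<notin> set es \<Longrightarrow> x e = 0" and x1: "\<And>e. e \<in> set es \<Longrightarrow> \<bar>x e\<bar> = 1"
  obtains lo where "\<And>z. z \<notin> X0 \<Longrightarrow> W x z = lo \<or> W x z = lo + 1"
proof -
  have "circ x" using x by (simp add: circ0_def)
  from cycle_W[OF c this x0 x1] obtain \<sigma> :: real where \<sigma>1: "\<sigma> \<in> {1, -1}"
    and "(\<forall>z\<in>inside (\<Union>(set es)). W x z = \<sigma>) \<and> (\<forall>z\<in>outside (\<Union>(set es)). W x z = 0)"
    by (rule bexE)
  then have \<sigma>: "\<sigma> = 1 \<or> \<sigma> = -1" "\<forall>z\<in>inside (\<Union>(set es)). W x z = \<sigma>"
    "\<forall>z\<in>outside (\<Union>(set es)). W x z = 0" by simp_all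
  have "W x z = \<sigma> \<or> W x z = 0" if z: "z \<notin> X0" for z
  proof -
    have "z \<notin> \<Union>(set es)" using z esE by (auto simp: X0_def)
    then have "z \<in> inside (\<Union>(set es)) \<union> outside (\<Union>(set es))" using cycle_jordan(10)[OF c] by simp
    then show ?thesis using \<sigma>(2,3) by blast
  qed
  then show ?thesis using \<sigma>(1) that[of 0] that[of "-1"] by fastforce
qed

text \<open>The potential has at most two values, which differ by 1, and the jump across any edge of
  \<open>A\<close> shows that both occur.\<close>

lemma W_side:
  assumes A: "A \<in> Z"
  obtains c where "\<And>z. z \<notin> X0 \<Longrightarrow> W (xi A) z = c + of_bool (z \<in> side A)"
proof -
  obtain vs es where c: "cycle_seq G vs es" "A = set es"
    using A unfolding Z_def alternating_cycle_def by blast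
  have 0: "xi A e = 0" if "e \<notin> set es" for e using that c(2) by (simp add: xi_def)
  have 1: "\<bar>xi A e\<bar> = 1" if "e \<in> set es" for e using that c(2) by (simp add: xi_def sgn_edge_def)
  have es: "set es \<subseteq> E0" using Z_E0[OF A] c(2) by simp
  obtain lo where lo: "\<And>z. z \<notin> X0 \<Longrightarrow> W (xi A) z = lo \<or> W (xi A) z = lo + 1"
    using W_two_values[OF c(1) circ0_xi[OF A] es 0 1] by metis
  obtain e where e: "e \<in> A" using Z_nonempty[OF A] by blast
  then have eE: "e \<in> E0" using Z_E0[OF A] by blast
  have n: "ls e \<notin> X0" "rs e \<notin> X0" using ls_rs_notin[OF eE] by auto
  have "W (xi A) (ls e) - W (xi A) (rs e) = 1"
    using jump[OF eE circ0_xi[OF A]] e by (simp add: xi_def sgn_sq)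
  then have r: "W (xi A) (rs e) = lo" using lo[OF n(1)] lo[OF n(2)] by auto
  have "W (xi A) z = lo + of_bool (z \<in> side A)" if z: "z \<notin> X0" for z
  proof (cases "W (xi A) z = lo")
    case True
    have "z \<notin> side A"
    proof
      assume "z \<in> side A"
      then obtain w where "w \<notin> X0" "W (xi A) w < lo" using True by (auto simp: side_def)
      then show False using lo[of w] by auto
    qed
    then show ?thesis using True by simp
  next
    case False
    then have "W (xi A) z = lo + 1" using lo[OF z] by simp
    moreover have "z \<in> side A" unfolding side_def using z n r calculation
      by (intro CollectI conjI exI[of _ "rs e"]) auto
    ultimately show ?thesis by simp
  qed
  then show ?thesis using that by blast
qed

lemma side_same:
  assumes "A \<in> Z" "z \<notin> X0" "w \<notin> X0" "W (xi A) z = W (xi A) w"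
  shows "z \<in> side A \<longleftrightarrow> w \<in> side A"
  using W_side[OF assms(1)] assms(2-4) by (metis add_left_cancel of_bool_eq_iff)

lemma side_same_side: "A \<in> Z \<Longrightarrow> z \<notin> X0 \<Longrightarrow> w \<notin> X0 \<Longrightarrow> same_side z w \<Longrightarrow> z \<in> side A \<longleftrightarrow> w \<in> side A"
  by (rule side_same) (auto simp: same_side_def circ0_xi)

lemma side_jump:
  assumes A: "A \<in> Z" and e: "e \<in> E0"
  shows "of_bool (ls e \<in> side A) - of_bool (rs e \<in> side A) = (of_bool (e \<in> A) :: int)"
proof -
  obtain c where c: "\<And>z. z \<notin> X0 \<Longrightarrow> W (xi A) z = c + of_bool (z \<in> side A)" using W_side[OF A] by metis
  have "W (xi A) (ls e) - W (xi A) (rs e) = of_int (sgn_edge e * xi A e)" by (rule jump[OF e circ0_xi[OF A]])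
  moreover have "sgn_edge e * xi A e = of_bool (e \<in> A)" by (simp add: xi_def sgn_sq)
  ultimately show ?thesis using c[OF ls_rs_notin(1)[OF e]] c[OF ls_rs_notin(2)[OF e]]
    by (auto simp: of_bool_def split: if_splits)
qed

lemma side_mem_cut: "A \<in> Z \<Longrightarrow> e \<in> E0 \<Longrightarrow> e \<in> A \<longleftrightarrow> ls e \<in> side A \<and> rs e \<notin> side A"
  using side_jump[of A e] by (auto simp: of_bool_def split: if_splits)

lemma side_no_reverse: "A \<in> Z \<Longrightarrow> e \<in> E0 \<Longrightarrow> rs e \<in> side A \<Longrightarrow> ls e \<in> side A"
  using side_jump[of A e] by (auto simp: of_bool_def split: if_splits)

text \<open>\<open>v\<close> is off the support of \<open>xi A\<close>, so the potential of
  \<open>A\<close> at \<open>v\<close> agrees with its values on both sides of each edge of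
  \<open>E0\<close> at \<open>v\<close>.\<close>

lemma side_away:
  assumes A: "A \<in> Z" and e: "e \<in> E0" and f: "f \<in> E0" and v: "v \<in> ends G e" "v \<in> ends G f"
    and nv: "\<And>g. g \<in> A \<Longrightarrow> v \<notin> ends G g"
  shows "ls e \<in> side A \<longleftrightarrow> ls f \<in> side A" "rs e \<in> side A \<longleftrightarrow> ls e \<in> side A"
proof -
  have vs: "v \<notin> supp (xi A)"
    using nv v(1) by (auto simp: supp_def xi_def ends_def split: if_splits)
  have ve: "v \<in> e" "v \<in> f" using v by (auto simp: ends_def)
  note c = circ0_xi[OF A]
  show "ls e \<in> side A \<longleftrightarrow> ls f \<in> side A"
    using side_same[OF A ls_rs_notin(1)[OF e] ls_rs_notin(1)[OF f]]
      W_ls[OF e c ve(1) vs] W_ls[OF f c ve(2) vs] by simp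
  show "rs e \<in> side A \<longleftrightarrow> ls e \<in> side A"
    using side_same[OF A ls_rs_notin(2)[OF e] ls_rs_notin(1)[OF e]]
      W_ls[OF e c ve(1) vs] W_rs[OF e c ve(1) vs] by simp
qed

lemma matching_edge_unique:
  "m \<in> M \<Longrightarrow> n \<in> M \<Longrightarrow> v \<in> ends G m \<Longrightarrow> v \<in> ends G n \<Longrightarrow> m = n"
  using perfect_matching_unique[OF pm] ends_subset_verts by blast

text \<open>Two alternating cycles through \<open>v\<close> share the matching edge there, so at
  \<open>v\<close> the symmetric difference contains both of their other edges or neither.\<close>

lemma sym_diff_regular_aux:
  assumes A: "A \<in> Z" and B: "B \<in> Z" and e: "e \<in> A - B" and v: "v \<in> ends G e"
  shows "\<exists>f\<in>(A - B) \<union> (B - A). f \<noteq> e \<and> v \<in> ends G f \<and>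
    (\<forall>g\<in>(A - B) \<union> (B - A). v \<in> ends G g \<longrightarrow> g = e \<or> g = f)"
proof -
  have eA: "e \<in> A" using e by simp
  obtain m p where mp: "m \<in> A" "m \<in> M" "p \<in> A" "p \<notin> M" "v \<in> ends G m" "v \<in> ends G p"
      "\<forall>f\<in>A. v \<in> ends G f \<longrightarrow> f = m \<or> f = p"
    using altsetE[OF Z_altset[OF A] eA v] .
  have ne: "m \<noteq> p" using mp by auto
  show ?thesis
  proof (cases "\<exists>f\<in>B. v \<in> ends G f")
    case False
    show ?thesis
    proof (cases "e = m")
      case True
      show ?thesis by (rule bexI[of _ p]) (use mp ne True False in blast)+
    next
      case ep: False
      then have "e = p" using mp(7) eA v by blast
      show ?thesis by (rule bexI[of _ m]) (use mp ne \<open>e = p\<close> False in blast)+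
    qed
  next
    case True
    then obtain f where f: "f \<in> B" "v \<in> ends G f" by blast
    obtain n q where nq: "n \<in> B" "n \<in> M" "q \<in> B" "q \<notin> M" "v \<in> ends G n" "v \<in> ends G q"
      "\<forall>f\<in>B. v \<in> ends G f \<longrightarrow> f = n \<or> f = q"
      using altsetE[OF Z_altset[OF B] f] .
    have "n = m" using matching_edge_unique[OF nq(2) mp(2) nq(5) mp(5)] .
    then have "e = p" using mp(7) eA v e nq(1) by blast
    have "q \<notin> A" using mp(7) nq(3,4,6) mp(2) \<open>e = p\<close> e by blast
    show ?thesis
      by (rule bexI[of _ q]) (use \<open>q \<notin> A\<close> mp(7) nq \<open>n = m\<close> mp(1) \<open>e = p\<close> e in blast)+
  qed
qed

lemma sym_diff_regular:
  assumes "A \<in> Z" "B \<in> Z"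
  shows "two_regular G ((A - B) \<union> (B - A))"
  unfolding two_regular_def
proof (intro conjI ballI)
  show "(A - B) \<union> (B - A) \<subseteq> edges G" using Z_edges assms by blast
  fix e v assume e: "e \<in> (A - B) \<union> (B - A)" and v: "v \<in> ends G e"
  from e show "\<exists>f\<in>(A - B) \<union> (B - A). f \<noteq> e \<and> v \<in> ends G f \<and>
    (\<forall>g\<in>(A - B) \<union> (B - A). v \<in> ends G g \<longrightarrow> g = e \<or> g = f)"
  proof
    assume "e \<in> A - B"
    then show ?thesis using sym_diff_regular_aux[OF assms] v by blast
  next
    assume "e \<in> B - A"
    then show ?thesis using sym_diff_regular_aux[OF assms(2,1)] v by (simp add: Un_commute)
  qed
qed

text \<open>
  Where two cycles merge into a common matching edge, one of them arrives from inside the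
  side of the other exactly if the other arrives from outside its side. The symmetric
  difference contains a third cycle \<open>J\<close> through both arriving edges, and \<open>A - B - J\<close> is a
  circulation avoiding the vertex.
\<close>

lemma side_merge:
  assumes A: "A \<in> Z" and B: "B \<in> Z" and m: "m \<in> A" "m \<in> B" "m \<in> M"
    and p: "p \<in> A" "p \<notin> B" "p \<notin> M" and q: "q \<in> B" "q \<notin> A" "q \<notin> M"
    and v: "v \<in> ends G m" "v \<in> ends G p" "v \<in> ends G q"
  shows "ls p \<in> side B \<longleftrightarrow> ls q \<notin> side A"
proof -
  define D where "D = (A - B) \<union> (B - A)"
  have D: "two_regular G D" unfolding D_def by (rule sym_diff_regular[OF A B])
  have pD: "p \<in> D" and qD: "q \<in> D" using p q by (auto simp: D_def)
  obtain vs es where c: "cycle_seq G vs es" "p \<in> set es" "set es \<subseteq> D"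
    using two_regular_cycle[OF D pD] .
  have closed: "f \<in> set es" if "e \<in> set es" "w \<in> ends G e" "f \<in> D" "w \<in> ends G f" for e f w
    using two_regular_closed[OF D cycle_seq_two_regular[OF c(1)] c(3)] that by blast
  have qJ: "q \<in> set es" using closed[OF c(2) v(2) qD v(3)] .
  have DE: "D \<subseteq> E0" using Z_E0 A B by (auto simp: D_def)
  define x where "x e = xi A e - xi B e" for e
  define y where "y e = (if e \<in> set es then x e else 0)" for e
  have xc: "circ0 x" unfolding x_def using circ0_xi[OF A] circ0_xi[OF B]
    by (auto simp: circ0_def intro: circ_diff)
  have xD: "x e = 0" if "e \<notin> D" for e using that by (auto simp: x_def xi_def D_def)
  \<comment> \<open>The third cycle contains all edges of \<open>D\<close> at each of its vertices,
    so conservation survives the restriction.\<close>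
  have yc: "circ0 y" unfolding circ0_def circ_def
  proof (intro conjI ballI allI impI)
    fix w assume w: "w \<in> verts G"
    let ?I = "{e. e \<in> edges G \<and> w \<in> ends G e}"
    show "(\<Sum>e\<in>?I. y e) = 0"
    proof (cases "\<exists>e\<in>set es. w \<in> ends G e")
      case False
      then show ?thesis by (intro sum.neutral) (auto simp: y_def)
    next
      case True
      then obtain e where e: "e \<in> set es" "w \<in> ends G e" by blast
      have "y f = x f" if "f \<in> ?I" for f
        using closed[OF e, of f] that xD[of f] by (auto simp: y_def)
      then have "(\<Sum>e\<in>?I. y e) = (\<Sum>e\<in>?I. x e)" by (intro sum.cong) auto
      then show ?thesis using xc w by (simp add: circ0_def circ_def)
    qed
  next
    fix e assume "e \<notin> E0"
    then show "y e = 0" using c(3) DE by (auto simp: y_def)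
  qed
  have y0: "y e = 0" if "e \<notin> set es" for e using that by (simp add: y_def)
  have y1: "\<bar>y e\<bar> = 1" if "e \<in> set es" for e
    using that c(3) by (auto simp: y_def x_def xi_def D_def sgn_edge_def)
  have esE: "set es \<subseteq> E0" using c(3) DE by blast
  obtain lo where lo: "\<And>z. z \<notin> X0 \<Longrightarrow> W y z = lo \<or> W y z = lo + 1"
    using W_two_values[OF c(1) yc esE y0 y1] by metis
  have pE: "p \<in> E0" and qE: "q \<in> E0" using pD qD DE by auto
  \<comment> \<open>The flow of \<open>A\<close> enters \<open>x\<close> positively and that of
    \<open>B\<close> negatively, so the jumps at \<open>p\<close> and \<open>q\<close> are opposite:
    the left of \<open>p\<close> has the higher value of \<open>W y\<close>, the left of
    \<open>q\<close> the lower.\<close>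
  have "W y (ls p) - W y (rs p) = 1"
    using jump[OF pE yc] p c(2) by (simp add: y_def x_def xi_def sgn_edge_def)
  then have yp: "W y (ls p) = lo + 1" using lo[OF ls_rs_notin(1)[OF pE]] lo[OF ls_rs_notin(2)[OF pE]] by auto
  have "W y (ls q) - W y (rs q) = - 1"
    using jump[OF qE yc] q qJ by (simp add: y_def x_def xi_def sgn_edge_def)
  then have yq: "W y (ls q) = lo" using lo[OF ls_rs_notin(1)[OF qE]] lo[OF ls_rs_notin(2)[OF qE]] by auto
  define g where "g e = x e - y e" for e
  have gc: "circ0 g" using xc yc unfolding circ0_def g_def by (auto intro: circ_diff)
  have vg: "v \<notin> supp g"
  proof
    assume "v \<in> supp g"
    then obtain f where f: "f \<in> edges G" "g f \<noteq> 0" "v \<in> f" by (auto simp: supp_def)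
    have "v \<in> ends G f" using f v(1) ends_subset_verts by (auto simp: ends_def)
    moreover have "f \<in> D" using f(2) xD[of f] by (auto simp: g_def y_def split: if_splits)
    ultimately have "f \<in> set es" using closed[OF c(2) v(2)] by blast
    then show False using f(2) by (simp add: g_def y_def)
  qed
  have vpq: "v \<in> p" "v \<in> q" using v by (auto simp: ends_def)
  have "W g (ls p) = W g (ls q)"
    using W_ls[OF pE gc vpq(1) vg] W_ls[OF qE gc vpq(2) vg] by simp
  then have eq: "W (xi A) (ls p) - W (xi B) (ls p) - (lo + 1) = W (xi A) (ls q) - W (xi B) (ls q) - lo"
    unfolding g_def x_def W_diff yp yq by (simp add: W_diff flip: x_def)
  obtain a where a: "\<And>z. z \<notin> X0 \<Longrightarrow> W (xi A) z = a + of_bool (z \<in> side A)" using W_side[OF A] by metis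
  obtain b where b: "\<And>z. z \<notin> X0 \<Longrightarrow> W (xi B) z = b + of_bool (z \<in> side B)" using W_side[OF B] by metis
  have "ls p \<in> side A" "ls q \<in> side B" using side_mem_cut A B pE qE p q by auto
  \<comment> \<open>As \<open>ls p\<close> is in \<open>side A\<close> and \<open>ls q\<close> in
    \<open>side B\<close>, the equation says that the two remaining indicators add up to 1.\<close>
  then show ?thesis
    using eq a[OF ls_rs_notin(1)[OF pE]] a[OF ls_rs_notin(1)[OF qE]]
      b[OF ls_rs_notin(1)[OF pE]] b[OF ls_rs_notin(1)[OF qE]]
    by (auto simp: of_bool_def split: if_splits)
qed

end

section \<open>Uncrossing\<close>

context matched
begin

text \<open>At a vertex of only one of the cycles, both its edges lie on the same side of the other
  cycle, so they enter the cut together or not at all. At a common vertex the shared matching edge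
  is in the cut; if the other two edges differ, \<open>side_merge\<close> admits exactly one of
  them.\<close>

lemma cutset_altset:
  assumes A: "A \<in> Z" and B: "B \<in> Z" and T: "T = side A \<union> side B \<or> T = side A \<inter> side B"
  shows "altset G M (cutset T)"
  unfolding altset_def
proof (intro conjI ballI)
  show "cutset T \<subseteq> edges G" using E0_edges by (auto simp: cutset_def)
  fix e v assume e: "e \<in> cutset T" and v: "v \<in> ends G e"
  have sub: "f \<in> A \<or> f \<in> B" if "f \<in> cutset T" for f
    using that T side_mem_cut[OF A] side_mem_cut[OF B] unfolding cutset_def by blast
  have in_cut: "f \<in> cutset T \<longleftrightarrow> f \<in> E0 \<and> ls f \<in> T \<and> rs f \<notin> T" for f by (simp add: cutset_def)
  have AE: "f \<in> E0" if "f \<in> A \<or> f \<in> B" for f using that A B Z_E0 by blast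
  let ?goal = "\<exists>m\<in>cutset T \<inter> M. \<exists>p\<in>cutset T - M. v \<in> ends G m \<and> v \<in> ends G p \<and>
     (\<forall>f\<in>cutset T. v \<in> ends G f \<longrightarrow> f = m \<or> f = p)"
  have goalI: ?goal if "m \<in> cutset T" "m \<in> M" "p \<in> cutset T" "p \<notin> M" "v \<in> ends G m" "v \<in> ends G p"
    "\<forall>f\<in>cutset T. v \<in> ends G f \<longrightarrow> f = m \<or> f = p" for m p
    by (rule bexI[of _ m], rule bexI[of _ p]) (use that in simp_all)
  have single: ?goal
    if X: "X \<in> Z" and Y: "Y \<in> Z" and XY: "T = side X \<union> side Y \<or> T = side X \<inter> side Y"
      and sub': "\<And>f. f \<in> cutset T \<Longrightarrow> f \<in> X \<or> f \<in> Y" and nY: "\<And>g. g \<in> Y \<Longrightarrow> v \<notin> ends G g" for X Y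
  proof -
    have eX: "e \<in> X" using sub'[OF e] nY v by blast
    obtain m p where mp: "m \<in> X" "m \<in> M" "p \<in> X" "p \<notin> M" "v \<in> ends G m" "v \<in> ends G p"
      "\<forall>f\<in>X. v \<in> ends G f \<longrightarrow> f = m \<or> f = p"
      using altsetE[OF Z_altset[OF X] eX v] .
    have E: "m \<in> E0" "p \<in> E0" using mp Z_E0[OF X] by auto
    have sY: "ls m \<in> side Y \<longleftrightarrow> ls p \<in> side Y" "rs m \<in> side Y \<longleftrightarrow> ls m \<in> side Y" "rs p \<in> side Y \<longleftrightarrow> ls p \<in> side Y"
      using side_away[OF Y E mp(5,6) nY] side_away[OF Y E(2,1) mp(6,5) nY] by blast+
    have sX: "ls m \<in> side X" "rs m \<notin> side X" "ls p \<in> side X" "rs p \<notin> side X"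
      using side_mem_cut[OF X] E mp(1,3) by auto
    have "m \<in> cutset T \<longleftrightarrow> p \<in> cutset T" using XY sX sY E unfolding in_cut by auto
    moreover have "e = m \<or> e = p" using mp(7) eX v by blast
    ultimately have in_T: "m \<in> cutset T" "p \<in> cutset T" using e by auto
    have "\<forall>f\<in>cutset T. v \<in> ends G f \<longrightarrow> f = m \<or> f = p" using sub' nY mp(7) by blast
    with in_T mp show ?goal by (intro goalI)
  qed
  show ?goal
  proof (cases "(\<exists>g\<in>A. v \<in> ends G g) \<and> (\<exists>g\<in>B. v \<in> ends G g)")
    case False
    show ?thesis
    proof (cases "\<exists>g\<in>B. v \<in> ends G g")
      case nB: False
      show ?thesis by (rule single[OF A B T]) (use sub nB in blast)+
    next
      case True
      then have nA: "\<not> (\<exists>g\<in>A. v \<in> ends G g)" using False by simp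
      have T': "T = side B \<union> side A \<or> T = side B \<inter> side A" using T by (simp add: Un_commute Int_commute)
      show ?thesis by (rule single[OF B A T']) (use sub nA in blast)+
    qed
  next
    case True
    then obtain gA gB where g: "gA \<in> A" "v \<in> ends G gA" "gB \<in> B" "v \<in> ends G gB" by blast
    obtain m p where mp: "m \<in> A" "m \<in> M" "p \<in> A" "p \<notin> M" "v \<in> ends G m" "v \<in> ends G p"
      "\<forall>f\<in>A. v \<in> ends G f \<longrightarrow> f = m \<or> f = p"
      using altsetE[OF Z_altset[OF A] g(1,2)] .
    obtain n q where nq: "n \<in> B" "n \<in> M" "q \<in> B" "q \<notin> M" "v \<in> ends G n" "v \<in> ends G q"
      "\<forall>f\<in>B. v \<in> ends G f \<longrightarrow> f = n \<or> f = q"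
      using altsetE[OF Z_altset[OF B] g(3,4)] .
    have nm: "n = m" using matching_edge_unique[OF nq(2) mp(2) nq(5) mp(5)] .
    have E: "m \<in> E0" "p \<in> E0" "q \<in> E0" using AE mp nq by auto
    have "m \<in> B" using nq(1) nm by simp
    then have sm: "ls m \<in> side A" "rs m \<notin> side A" "ls m \<in> side B" "rs m \<notin> side B"
      using side_mem_cut[OF A E(1)] side_mem_cut[OF B E(1)] mp(1) by auto
    have mT: "m \<in> cutset T" using sm T E unfolding in_cut by auto
    have at_v: "f = m \<or> f = p \<or> f = q" if "f \<in> cutset T" "v \<in> ends G f" for f
      using sub[OF that(1)] that(2) mp(7) nq(7) nm by blast
    have sp: "ls p \<in> side A" "rs p \<notin> side A" using side_mem_cut[OF A E(2)] mp(3) by auto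
    have sq: "ls q \<in> side B" "rs q \<notin> side B" using side_mem_cut[OF B E(3)] nq(3) by auto
    show ?thesis
    proof (cases "p = q")
      case True
      then have "p \<in> cutset T" using sp sq T E unfolding in_cut by auto
      then show ?thesis using mT at_v True mp by (intro goalI[of m p]) auto
    next
      case False
      have pB: "p \<notin> B" using nq(7) mp(2,4,6) nm False by blast
      have qA: "q \<notin> A" using mp(7) nq(4,6) mp(2) False by blast
      have merge: "ls p \<in> side B \<longleftrightarrow> ls q \<notin> side A"
        using side_merge[OF A B mp(1) \<open>m \<in> B\<close> mp(2) mp(3) pB mp(4) nq(3) qA nq(4) mp(5,6) nq(6)] .
      have same: "rs p \<in> side B \<longleftrightarrow> ls p \<in> side B" "rs q \<in> side A \<longleftrightarrow> ls q \<in> side A"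
        using side_mem_cut[OF B E(2)] side_no_reverse[OF B E(2)] pB
          side_mem_cut[OF A E(3)] side_no_reverse[OF A E(3)] qA by auto
      have "p \<in> cutset T \<longleftrightarrow> q \<notin> cutset T"
        using T sp sq merge same E unfolding in_cut by auto
      then show ?thesis
      proof (cases "p \<in> cutset T")
        case True
        then have "q \<notin> cutset T" using \<open>p \<in> cutset T \<longleftrightarrow> q \<notin> cutset T\<close> by simp
        then show ?thesis using True mT at_v mp(2,4,5,6) by (intro goalI[of m p]) auto
      next
        case False
        then have "q \<in> cutset T" using \<open>p \<in> cutset T \<longleftrightarrow> q \<notin> cutset T\<close> by simp
        then show ?thesis using False mT at_v mp(2,5) nq(4,6) by (intro goalI[of m q]) auto
      qed
    qed
  qed
qed

text \<open>A finite sample of the plane; it suffices because cuts are read off at these points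
  only.\<close>

definition F :: "complex set" where
  "F = ls ` E0 \<union> rs ` E0"

lemma cutset_jump:
  assumes A: "A \<in> Z" and B: "B \<in> Z" and T: "T = side A \<union> side B \<or> T = side A \<inter> side B" and e: "e \<in> E0"
  shows "of_bool (ls e \<in> T) - of_bool (rs e \<in> T) = (of_bool (e \<in> cutset T) :: int)"
  using T side_no_reverse[OF A e] side_no_reverse[OF B e] e by (auto simp: cutset_def)

lemma side_notin: "z \<in> side A \<Longrightarrow> z \<notin> X0"
  by (simp add: side_def)

text \<open>As \<open>T\<close> separates \<open>z\<close> from \<open>w\<close>, membership in
  \<open>T\<close> must jump somewhere, so the cut is nonempty and contains an alternating cycle. If
  that cycle is the whole cut, its side and \<open>T\<close> have equal jumps; their indicators
  differ by a constant, which is 0 at the left of \<open>e\<close>.\<close>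

lemma uncross_sides:
  assumes A: "A \<in> Z" and B: "B \<in> Z" and T: "T = side A \<union> side B \<or> T = side A \<inter> side B"
    and z: "z \<notin> X0" "z \<in> T" and w: "w \<notin> X0" "w \<notin> T"
  shows "\<exists>C\<in>Z. C \<subseteq> cutset T \<and> (C = cutset T \<longrightarrow> side C = T)"
proof -
  have resp: "a \<in> T \<longleftrightarrow> b \<in> T" if "a \<notin> X0" "b \<notin> X0" "same_side a b" for a b
    using T side_same_side[OF A that] side_same_side[OF B that] by auto
  have "\<exists>e\<in>E0. (ls e \<in> T) \<noteq> (rs e \<in> T)"
  proof (rule ccontr)
    assume *: "\<not> ?thesis"
    have "(z \<in> T) = (w \<in> T)"
      by (rule no_jump_constant[of "\<lambda>z. z \<in> T", OF resp _ z(1) w(1)]) (use * in blast)+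
    then show False using z w by simp
  qed
  then obtain e where e: "e \<in> E0" "(ls e \<in> T) \<noteq> (rs e \<in> T)" by blast
  then have "e \<in> cutset T" using cutset_jump[OF A B T e(1)] by (auto simp: of_bool_def split: if_splits)
  then obtain C where C: "alternating_cycle G M C" "C \<subseteq> cutset T" "e \<in> C"
    using altset_cycle[OF cutset_altset[OF A B T]] by blast
  have CZ: "C \<in> Z" using C by (simp add: Z_def)
  have "side C = T" if eq: "C = cutset T"
  proof -
    define f :: "complex \<Rightarrow> int" where "f u = of_bool (u \<in> side C) - of_bool (u \<in> T)" for u
    have f0: "f u = 0" if u: "u \<notin> X0" for u
    proof -
      have "f u = f (ls e)"
      proof (rule no_jump_constant[of f])
        show "f a = f b" if "a \<notin> X0" "b \<notin> X0" "same_side a b" for a b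
          using resp[OF that] side_same_side[OF CZ that] by (simp add: f_def)
        show "f (ls h) = f (rs h)" if "h \<in> E0" for h
          using side_jump[OF CZ that] cutset_jump[OF A B T that] eq by (simp add: f_def)
      qed (use u ls_rs_notin(1)[OF e(1)] in auto)
      also have "\<dots> = 0" using side_mem_cut[OF CZ e(1)] C(3) eq by (simp add: f_def cutset_def)
      finally show ?thesis .
    qed
    have "u \<in> side C \<longleftrightarrow> u \<in> T" if "u \<notin> X0" for u
      using f0[OF that] by (auto simp: f_def of_bool_def split: if_splits)
    moreover have "T \<subseteq> - X0" using T side_notin by blast
    ultimately show ?thesis using side_notin by blast
  qed
  then show ?thesis using CZ C(2) by blast
qed

sublocale cut_system Z "\<lambda>A. side A \<inter> F" F ls rs
proof
  have fin: "finite E0" using E0_edges finite_edges by (rule finite_subset)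
  then show "finite F" by (simp add: F_def)
  show "finite A" if "A \<in> Z" for A using Z_edges[OF that] finite_edges by (rule finite_subset)
  show "A \<noteq> {}" if "A \<in> Z" for A using Z_nonempty[OF that] .
  show "ls e \<in> F" "rs e \<in> F" if "e \<in> \<Union>Z" for e using that by (auto simp: F_def E0_def)
  show "side A \<inter> F \<subseteq> F" for A by simp
  show "e \<in> A \<longleftrightarrow> ls e \<in> side A \<inter> F \<and> rs e \<notin> side A \<inter> F" if "A \<in> Z" "e \<in> \<Union>Z" for A e
    using side_mem_cut[of A e] that by (auto simp: F_def E0_def)
  show "ls e \<in> side A \<inter> F" if "A \<in> Z" "e \<in> \<Union>Z" "rs e \<in> side A \<inter> F" for A e
    using side_no_reverse[of A e] that by (auto simp: F_def E0_def)
  fix A B T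
  assume A: "A \<in> Z" and B: "B \<in> Z" and i: "side A \<inter> F \<inter> (side B \<inter> F) \<noteq> {}"
    and u: "side A \<inter> F \<union> side B \<inter> F \<noteq> F"
    and T: "T = side A \<inter> F \<union> side B \<inter> F \<or> T = side A \<inter> F \<inter> (side B \<inter> F)"
  obtain T' where T': "T' = side A \<union> side B \<or> T' = side A \<inter> side B" "T = T' \<inter> F" using T by blast
  have FX: "F \<subseteq> - X0" using ls_rs_notin by (auto simp: F_def)
  obtain z where z: "z \<in> F" "z \<in> side A" "z \<in> side B" using i by blast
  obtain w where w: "w \<in> F" "w \<notin> side A" "w \<notin> side B" using u by blast
  obtain C where C: "C \<in> Z" "C \<subseteq> cutset T'" "C = cutset T' \<longrightarrow> side C = T'"
    using uncross_sides[OF A B T'(1), of z w] z w T'(1) FX by blast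
  have "cutset T' = {e\<in>\<Union>Z. ls e \<in> T \<and> rs e \<notin> T}"
    using T'(2) by (auto simp: cutset_def F_def E0_def)
  then show "\<exists>A'\<in>Z. A' \<subseteq> {e \<in> \<Union> Z. ls e \<in> T \<and> rs e \<notin> T} \<and>
      (A' = {e \<in> \<Union> Z. ls e \<in> T \<and> rs e \<notin> T} \<longrightarrow> side A' \<inter> F = T)"
    using C T'(2) by (intro bexI[of _ C]) auto
qed

lemma finite_M: "finite M"
  using pm finite_edges unfolding perfect_matching_def by (auto intro: finite_subset)

lemma Z_meets_M:
  assumes "A \<in> Z"
  shows "A \<inter> M \<noteq> {}"
proof -
  obtain e where e: "e \<in> A" using Z_nonempty[OF assms] by blast
  then obtain v where v: "v \<in> ends G e" using ends_nonempty Z_edges[OF assms] by blast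
  obtain m where "m \<in> A" "m \<in> M" using altsetE[OF Z_altset[OF assms] e v] by metis
  then show ?thesis by blast
qed

text \<open>The planar min-max theorem (Lucchesi--Younger, Pachter--Kim).\<close>

lemma forcing_le_disjoint_cycles:
  assumes k: "\<And>S. forcing_set G M S \<Longrightarrow> k \<le> card S"
  shows "\<exists>\<C>. finite \<C> \<and> card \<C> = k \<and> (\<forall>C\<in>\<C>. alternating_cycle G M C) \<and>
    (\<forall>C\<in>\<C>. \<forall>D\<in>\<C>. C \<noteq> D \<longrightarrow> C \<inter> D \<inter> M = {})"
proof (cases k)
  case 0
  then show ?thesis by (intro exI[of _ "{}"]) auto
next
  case (Suc j)
  have "pack M (\<lambda>e. of_bool (e \<in> M)) (Suc j)"
  proof (rule ccontr)
    assume "\<not> ?thesis"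
    from min_max[OF Z_meets_M finite_M subset_refl this] obtain T where
      T: "T \<subseteq> M" "card T \<le> j" "\<forall>A\<in>Z. A \<inter> M \<subseteq> M \<longrightarrow> A \<inter> T \<noteq> {}" by blast
    have "forcing_set G M T" using T unfolding forcing_set_iff[OF pm] by (auto simp: Z_def)
    then show False using k[of T] T(2) Suc by simp
  qed
  then obtain A where A: "\<forall>i<Suc j. A i \<in> Z" "\<forall>e\<in>M. load A (Suc j) e \<le> 1"
    unfolding pack_def by auto
  have disj: "A i \<inter> A l \<inter> M = {}" if il: "i < Suc j" "l < Suc j" "i \<noteq> l" for i l
  proof (rule ccontr)
    assume "A i \<inter> A l \<inter> M \<noteq> {}"
    then obtain e where e: "e \<in> A i" "e \<in> A l" "e \<in> M" by blast
    have "{i, l} \<subseteq> {i. i < Suc j \<and> e \<in> A i}" using il e by auto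
    then have "card {i, l} \<le> load A (Suc j) e" unfolding load_def by (intro card_mono) auto
    then show False using A(2) e(3) il by auto
  qed
  have inj: "inj_on A {..<Suc j}"
  proof (rule inj_onI)
    fix i l assume il: "i \<in> {..<Suc j}" "l \<in> {..<Suc j}" "A i = A l"
    then show "i = l" using disj[of i l] Z_meets_M[of "A i"] A(1) by force
  qed
  show ?thesis
  proof (intro exI[of _ "A ` {..<Suc j}"] conjI ballI impI)
    show "card (A ` {..<Suc j}) = k" using inj Suc by (simp add: card_image)
    show "alternating_cycle G M C" if "C \<in> A ` {..<Suc j}" for C using that A(1) by (auto simp: Z_def)
    show "C \<inter> D \<inter> M = {}" if "C \<in> A ` {..<Suc j}" "D \<in> A ` {..<Suc j}" "C \<noteq> D" for C D
      using that disj by blast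
  qed simp
qed

end

section \<open>Faces inside a cycle\<close>

text \<open>Recognises a face by its frontier alone, for passing between \<open>G\<close> and the
  graph inside a cycle.\<close>

lemma open_frontier_component:
  fixes f X :: "'a::euclidean_space set"
  assumes f: "connected f" "f \<noteq> {}" and fX: "f \<inter> X = {}" "frontier f \<subseteq> X"
  shows "f \<in> components (- X)"
proof -
  obtain x where x: "x \<in> f" using f by blast
  let ?c = "connected_component_set (- X) x"
  have sub: "f \<subseteq> ?c" using f fX x by (intro connected_component_maximal) auto
  have "?c \<subseteq> f"
  proof (rule ccontr)
    assume "\<not> ?c \<subseteq> f"
    then have "?c - f \<noteq> {}" by blast
    moreover have "?c \<inter> f \<noteq> {}" using sub x by blast
    ultimately have "?c \<inter> frontier f \<noteq> {}" by (intro connected_Int_frontier) auto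
    then show False using fX(2) connected_component_subset[of "- X" x] by blast
  qed
  then have "f = ?c" using sub by blast
  moreover have "x \<in> - X" using x fX by blast
  ultimately show ?thesis by (auto simp: components_def)
qed

lemma connected_subset_or_disjoint:
  assumes "connected T" "T \<inter> frontier U = {}" "T \<inter> U \<noteq> {}"
  shows "T \<subseteq> U"
  using assms connected_Int_frontier[of T U] by blast

lemma alternating_cycle_transfer:
  assumes "alternating_cycle G M A"
    and "\<And>e. e \<in> A \<Longrightarrow> e \<in> edges H \<and> ends H e = ends G e \<and> (e \<in> M \<longleftrightarrow> e \<in> N)"
  shows "alternating_cycle H N A"
proof -
  obtain vs es where c: "cycle_seq G vs es" "A = set es"
    "\<forall>i<length es. es ! i \<in> M \<longleftrightarrow> es ! (Suc i mod length es) \<notin> M"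
    using assms(1) unfolding alternating_cycle_def by blast
  note l = cycle_seq_lengths[OF c(1)]
  have n0: "0 < length es" using l(1,2) by linarith
  have in_A: "es ! i \<in> A" "es ! (Suc i mod length es) \<in> A" if "i < length es" for i
    using that c(2) n0 by auto
  have "cycle_seq H vs es"
    unfolding cycle_seq_def
  proof (intro conjI allI impI)
    fix i assume i: "i < length vs"
    then have iA: "es ! i \<in> A" using in_A(1) l(2) by simp
    show "es ! i \<in> edges H" using assms(2)[OF iA] by simp
    show "ends H (es ! i) = {vs ! i, vs ! (Suc i mod length vs)}" using assms(2)[OF iA] l(5)[OF i] by simp
  qed (use l in auto)
  moreover have "\<forall>i<length es. es ! i \<in> N \<longleftrightarrow> es ! (Suc i mod length es) \<notin> N"
    using c(3) assms(2)[OF in_A(1)] assms(2)[OF in_A(2)] by simp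
  ultimately show ?thesis using c(2) unfolding alternating_cycle_def by blast
qed

lemma alternating_cycle_nonempty: "alternating_cycle G M C \<Longrightarrow> C \<noteq> {}"
  by (auto simp: alternating_cycle_def cycle_seq_def)

lemma alternating_cycle_vertex:
  assumes "alternating_cycle G M C"
  shows "\<exists>v\<in>verts G. v \<in> \<Union>C"
proof -
  obtain vs es where c: "cycle_seq G vs es" "C = set es"
    using assms unfolding alternating_cycle_def by blast
  note l = cycle_seq_lengths[OF c(1)]
  have n0: "0 < length vs" using l(1) by linarith
  have "vs ! 0 \<in> ends G (es ! 0)" using l(5)[OF n0] by simp
  moreover have "es ! 0 \<in> C" using n0 l(2) c(2) by auto
  ultimately show ?thesis by (auto simp: ends_def)
qed

lemma resonant_setE:
  assumes "resonant_set G K"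
  obtains M where "perfect_matching G M" "\<forall>f\<in>K. resonant_face G M f"
    "\<forall>f\<in>K. \<forall>g\<in>K. f \<noteq> g \<longrightarrow> face_verts G f \<inter> face_verts G g = {}"
proof -
  have "\<exists>M. perfect_matching G M \<and> (\<forall>f\<in>K. resonant_face G M f)"
    and "\<forall>f\<in>K. \<forall>g\<in>K. f \<noteq> g \<longrightarrow> face_verts G f \<inter> face_verts G g = {}"
    using assms by (simp_all add: resonant_set_def)
  then show ?thesis using that by (elim exE conjE)
qed

lemma resonant_face_vertex:
  assumes "resonant_face G M f"
  shows "face_verts G f \<noteq> {}"
  using assms alternating_cycle_vertex unfolding resonant_face_def face_verts_def by blast

text \<open>A vertex chosen on each face identifies it, as the faces are vertex-disjoint. The bound
  makes the maximum in \<open>clar_number\<close> one over a finite set.\<close>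

lemma resonant_set_card_le:
  assumes "finite (verts G)" "resonant_set G K"
  shows "card K \<le> card (verts G)"
proof -
  obtain M where K: "\<forall>f\<in>K. resonant_face G M f"
    "\<forall>f\<in>K. \<forall>g\<in>K. f \<noteq> g \<longrightarrow> face_verts G f \<inter> face_verts G g = {}"
    using resonant_setE[OF assms(2)] by metis
  have "\<exists>v. v \<in> face_verts G f" if "f \<in> K" for f
    using resonant_face_vertex K(1) that by blast
  then obtain v where v: "\<And>f. f \<in> K \<Longrightarrow> v f \<in> face_verts G f" by metis
  have "inj_on v K"
  proof (rule inj_onI)
    fix f g assume fg: "f \<in> K" "g \<in> K" "v f = v g"
    then have "v f \<in> face_verts G f \<inter> face_verts G g" using v[OF fg(1)] v[OF fg(2)] by simp
    then show "f = g" using K(2) fg(1,2) by blast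
  qed
  moreover have "v ` K \<subseteq> verts G" using v by (auto simp: face_verts_def)
  ultimately show ?thesis using assms(1) by (rule card_inj_on_le)
qed

text \<open>By \<open>closed\<close> a matching edge meeting \<open>D\<close> has both ends in
  \<open>D\<close>, so deletion removes whole matching edges.\<close>

lemma perfect_matching_delete_faces:
  assumes pm: "perfect_matching H N"
    and D: "D = (\<Union>f\<in>K. face_verts H f)"
    and closed: "\<And>e. e \<in> N \<Longrightarrow> ends H e \<inter> D \<noteq> {} \<Longrightarrow> ends H e \<subseteq> D"
  shows "perfect_matching (delete_faces H K) {e\<in>N. ends H e \<inter> D = {}}"
  unfolding perfect_matching_def
proof (intro conjI ballI)
  have H': "verts (delete_faces H K) = verts H - D" "edges (delete_faces H K) = {e\<in>edges H. ends H e \<inter> D = {}}"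
    by (simp_all add: delete_faces_def Let_def D)
  show "{e\<in>N. ends H e \<inter> D = {}} \<subseteq> edges (delete_faces H K)"
    using pm H' by (auto simp: perfect_matching_def)
  fix v assume "v \<in> verts (delete_faces H K)"
  then have v: "v \<in> verts H" "v \<notin> D" using H' by auto
  obtain m where m: "m \<in> N" "v \<in> ends H m" "\<forall>f\<in>N. v \<in> ends H f \<longrightarrow> f = m"
    using perfect_matchingE[OF pm v(1)] .
  have e: "v \<in> ends (delete_faces H K) f \<longleftrightarrow> v \<in> ends H f" for f
    using v H' by (auto simp: ends_def)
  have mD: "ends H m \<inter> D = {}" using closed[OF m(1)] m(2) v(2) by blast
  show "\<exists>!f. f \<in> {e\<in>N. ends H e \<inter> D = {}} \<and> v \<in> ends (delete_faces H K) f"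
    unfolding e by (rule ex1I[of _ m]) (use m mD in blast)+
qed

context plane_bip
begin

abbreviation pts :: "pgraph \<Rightarrow> complex set" where
  "pts H \<equiv> verts H \<union> \<Union>(edges H)"

text \<open>A common point lies on a common edge or is a common vertex, and either forces the same
  matching edge into both cycles.\<close>

lemma alternating_disjoint:
  assumes C: "alternating_cycle G M C" and D: "alternating_cycle G M D" and pm: "perfect_matching G M"
    and CD: "C \<inter> D \<inter> M = {}"
  shows "\<Union>C \<inter> \<Union>D = {}"
proof -
  have CE: "C \<subseteq> edges G" "D \<subseteq> edges G" using C D alternating_cycle_edges by blast+
  have noshare: False if e: "e \<in> C" "v \<in> ends G e" and f: "f \<in> D" "v \<in> ends G f" for e f v
  proof -
    obtain m where m: "m \<in> C" "m \<in> M" "v \<in> ends G m"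
      using altsetE[OF alternating_cycle_altset[OF C] e] by metis
    obtain n where n: "n \<in> D" "n \<in> M" "v \<in> ends G n"
      using altsetE[OF alternating_cycle_altset[OF D] f] by metis
    have "m = n" using perfect_matching_unique[OF pm _ m(2,3) n(2,3)] m(3) ends_subset_verts by blast
    then show False using m n CD by blast
  qed
  have False if p: "e \<in> C" "p \<in> e" "f \<in> D" "p \<in> f" for e f p
  proof (cases "e = f")
    case True
    obtain v where "v \<in> ends G e" using ends_nonempty CE p(1) by blast
    then show False using noshare p(1,3) True by blast
  next
    case False
    then have "p \<in> verts G" using edges_meet[of e f] CE p by blast
    then show False using noshare[OF p(1) _ p(3)] p(2,4) by (auto simp: ends_def)
  qed
  then show ?thesis by blast
qed

text \<open>The outside of the outer cycle is connected, misses the inner cycle and is unbounded, so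
  it cannot meet the bounded inside of the inner one.\<close>

lemma inside_mono_cycle:
  assumes C: "cycle_seq G vs es" and D: "cycle_seq G us ds" and DC: "\<Union>(set ds) \<subseteq> inside (\<Union>(set es))"
  shows "inside (\<Union>(set ds)) \<subset> inside (\<Union>(set es))"
proof -
  let ?S = "\<Union>(set es)" and ?R = "\<Union>(set ds)"
  note jC = cycle_jordan[OF C] and jD = cycle_jordan[OF D]
  have disj: "outside ?S \<inter> ?R = {}" using DC jC(9) by blast
  have "outside ?S \<inter> frontier (inside ?R) = {}" using disj jD(11) by simp
  moreover have "\<not> outside ?S \<subseteq> inside ?R" using jC(8) jD(7) bounded_subset by blast
  ultimately have "outside ?S \<inter> inside ?R = {}"
    using connected_subset_or_disjoint[OF jC(6)] by blast
  then have sub: "inside ?R \<subseteq> ?S \<union> inside ?S" using jC(10) by blast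
  have "inside ?R \<inter> closure (outside ?S) = {}"
    using \<open>outside ?S \<inter> inside ?R = {}\<close> jD(3) by (metis inf_commute open_Int_closure_eq_empty)
  moreover have "?S \<subseteq> closure (outside ?S)" using jC(12) by (metis Diff_subset frontier_def)
  ultimately have "inside ?R \<subseteq> inside ?S" using sub by blast
  moreover have "inside ?R \<noteq> inside ?S"
  proof -
    have "?R \<noteq> {}" using jD(1) by (metis inside_empty)
    then obtain p where "p \<in> ?R" by blast
    then show ?thesis using DC jD(9,10) by blast
  qed
  ultimately show ?thesis by blast
qed

section \<open>The plane graph inside a cycle\<close>

context
  fixes C :: "complex set set" and vs es
  assumes c: "cycle_seq G vs es" and C: "C = set es"
begin

abbreviation "H \<equiv> cycle_interior G C"

lemma H_simps: "verts H = verts G \<inter> (\<Union>C \<union> inside (\<Union>C))" "edges H = {e\<in>edges G. e \<subseteq> \<Union>C \<union> inside (\<Union>C)}"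
  by (simp_all add: cycle_interior_def)

lemmas jordan = cycle_jordan[OF c, folded C]

lemma C_edges_H: "C \<subseteq> edges H"
proof
  fix e assume e: "e \<in> C"
  then have "e \<in> edges G" using cycle_seq_two_regular[OF c] C by (auto simp: two_regular_def)
  then show "e \<in> edges H" using e by (auto simp: cycle_interior_def)
qed

lemma H_edges_G: "edges H \<subseteq> edges G"
  by (auto simp: H_simps)

lemma ends_H: "e \<in> edges H \<Longrightarrow> ends H e = ends G e"
  by (auto simp: ends_def H_simps)

text \<open>Edges meet only in vertices, so the inner part of an edge that reaches the inside cannot
  cross \<open>C\<close>.\<close>

lemma edge_in_H:
  assumes e: "e \<in> edges G" and q: "q \<in> e" "q \<in> inside (\<Union>C)"
  shows "e \<in> edges H"
proof -
  have qC: "q \<notin> \<Union>C" using q(2) jordan(10) by blast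
  then have "e \<notin> C" using q(1) by blast
  let ?T = "insert q (e - verts G)"
  have conn: "connected ?T" using q(1) by (intro connected_edge_part[OF e]) auto
  have "f \<inter> e \<subseteq> verts G" if "f \<in> C" for f
    using edges_meet[of f e] that C_edges_H H_edges_G e \<open>e \<notin> C\<close> by blast
  then have "?T \<inter> \<Union>C = {}" using qC by blast
  then have "?T \<inter> frontier (inside (\<Union>C)) = {}" using jordan(11) by simp
  then have "?T \<subseteq> inside (\<Union>C)" using connected_subset_or_disjoint[OF conn] q(2) by blast
  then have "closure (e - verts G) \<subseteq> closure (inside (\<Union>C))" by (intro closure_mono) auto
  also have "\<dots> \<subseteq> \<Union>C \<union> inside (\<Union>C)"
    using jordan(11) by (metis Un_commute closure_Un_frontier eq_refl)
  finally show ?thesis using edge_interior(3)[OF e] e by (auto simp: H_simps)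
qed

text \<open>At a vertex of \<open>C\<close> the matching edge belongs to \<open>C\<close>, because
  \<open>C\<close> alternates. So \<open>M\<close> splits into a matching of \<open>H\<close> and a
  matching of the rest, and the former can be exchanged independently.\<close>

lemma matching_edge_in_H:
  assumes pm: "perfect_matching G M" and alt: "alternating_cycle G M C"
    and v: "v \<in> verts H" and m: "m \<in> M" "v \<in> ends G m"
  shows "m \<in> edges H"
proof (cases "v \<in> \<Union>C")
  case True
  then obtain e where e: "e \<in> C" "v \<in> ends G e" using v by (auto simp: H_simps ends_def)
  obtain n where n: "n \<in> C" "n \<in> M" "v \<in> ends G n"
    using altsetE[OF alternating_cycle_altset[OF alt] e] by metis
  have "m = n" using perfect_matching_unique[OF pm _ m n(2,3)] v by (simp add: H_simps)
  then show ?thesis using n(1) C_edges_H by blast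
next
  case False
  have "m \<in> edges G" using pm m(1) by (auto simp: perfect_matching_def)
  then show ?thesis using edge_in_H[of m v] False v m(2) by (auto simp: H_simps ends_def)
qed

lemma perfect_matching_H:
  assumes pm: "perfect_matching G M" and alt: "alternating_cycle G M C"
  shows "perfect_matching H (M \<inter> edges H)"
  unfolding perfect_matching_def
proof (intro conjI ballI)
  fix v assume v: "v \<in> verts H"
  then have vG: "v \<in> verts G" by (simp add: H_simps)
  obtain m where m: "m \<in> M" "v \<in> ends G m" "\<forall>f\<in>M. v \<in> ends G f \<longrightarrow> f = m"
    using perfect_matchingE[OF pm vG] .
  have mH: "m \<in> edges H" using matching_edge_in_H[OF pm alt v m(1,2)] .
  show "\<exists>!e. e \<in> M \<inter> edges H \<and> v \<in> ends H e"
    by (rule ex1I[of _ m]) (use m mH ends_H in blast)+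
qed simp

lemma perfect_matching_replace:
  assumes pm: "perfect_matching G M" and alt: "alternating_cycle G M C" and N: "perfect_matching H N"
  shows "perfect_matching G (N \<union> (M - edges H))"
  unfolding perfect_matching_def
proof (intro conjI ballI)
  have NH: "N \<subseteq> edges H" using N by (simp add: perfect_matching_def)
  show "N \<union> (M - edges H) \<subseteq> edges G" using NH H_edges_G pm by (auto simp: perfect_matching_def)
  fix v assume v: "v \<in> verts G"
  show "\<exists>!e. e \<in> N \<union> (M - edges H) \<and> v \<in> ends G e"
  proof (cases "v \<in> verts H")
    case True
    obtain n where n: "n \<in> N" "v \<in> ends H n" "\<forall>f\<in>N. v \<in> ends H f \<longrightarrow> f = n"
      using perfect_matchingE[OF N True] .
    have M: "f \<in> edges H" if "f \<in> M" "v \<in> ends G f" for f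
      using matching_edge_in_H[OF pm alt True that] .
    show ?thesis
    proof (rule ex1I[of _ n])
      show "n \<in> N \<union> (M - edges H) \<and> v \<in> ends G n" using n(1,2) NH ends_H by blast
      fix f assume f: "f \<in> N \<union> (M - edges H) \<and> v \<in> ends G f"
      then have "f \<in> N" using M by blast
      then show "f = n" using n(3) f NH ends_H by blast
    qed
  next
    case False
    obtain m where m: "m \<in> M" "v \<in> ends G m" "\<forall>f\<in>M. v \<in> ends G f \<longrightarrow> f = m"
      using perfect_matchingE[OF pm v] .
    have off: "v \<notin> ends G f" if "f \<in> edges H" for f
      using ends_H[OF that] False ends_subset_verts by blast
    show ?thesis
    proof (rule ex1I[of _ m])
      show "m \<in> N \<union> (M - edges H) \<and> v \<in> ends G m" using m(1,2) off by blast
      fix f assume f: "f \<in> N \<union> (M - edges H) \<and> v \<in> ends G f"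
      then have "f \<in> M" using off NH by blast
      then show "f = m" using m(3) f by blast
    qed
  qed
qed

text \<open>A face of \<open>H\<close> that left the inside of \<open>C\<close> would contain the
  whole unbounded outside. And inside \<open>C\<close> the graph \<open>G\<close> has no points
  beyond those of \<open>H\<close>.\<close>

lemma face_H_imp_G:
  assumes f: "f \<in> finite_faces H" "frontier f = \<Union>A" and A: "A \<subseteq> edges H"
  shows "f \<in> finite_faces G"
proof -
  have fc: "f \<in> components (- pts H)" and fb: "bounded f" using f by (auto simp: finite_faces_def)
  have conn: "connected f" and ne: "f \<noteq> {}" and fH: "f \<inter> pts H = {}"
    using in_components_connected[OF fc] in_components_nonempty[OF fc] in_components_subset[OF fc] by auto
  have CH: "\<Union>C \<subseteq> pts H" using C_edges_H by blast
  have "f \<subseteq> inside (\<Union>C)"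
  proof (rule ccontr)
    assume n: "\<not> f \<subseteq> inside (\<Union>C)"
    have fC: "f \<inter> \<Union>C = {}" using fH CH by blast
    then have "f \<inter> frontier (inside (\<Union>C)) = {}" using jordan(11) by simp
    then have "f \<inter> inside (\<Union>C) = {}" using connected_subset_or_disjoint[OF conn] n by blast
    then have fo: "f \<subseteq> outside (\<Union>C)" using fC jordan(10) by blast
    have "outside (\<Union>C) \<inter> (\<Union>C \<union> inside (\<Union>C)) = {}" using jordan(9,10) by blast
    then have "outside (\<Union>C) \<subseteq> - pts H" by (auto simp: H_simps)
    then have "outside (\<Union>C) \<subseteq> f"
      using in_components_maximal[THEN iffD1, OF fc] jordan(2,6) fo ne by blast
    then show False using fb jordan(8) bounded_subset by blast
  qed
  then have fi: "x \<in> inside (\<Union>C)" if "x \<in> f" for x using that by blast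
  have "f \<inter> pts G = {}"
  proof (rule ccontr)
    assume "f \<inter> pts G \<noteq> {}"
    then obtain x where x: "x \<in> f" "x \<in> pts G" by blast
    have "x \<in> pts H"
    proof (cases "x \<in> verts G")
      case True
      then show ?thesis using fi[OF x(1)] by (simp add: H_simps)
    next
      case False
      then obtain e where "e \<in> edges G" "x \<in> e" using x(2) by blast
      then show ?thesis using edge_in_H fi[OF x(1)] by blast
    qed
    then show False using fH x(1) by blast
  qed
  moreover have "frontier f \<subseteq> pts G" using f(2) A H_edges_G by blast
  ultimately have "f \<in> components (- pts G)" using open_frontier_component conn ne by blast
  then show ?thesis using fb by (simp add: finite_faces_def)
qed

lemma face_G_imp_H:
  assumes f: "f \<in> finite_faces G" "frontier f = \<Union>A" and A: "A \<subseteq> edges H"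
  shows "f \<in> finite_faces H"
proof -
  have fc: "f \<in> components (- pts G)" and fb: "bounded f" using f by (auto simp: finite_faces_def)
  have conn: "connected f" and ne: "f \<noteq> {}" and fG: "f \<inter> pts G = {}"
    using in_components_connected[OF fc] in_components_nonempty[OF fc] in_components_subset[OF fc] by auto
  have "pts H \<subseteq> pts G" by (auto simp: H_simps)
  then have "f \<inter> pts H = {}" using fG by blast
  moreover have "frontier f \<subseteq> pts H" using f(2) A by blast
  ultimately have "f \<in> components (- pts H)" using open_frontier_component conn ne by blast
  then show ?thesis using fb by (simp add: finite_faces_def)
qed

end

end

section \<open>From disjoint alternating cycles to disjoint faces\<close>

context plane_bip
begin

definition facial :: "complex set set \<Rightarrow> bool" where
  "facial C \<longleftrightarrow> (\<exists>f\<in>finite_faces G. frontier f = \<Union>C)"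

lemma disjoint_family_inj:
  assumes "\<And>D. D \<in> \<A> \<Longrightarrow> alternating_cycle G M D" and "\<And>D. D \<in> \<A> \<Longrightarrow> frontier (\<phi> D) = \<Union>D"
    and "\<And>D E. D \<in> \<A> \<Longrightarrow> E \<in> \<A> \<Longrightarrow> D \<noteq> E \<Longrightarrow> \<Union>D \<inter> \<Union>E = {}"
  shows "inj_on \<phi> \<A>"
proof (rule inj_onI, rule ccontr)
  fix D E assume DE: "D \<in> \<A>" "E \<in> \<A>" "\<phi> D = \<phi> E" "D \<noteq> E"
  then have "\<Union>D = \<Union>E" using assms(2) by metis
  moreover have "\<Union>D \<inter> \<Union>E = {}" using assms(3) DE by blast
  ultimately have "\<Union>D = {}" by blast
  then show False using alternating_cycle_vertex[OF assms(1)[OF DE(1)]] by blast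
qed

text \<open>
  If all cycles of a disjoint family inside \<open>C\<close> bound faces, these faces are not a maximum
  resonant set of \<open>I[C]\<close>: flipping \<open>C\<close> would give a second perfect matching of what remains
  after deleting them.
\<close>

lemma larger_resonant_set:
  assumes pm: "perfect_matching G M" and alt: "alternating_cycle G M C"
    and hyp: "\<And>K. maximum_resonant_set (cycle_interior G C) K \<Longrightarrow>
       \<exists>!M. perfect_matching (delete_faces (cycle_interior G C) K) M"
    and \<A>: "\<And>D. D \<in> \<A> \<Longrightarrow> alternating_cycle G M D" "\<And>D. D \<in> \<A> \<Longrightarrow> \<Union>D \<subseteq> inside (\<Union>C)"
      "\<And>D. D \<in> \<A> \<Longrightarrow> facial D" "\<And>D E. D \<in> \<A> \<Longrightarrow> E \<in> \<A> \<Longrightarrow> D \<noteq> E \<Longrightarrow> \<Union>D \<inter> \<Union>E = {}"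
  shows "\<exists>K. resonant_set (cycle_interior G C) K \<and> card \<A> < card K"
proof (rule ccontr)
  assume neg: "\<not> ?thesis"
  obtain vs es where c: "cycle_seq G vs es" "C = set es" using alt unfolding alternating_cycle_def by blast
  let ?H = "cycle_interior G C"
  define N where "N = M \<inter> edges ?H"
  note jordan = cycle_jordan[OF c(1), folded c(2)]
  have CH: "C \<subseteq> edges ?H" using C_edges_H[OF c] .
  have ends_H: "ends ?H e = ends G e" if "e \<in> edges ?H" for e using ends_H[OF c that] .
  have pmN: "perfect_matching ?H N" unfolding N_def using perfect_matching_H[OF c pm alt] .
  have DH: "D \<subseteq> edges ?H" if D: "D \<in> \<A>" for D
  proof
    fix e assume e: "e \<in> D"
    then have "e \<in> edges G" "e \<subseteq> inside (\<Union>C)"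
      using alternating_cycle_edges[OF \<A>(1)[OF D]] \<A>(2)[OF D] by auto
    then show "e \<in> edges ?H" by (auto simp: cycle_interior_def)
  qed
  have altH: "alternating_cycle ?H N D" if D: "alternating_cycle G M D" "D \<subseteq> edges ?H" for D
    using D(1)
  proof (rule alternating_cycle_transfer)
    fix e assume "e \<in> D"
    then show "e \<in> edges ?H \<and> ends ?H e = ends G e \<and> (e \<in> M \<longleftrightarrow> e \<in> N)"
      using D(2) ends_H by (auto simp: N_def)
  qed
  have "\<forall>D\<in>\<A>. \<exists>f. f \<in> finite_faces G \<and> frontier f = \<Union>D" using \<A>(3) unfolding facial_def by blast
  then obtain \<phi> where \<phi>: "\<And>D. D \<in> \<A> \<Longrightarrow> \<phi> D \<in> finite_faces G" "\<And>D. D \<in> \<A> \<Longrightarrow> frontier (\<phi> D) = \<Union>D"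
    by metis
  have inj: "inj_on \<phi> \<A>" using disjoint_family_inj[OF \<A>(1) \<phi>(2) \<A>(4)] .
  define K where "K = \<phi> ` \<A>"
  have fH: "\<phi> D \<in> finite_faces ?H" if D: "D \<in> \<A>" for D
    using face_G_imp_H[OF c \<phi>(1)[OF D] \<phi>(2)[OF D] DH[OF D]] .
  have "resonant_set ?H K"
    unfolding resonant_set_def
  proof (intro conjI ballI impI exI[of _ N])
    show "perfect_matching ?H N" by (rule pmN)
    show "resonant_face ?H N f" if fK: "f \<in> K" for f
    proof -
      obtain D where D: "D \<in> \<A>" "f = \<phi> D" using fK by (auto simp: K_def)
      have "alternating_cycle ?H N D" using altH[OF \<A>(1)[OF D(1)] DH[OF D(1)]] .
      then show ?thesis using fH[OF D(1)] \<phi>(2)[OF D(1)] D(2) unfolding resonant_face_def by blast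
    qed
    show "face_verts ?H f \<inter> face_verts ?H g = {}" if fg: "f \<in> K" "g \<in> K" "f \<noteq> g" for f g
    proof -
      obtain D E where DE: "D \<in> \<A>" "f = \<phi> D" "E \<in> \<A>" "g = \<phi> E" using fg by (auto simp: K_def)
      then have "\<Union>D \<inter> \<Union>E = {}" using \<A>(4) fg(3) by blast
      then show ?thesis using \<phi>(2)[OF DE(1)] \<phi>(2)[OF DE(3)] DE by (auto simp: face_verts_def)
    qed
  qed
  \<comment> \<open>The negated claim bounds every resonant set by \<open>card \<A>\<close>, which
    is the size of \<open>K\<close>.\<close>
  moreover have "card K' \<le> card K" if "resonant_set ?H K'" for K'
    using neg that inj by (simp add: K_def card_image not_less)
  ultimately have "maximum_resonant_set ?H K" by (simp add: maximum_resonant_set_def)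
  then have uniq: "\<exists>!L. perfect_matching (delete_faces ?H K) L" by (rule hyp)
  define V where "V = (\<Union>f\<in>K. face_verts ?H f)"
  have V: "v \<in> V \<longleftrightarrow> v \<in> verts ?H \<and> (\<exists>D\<in>\<A>. v \<in> \<Union>D)" for v
    using \<phi>(2) by (auto simp: V_def K_def face_verts_def)
  have VC: "V \<inter> \<Union>C = {}"
  proof -
    have "inside (\<Union>C) \<inter> \<Union>C = {}" using jordan(10) by blast
    then show ?thesis using V \<A>(2) by blast
  qed
  have closedN: "ends ?H e \<subseteq> V" if e: "e \<in> N" "ends ?H e \<inter> V \<noteq> {}" for e
  proof -
    obtain v where v: "v \<in> ends ?H e" "v \<in> V" using e by blast
    then obtain D f where D: "D \<in> \<A>" "f \<in> D" "v \<in> f" using V by blast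
    have vf: "v \<in> ends ?H f" using D(3) v by (auto simp: ends_def)
    obtain m where m: "m \<in> D" "m \<in> N" "v \<in> ends ?H m"
      using altsetE[OF alternating_cycle_altset[OF altH[OF \<A>(1)[OF D(1)] DH[OF D(1)]]] D(2) vf] by metis
    have "e = m" using perfect_matching_unique[OF pmN _ e(1) v(1) m(2,3)] v(1) ends_subset_verts by blast
    then show ?thesis using m(1) D(1) V by (auto simp: ends_def)
  qed
  \<comment> \<open>The faces in \<open>K\<close> have no vertex on \<open>C\<close>, so flipping
    \<open>C\<close> leaves the matching on the deleted vertices unchanged and both matchings
    survive the deletion.\<close>
  define N' where "N' = (N - C) \<union> (C - N)"
  have altC: "altset ?H N C" using alternating_cycle_altset[OF altH[OF alt CH]] .
  have pmN': "perfect_matching ?H N'" unfolding N'_def by (rule perfect_matching_flip[OF pmN altC])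
  have CV: "ends ?H e \<inter> V = {}" if "e \<in> C" for e using that VC by (auto simp: ends_def)
  have closedN': "ends ?H e \<subseteq> V" if e: "e \<in> N'" "ends ?H e \<inter> V \<noteq> {}" for e
  proof -
    have "e \<notin> C" using CV e(2) by blast
    then show ?thesis using closedN e by (auto simp: N'_def)
  qed
  have "perfect_matching (delete_faces ?H K) {e\<in>N. ends ?H e \<inter> V = {}}"
    using perfect_matching_delete_faces[OF pmN V_def closedN] .
  moreover have "perfect_matching (delete_faces ?H K) {e\<in>N'. ends ?H e \<inter> V = {}}"
    using perfect_matching_delete_faces[OF pmN' V_def closedN'] .
  ultimately have eq: "{e\<in>N. ends ?H e \<inter> V = {}} = {e\<in>N'. ends ?H e \<inter> V = {}}" using uniq by blast
  obtain e where "e \<in> C" using alternating_cycle_nonempty[OF alt] by blast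
  then have "e \<in> N \<longleftrightarrow> e \<in> N'" using eq CV by blast
  then show False using \<open>e \<in> C\<close> by (auto simp: N'_def)
qed

text \<open>Each exchange keeps the number of cycles and removes a nonfacial one without creating
  another. It may change the matching inside \<open>C\<close>, so the induction ranges over all
  matchings.\<close>

lemma disjoint_cycles_resonant:
  assumes hyp: "\<And>C K. nice_cycle G C \<Longrightarrow> maximum_resonant_set (cycle_interior G C) K \<Longrightarrow>
           \<exists>!M. perfect_matching (delete_faces (cycle_interior G C) K) M"
    and fin: "finite \<C>" and pm: "perfect_matching G M" and alt: "\<And>C. C \<in> \<C> \<Longrightarrow> alternating_cycle G M C"
    and disj: "\<And>C D. C \<in> \<C> \<Longrightarrow> D \<in> \<C> \<Longrightarrow> C \<noteq> D \<Longrightarrow> \<Union>C \<inter> \<Union>D = {}"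
  shows "\<exists>K. resonant_set G K \<and> card K = card \<C>"
  using fin pm alt disj
proof (induction "card {C\<in>\<C>. \<not> facial C}" arbitrary: \<C> M rule: less_induct)
  case less
  note fin = less.prems(1) and pm = less.prems(2) and alt = less.prems(3) and disj = less.prems(4)
  show ?case
  proof (cases "\<forall>C\<in>\<C>. facial C")
    case True
    then have "\<forall>C\<in>\<C>. \<exists>f. f \<in> finite_faces G \<and> frontier f = \<Union>C" by (auto simp: facial_def)
    then obtain \<phi> where \<phi>: "\<And>C. C \<in> \<C> \<Longrightarrow> \<phi> C \<in> finite_faces G" "\<And>C. C \<in> \<C> \<Longrightarrow> frontier (\<phi> C) = \<Union>C"
      by metis
    have inj: "inj_on \<phi> \<C>" using disjoint_family_inj[OF alt \<phi>(2) disj] .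
    have "resonant_set G (\<phi> ` \<C>)"
      unfolding resonant_set_def
    proof (intro conjI ballI impI exI[of _ M])
      show "perfect_matching G M" by (rule pm)
      show "resonant_face G M f" if "f \<in> \<phi> ` \<C>" for f
        using that \<phi> alt unfolding resonant_face_def by blast
      show "face_verts G f \<inter> face_verts G g = {}" if fg: "f \<in> \<phi> ` \<C>" "g \<in> \<phi> ` \<C>" "f \<noteq> g" for f g
      proof -
        obtain D E where DE: "D \<in> \<C>" "f = \<phi> D" "E \<in> \<C>" "g = \<phi> E" using fg by auto
        then have "\<Union>D \<inter> \<Union>E = {}" using disj fg(3) by blast
        then show ?thesis using \<phi>(2)[OF DE(1)] \<phi>(2)[OF DE(3)] DE by (auto simp: face_verts_def)
      qed
    qed
    then show ?thesis using inj by (intro exI[of _ "\<phi> ` \<C>"]) (simp add: card_image)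
  next
    case False
    let ?in = "\<lambda>C. inside (\<Union>C)"
    let ?B = "{C\<in>\<C>. \<not> facial C}"
    have "finite (?in ` ?B)" "?in ` ?B \<noteq> {}" using fin False by auto
    from finite_has_minimal[OF this] obtain C where C: "C \<in> \<C>" "\<not> facial C"
      and min: "\<And>D. D \<in> \<C> \<Longrightarrow> \<not> facial D \<Longrightarrow> ?in D \<subseteq> ?in C \<Longrightarrow> ?in C = ?in D"
      by auto
    have altC: "alternating_cycle G M C" using alt C by blast
    obtain vs es where c: "cycle_seq G vs es" "C = set es" using altC unfolding alternating_cycle_def by blast
    let ?H = "cycle_interior G C"
    note jordan = cycle_jordan[OF c(1), folded c(2)]
    define \<A> where "\<A> = {D\<in>\<C>. \<Union>D \<subseteq> ?in C}"
    have CA: "C \<notin> \<A>"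
    proof
      assume "C \<in> \<A>"
      then have "\<Union>C \<subseteq> ?in C" by (simp add: \<A>_def)
      then have "\<Union>C = {}" using jordan(10) by blast
      then show False using alternating_cycle_vertex[OF altC] by blast
    qed
    have A_facial: "facial D" if D: "D \<in> \<A>" for D
    proof (rule ccontr)
      assume nf: "\<not> facial D"
      obtain us ds where d: "cycle_seq G us ds" "D = set ds"
        using alt D unfolding alternating_cycle_def \<A>_def by blast
      have "?in D \<subset> ?in C" using inside_mono_cycle[OF c(1) d(1)] D c(2) d(2) by (simp add: \<A>_def)
      then show False using min[of D] nf D by (auto simp: \<A>_def)
    qed
    have "nice_cycle G C" using pm altC unfolding nice_cycle_def by blast
    then have "\<exists>K. resonant_set ?H K \<and> card \<A> < card K"
      using hyp A_facial alt disj
      by (intro larger_resonant_set[OF pm altC]) (auto simp: \<A>_def)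
    then obtain K' where K': "resonant_set ?H K'" "card \<A> < card K'" by blast
    \<comment> \<open>The larger resonant set is trimmed to the number of cycles it replaces: those
      in \<open>\<A>\<close> together with \<open>C\<close>.\<close>
    obtain K where K: "K \<subseteq> K'" "card K = Suc (card \<A>)"
      using K'(2) by (metis Suc_leI obtain_subset_with_card_n)
    have finK: "finite K" using K(2) by (intro card_ge_0_finite) simp
    obtain N where N: "perfect_matching ?H N" "\<forall>f\<in>K'. resonant_face ?H N f"
      "\<forall>f\<in>K'. \<forall>g\<in>K'. f \<noteq> g \<longrightarrow> face_verts ?H f \<inter> face_verts ?H g = {}"
      using resonant_setE[OF K'(1)] by metis
    have "\<forall>f\<in>K. \<exists>D. f \<in> finite_faces ?H \<and> frontier f = \<Union>D \<and> alternating_cycle ?H N D"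
      using N(2) K(1) unfolding resonant_face_def by blast
    then obtain \<psi> where \<psi>: "\<And>f. f \<in> K \<Longrightarrow> f \<in> finite_faces ?H" "\<And>f. f \<in> K \<Longrightarrow> frontier f = \<Union>(\<psi> f)"
      "\<And>f. f \<in> K \<Longrightarrow> alternating_cycle ?H N (\<psi> f)" by metis
    have \<psi>H: "\<psi> f \<subseteq> edges ?H" if "f \<in> K" for f using alternating_cycle_edges[OF \<psi>(3)[OF that]] .
    have ends_H: "ends ?H e = ends G e" if "e \<in> edges ?H" for e using ends_H[OF c that] .
    have HG: "edges ?H \<subseteq> edges G" using H_edges_G[OF c] .
    \<comment> \<open>Only edges of \<open>H\<close> are rematched, so the cycles in
      \<open>\<O>\<close>, which lie outside \<open>C\<close>, stay alternating.\<close>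
    define M' where "M' = N \<union> (M - edges ?H)"
    have pm': "perfect_matching G M'" unfolding M'_def by (rule perfect_matching_replace[OF c pm altC N(1)])
    have NH: "N \<subseteq> edges ?H" using N(1) by (simp add: perfect_matching_def)
    have alt_\<psi>: "alternating_cycle G M' (\<psi> f)" if f: "f \<in> K" for f
      using \<psi>(3)[OF f]
    proof (rule alternating_cycle_transfer)
      fix e assume "e \<in> \<psi> f"
      then have "e \<in> edges ?H" using \<psi>H[OF f] by blast
      then show "e \<in> edges G \<and> ends G e = ends ?H e \<and> (e \<in> N \<longleftrightarrow> e \<in> M')"
        using HG ends_H by (auto simp: M'_def)
    qed
    have \<psi>in: "\<Union>(\<psi> f) \<subseteq> \<Union>C \<union> ?in C" if "f \<in> K" for f
      using \<psi>H[OF that] by (auto simp: cycle_interior_def)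
    define \<O> where "\<O> = \<C> - insert C \<A>"
    have out: "\<Union>D \<subseteq> outside (\<Union>C)" if D: "D \<in> \<O>" for D
    proof -
      have DC: "D \<in> \<C>" "D \<noteq> C" "\<not> \<Union>D \<subseteq> ?in C" using D by (auto simp: \<O>_def \<A>_def)
      have dC: "\<Union>D \<inter> \<Union>C = {}" using disj[OF DC(1) C(1) DC(2)] .
      obtain us ds where d: "cycle_seq G us ds" "D = set ds"
        using alt[OF DC(1)] unfolding alternating_cycle_def by blast
      have conn: "connected (\<Union>D)" using cycle_jordan(14)[OF d(1)] d(2) by simp
      have "\<Union>D \<inter> frontier (?in C) = {}" using dC jordan(11) by simp
      then have "\<Union>D \<inter> ?in C = {}" using connected_subset_or_disjoint[OF conn] DC(3) by blast
      then show ?thesis using dC jordan(10) by blast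
    qed
    have offH: "e \<notin> edges ?H" if D: "D \<in> \<O>" and e: "e \<in> D" for D e
    proof
      assume eH: "e \<in> edges ?H"
      then have "e \<subseteq> \<Union>C \<union> ?in C" by (simp add: cycle_interior_def)
      moreover have "e \<subseteq> outside (\<Union>C)" using out[OF D] e by blast
      ultimately have "e = {}" using jordan(9,10) by blast
      moreover have "e \<noteq> {}" using ends_nonempty[of e] eH HG by (auto simp: ends_def)
      ultimately show False by simp
    qed
    have alt_\<O>: "alternating_cycle G M' D" if D: "D \<in> \<O>" for D
    proof (rule alternating_cycle_transfer)
      show a: "alternating_cycle G M D" using D alt by (simp add: \<O>_def)
      fix e assume e: "e \<in> D"
      then show "e \<in> edges G \<and> ends G e = ends G e \<and> (e \<in> M \<longleftrightarrow> e \<in> M')"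
        using alternating_cycle_edges[OF a] offH[OF D e] NH by (auto simp: M'_def)
    qed
    have disj_\<psi>: "\<Union>(\<psi> f) \<inter> \<Union>(\<psi> g) = {}" if fg: "f \<in> K" "g \<in> K" "f \<noteq> g" for f g
    proof (rule alternating_disjoint[OF alt_\<psi>[OF fg(1)] alt_\<psi>[OF fg(2)] pm'], rule ccontr)
      assume "\<psi> f \<inter> \<psi> g \<inter> M' \<noteq> {}"
      then obtain e where e: "e \<in> \<psi> f" "e \<in> \<psi> g" by blast
      have eH: "e \<in> edges ?H" using \<psi>H[OF fg(1)] e(1) by blast
      then obtain v where "v \<in> ends ?H e" using ends_nonempty[of e] ends_H HG by auto
      then have "v \<in> face_verts ?H f \<inter> face_verts ?H g"
        using e \<psi>(2)[OF fg(1)] \<psi>(2)[OF fg(2)] by (auto simp: face_verts_def ends_def)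
      moreover have "face_verts ?H f \<inter> face_verts ?H g = {}"
        using N(3) fg K(1) by blast
      ultimately show False by blast
    qed
    have disj_\<psi>\<O>: "\<Union>(\<psi> f) \<inter> \<Union>D = {}" if "f \<in> K" "D \<in> \<O>" for f D
      using \<psi>in[OF that(1)] out[OF that(2)] jordan(9,10) by blast
    have \<psi>ne: "\<Union>(\<psi> f) \<noteq> {}" if "f \<in> K" for f
      using alternating_cycle_vertex[OF alt_\<psi>[OF that]] by blast
    have inj: "inj_on \<psi> K"
    proof (rule inj_onI, rule ccontr)
      fix f g assume "f \<in> K" "g \<in> K" "\<psi> f = \<psi> g" "f \<noteq> g"
      then show False using disj_\<psi>[of f g] \<psi>ne[of f] by auto
    qed
    define \<C>' where "\<C>' = \<psi> ` K \<union> \<O>"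
    have finO: "finite \<O>" using fin by (simp add: \<O>_def)
    have "\<psi> ` K \<inter> \<O> = {}" using disj_\<psi>\<O> \<psi>ne by fastforce
    then have "card \<C>' = Suc (card \<A>) + card \<O>"
      unfolding \<C>'_def using finK finO inj K(2) by (subst card_Un_disjoint) (auto simp: card_image)
    also have "\<dots> = card \<C>"
    proof -
      have "finite \<A>" "insert C \<A> \<subseteq> \<C>" using fin C(1) by (auto simp: \<A>_def)
      then have "card \<O> = card \<C> - Suc (card \<A>)" "Suc (card \<A>) \<le> card \<C>"
        using CA card_mono[OF fin, of "insert C \<A>"] by (simp_all add: \<O>_def card_Diff_subset)
      then show ?thesis by simp
    qed
    finally have card': "card \<C>' = card \<C>" .
    have "facial (\<psi> f)" if f: "f \<in> K" for f
      using face_H_imp_G[OF c \<psi>(1)[OF f] \<psi>(2)[OF f] \<psi>H[OF f]] \<psi>(2)[OF f] unfolding facial_def by blast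
    then have "{D\<in>\<C>'. \<not> facial D} \<subseteq> ?B - {C}" by (auto simp: \<C>'_def \<O>_def)
    then have "{D\<in>\<C>'. \<not> facial D} \<subset> ?B" using C by blast
    then have "card {D\<in>\<C>'. \<not> facial D} < card ?B" using fin by (intro psubset_card_mono) auto
    then have "\<exists>K. resonant_set G K \<and> card K = card \<C>'"
    proof (rule less.hyps[OF _ _ pm'])
      show "finite \<C>'" using finK finO by (simp add: \<C>'_def)
      show "alternating_cycle G M' D" if "D \<in> \<C>'" for D using that alt_\<psi> alt_\<O> by (auto simp: \<C>'_def)
      show "\<Union>D \<inter> \<Union>E = {}" if DE: "D \<in> \<C>'" "E \<in> \<C>'" "D \<noteq> E" for D E
      proof -
        consider f g where "f \<in> K" "g \<in> K" "D = \<psi> f" "E = \<psi> g" | f where "f \<in> K" "D = \<psi> f" "E \<in> \<O>"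
          | g where "g \<in> K" "E = \<psi> g" "D \<in> \<O>" | "D \<in> \<O>" "E \<in> \<O>"
          using DE(1,2) unfolding \<C>'_def by blast
        then show ?thesis
        proof cases
          case 1
          then show ?thesis using disj_\<psi> DE(3) by blast
        next
          case 2
          then show ?thesis using disj_\<psi>\<O> by blast
        next
          case 3
          then show ?thesis using disj_\<psi>\<O> by blast
        next
          case 4
          then show ?thesis using disj DE(3) by (simp add: \<O>_def)
        qed
      qed
    qed
    then show ?thesis using card' by simp
  qed
qed

text \<open>For the matching that makes all faces of \<open>K\<close> resonant, a forcing set has an
  edge on each face boundary; faces sharing such an edge would share its ends.\<close>

lemma resonant_card_le_forcing:
  assumes K: "resonant_set G K"
  obtains M where "perfect_matching G M" "\<And>S. forcing_set G M S \<Longrightarrow> card K \<le> card S"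
proof -
  obtain M where M: "perfect_matching G M" "\<forall>f\<in>K. resonant_face G M f"
    "\<forall>f\<in>K. \<forall>g\<in>K. f \<noteq> g \<longrightarrow> face_verts G f \<inter> face_verts G g = {}"
    using resonant_setE[OF K] by metis
  have "card K \<le> card S" if S: "forcing_set G M S" for S
  proof -
    have SM: "S \<subseteq> M" "\<And>C. alternating_cycle G M C \<Longrightarrow> S \<inter> C \<noteq> {}"
      using S forcing_set_iff[OF M(1)] by auto
    have MG: "M \<subseteq> edges G" using M(1) by (simp add: perfect_matching_def)
    have "\<exists>e. e \<in> S \<and> e \<subseteq> frontier f" if fK: "f \<in> K" for f
    proof -
      have "resonant_face G M f" using M(2) fK by blast
      then obtain C where C: "frontier f = \<Union>C" "alternating_cycle G M C"
        by (auto simp: resonant_face_def)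
      obtain e where "e \<in> S" "e \<in> C" using SM(2)[OF C(2)] by blast
      then show ?thesis using C(1) by blast
    qed
    then obtain \<epsilon> where \<epsilon>: "\<And>f. f \<in> K \<Longrightarrow> \<epsilon> f \<in> S" "\<And>f. f \<in> K \<Longrightarrow> \<epsilon> f \<subseteq> frontier f" by metis
    have "inj_on \<epsilon> K"
    proof (rule inj_onI, rule ccontr)
      fix f g assume fg: "f \<in> K" "g \<in> K" "\<epsilon> f = \<epsilon> g" "f \<noteq> g"
      have "\<epsilon> f \<in> edges G" using \<epsilon>(1)[OF fg(1)] SM(1) MG by blast
      then obtain v where "v \<in> ends G (\<epsilon> f)" using ends_nonempty by blast
      then have "v \<in> face_verts G f \<inter> face_verts G g"
        using \<epsilon>(2)[OF fg(1)] \<epsilon>(2)[OF fg(2)] fg(3) by (auto simp: face_verts_def ends_def)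
      then show False using M(3) fg by blast
    qed
    moreover have "finite S" using SM(1) MG finite_edges by (meson finite_subset)
    ultimately show ?thesis using \<epsilon>(1) by (meson card_inj_on_le image_subsetI)
  qed
  then show ?thesis using that M(1) by blast
qed

text \<open>\<open>M\<close> meets each of its alternating cycles and is thus a forcing set of
  itself, so the minimum is over a nonempty finite set.\<close>

lemma forcing_number_attained:
  assumes pm: "perfect_matching G M"
  shows "\<exists>S. forcing_set G M S \<and> card S = forcing_number G M"
    "forcing_set G M S \<Longrightarrow> forcing_number G M \<le> card S"
proof -
  have MG: "M \<subseteq> edges G" using pm by (simp add: perfect_matching_def)
  have "finite {S. forcing_set G M S}"
    using finite_subset[OF MG finite_edges] by (rule finite_subset[OF _ finite_Pow_iff[THEN iffD2], rotated]) (auto simp: forcing_set_def)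
  then have fin: "finite {card S | S. forcing_set G M S}" by simp
  interpret matched G P M by unfold_locales (rule pm)
  have "M \<inter> C \<noteq> {}" if "alternating_cycle G M C" for C
    using Z_meets_M[of C] that by (auto simp: Z_def)
  then have "forcing_set G M M" unfolding forcing_set_iff[OF pm] by simp
  then have ne: "{card S | S. forcing_set G M S} \<noteq> {}" by blast
  show "\<exists>S. forcing_set G M S \<and> card S = forcing_number G M"
    using Min_in[OF fin ne] unfolding forcing_number_def by auto
  show "forcing_number G M \<le> card S" if "forcing_set G M S"
    unfolding forcing_number_def using that by (intro Min_le[OF fin]) blast
qed

end

theorem theorem4p1:
  fixes G :: pgraph
  assumes "plane_graph G"
    and "connected_graph G"
    and "bipartite G"
    and "\<exists>M. perfect_matching G M"
    and "\<And>C K. nice_cycle G C \<Longrightarrow> maximum_resonant_set (cycle_interior G C) K \<Longrightarrow>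
           \<exists>!M. perfect_matching (delete_faces (cycle_interior G C) K) M"
  shows "clar_number G = max_forcing_number G"
proof -
  obtain P Q where PQ: "P \<union> Q = verts G" "P \<inter> Q = {}" "\<forall>e\<in>edges G. \<exists>a\<in>P. \<exists>b\<in>Q. ends G e = {a, b}"
    using assms(3) unfolding bipartite_def by blast
  have "verts G - P = Q" using PQ(1,2) by blast
  then interpret plane_bip G P
    using PQ assms(1) by unfold_locales auto
  let ?R = "{card K | K. resonant_set G K}" and ?F = "{forcing_number G M | M. perfect_matching G M}"
  have fin_resonant: "finite ?R"
    by (rule finite_subset[of _ "{..card (verts G)}"]) (use resonant_set_card_le finite_verts in auto)
  \<comment> \<open>The empty set is resonant for any perfect matching, which makes the maximum in
    \<open>clar_number\<close> meaningful.\<close>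
  have "resonant_set G {}" using assms(4) by (simp add: resonant_set_def)
  then have ne_resonant: "?R \<noteq> {}" by blast
  have "finite {M. perfect_matching G M}"
    by (rule finite_subset[of _ "Pow (edges G)"]) (use finite_edges in \<open>auto simp: perfect_matching_def\<close>)
  then have fin_forcing: "finite ?F" by simp
  have ne_forcing: "?F \<noteq> {}" using assms(4) by blast
  have "max_forcing_number G \<in> ?F" unfolding max_forcing_number_def by (rule Max_in[OF fin_forcing ne_forcing])
  then obtain M where M: "perfect_matching G M" "max_forcing_number G = forcing_number G M" by blast
  interpret matched G P M by unfold_locales (rule M(1))
  \<comment> \<open>No forcing set of \<open>M\<close> is smaller than the maximum forcing number,
    so the min-max theorem yields that many cycles with disjoint matching edges.\<close>
  obtain \<C> where \<C>: "finite \<C>" "card \<C> = forcing_number G M" "\<forall>C\<in>\<C>. alternating_cycle G M C"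
    "\<forall>C\<in>\<C>. \<forall>D\<in>\<C>. C \<noteq> D \<longrightarrow> C \<inter> D \<inter> M = {}"
    using forcing_le_disjoint_cycles[OF forcing_number_attained(2)[OF M(1)]] by metis
  have "\<exists>K. resonant_set G K \<and> card K = card \<C>"
  proof (rule disjoint_cycles_resonant[OF assms(5) \<C>(1) M(1)])
    show "alternating_cycle G M C" if "C \<in> \<C>" for C using that \<C>(3) by blast
    show "\<Union>C \<inter> \<Union>D = {}" if "C \<in> \<C>" "D \<in> \<C>" "C \<noteq> D" for C D
      by (rule alternating_disjoint[of M]) (use that \<C>(3,4) M(1) in blast)+
  qed
  then obtain K where "resonant_set G K" "card K = max_forcing_number G" using M(2) \<C>(2) by auto
  then have "max_forcing_number G \<in> ?R" by (intro CollectI exI[of _ K]) simp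
  then have "max_forcing_number G \<le> clar_number G"
    unfolding clar_number_def by (rule Max_ge[OF fin_resonant])
  moreover have "clar_number G \<le> max_forcing_number G"
  proof -
    have "clar_number G \<in> ?R" unfolding clar_number_def by (rule Max_in[OF fin_resonant ne_resonant])
    then obtain K where K: "resonant_set G K" "clar_number G = card K" by blast
    obtain N where N: "perfect_matching G N" "\<And>S. forcing_set G N S \<Longrightarrow> card K \<le> card S"
      using resonant_card_le_forcing[OF K(1)] by metis
    have "card K \<le> forcing_number G N" using forcing_number_attained(1)[OF N(1)] N(2) by metis
    also have "\<dots> \<le> max_forcing_number G"
      unfolding max_forcing_number_def using N(1) by (intro Max_ge[OF fin_forcing]) blast
    finally show ?thesis using K(2) by simp
  qed
  ultimately show ?thesis by simp
qed

end
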